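(* Let $\alpha\in(1,2]$, $|\beta|\le1$, let $X$ be a random variable with $\mathbf{E}X=0$ and $X\in\mathcal{D}(\alpha,\beta)$, and let $\rho\in(0,1)$ be the probability that a random variable with characteristic function $G_{\alpha,\beta}$ is nonnegative. Then for every $r\in(1-\rho,\alpha)$ there exists a function $L_r$, slowly varying at infinity, such that $$\mathbf{E}\bigl(\tau^{(a)}\bigr)^r=L_r(1/a)\,a^{-\alpha(r+\rho-1)/(\alpha-1)}$$ for $a\in(0,a_0]$.
   Context: Let $X,X_1,X_2,\dots$ be i.i.d. with $\mathbf{E}X=0$, and fix $a_0>0$. For $a\in[0,a_0]$ let $S^{(a)}$ be the random walk $S^{(a)}_0=0$, $S^{(a)}_n=\sum_{i=1}^n (X_i-a)$, and let $\tau^{(a)}:=\min\{k\ge1: S^{(a)}_k<0\}$. $X\in\mathcal{D}(\alpha,\beta)$ means that there are constants $b_n>0$ such that $(X_1+\dots+X_n)/b_n$ converges in distribution to the stable law with characteristic function $$G_{\alpha,\beta}(t)=\exp\Bigl\{-|t|^{\alpha}\Bigl(1-i\beta\frac{t}{|t|}\tan\frac{\pi\alpha}{2}\Bigr)\Bigr\}.$$ *)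

theory Defs
  imports "HOL-Probability.Probability"
begin

definition iid_sequence :: "'a measure \<Rightarrow> (nat \<Rightarrow> 'a \<Rightarrow> real) \<Rightarrow> bool" where
  "iid_sequence M X \<longleftrightarrow>
     prob_space.indep_vars M (\<lambda>_. borel) X UNIV \<and>
     (\<forall>i. distr M borel (X i) = distr M borel (X 0))"

text \<open>At \<open>t = 0\<close> the convention \<open>0 / 0 = 0\<close> yields the intended value \<open>1\<close>.\<close>

definition stable_char :: "real \<Rightarrow> real \<Rightarrow> real \<Rightarrow> complex" where
  "stable_char \<alpha> \<beta> t =
     exp (- complex_of_real (\<bar>t\<bar> powr \<alpha>) *
            (1 - \<i> * complex_of_real (\<beta> * (t / \<bar>t\<bar>) * tan (pi * \<alpha> / 2))))"

text \<open>By uniqueness of characteristic functions at most one \<open>\<mu>\<close> satisfies the following.\<close>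

definition stable_law :: "real \<Rightarrow> real \<Rightarrow> real measure \<Rightarrow> bool" where
  "stable_law \<alpha> \<beta> \<mu> \<longleftrightarrow> real_distribution \<mu> \<and> char \<mu> = stable_char \<alpha> \<beta>"

text \<open>
  The attraction property of the common law of an i.i.d. sequence \<open>X\<close>, whose member \<open>X 0\<close>
  is the generic variable and whose members \<open>X 1, X 2, \<dots>\<close> are the summands. There is no
  centering.
\<close>

definition in_domain_of_attraction ::
    "real \<Rightarrow> real \<Rightarrow> 'a measure \<Rightarrow> (nat \<Rightarrow> 'a \<Rightarrow> real) \<Rightarrow> bool" where
  "in_domain_of_attraction \<alpha> \<beta> M X \<longleftrightarrow>
     (\<exists>\<mu> b. stable_law \<alpha> \<beta> \<mu> \<and> (\<forall>n. b n > 0) \<and>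
        weak_conv_m (\<lambda>n. distr M borel (\<lambda>\<omega>. (\<Sum>i=1..n. X i \<omega>) / b n)) \<mu>)"

definition walk :: "(nat \<Rightarrow> 'a \<Rightarrow> real) \<Rightarrow> real \<Rightarrow> nat \<Rightarrow> 'a \<Rightarrow> real" where
  "walk X a n \<omega> = (\<Sum>i=1..n. (X i \<omega> - a))"

text \<open>The infimum of the empty set of extended naturals is \<open>\<infinity>\<close>.\<close>

definition first_negative_time :: "(nat \<Rightarrow> 'a \<Rightarrow> real) \<Rightarrow> real \<Rightarrow> 'a \<Rightarrow> enat" where
  "first_negative_time X a \<omega> = Inf {enat k | k. 1 \<le> k \<and> walk X a k \<omega> < 0}"

text \<open>Real powers of an extended natural; the value at \<open>\<infinity>\<close> is the usual one only for \<open>r > 0\<close>.\<close>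

definition enat_powr :: "enat \<Rightarrow> real \<Rightarrow> ennreal" where
  "enat_powr n r = (case n of enat k \<Rightarrow> ennreal (real k powr r) | \<infinity> \<Rightarrow> \<top>)"

definition slowly_varying_at_infinity :: "(real \<Rightarrow> real) \<Rightarrow> bool" where
  "slowly_varying_at_infinity L \<longleftrightarrow>
     (\<exists>A. set_borel_measurable borel {A..} L \<and> (\<forall>x\<ge>A. L x > 0)) \<and>
     (\<forall>c>0. ((\<lambda>x. L (c * x) / L x) \<longlongrightarrow> 1) at_top)"

end

(*
  Let tau be the first passage time of the walk with drift -a.  Then
    E tau^r = c * (integral over l > 0 of l^(-r-1) * E (1 - exp (-l tau))^2),   0 < r < 2,
  and the Sparre Andersen identity
    1 - E exp (-l tau) = (1 - exp (-l)) * exp (sum over n >= 1 of exp (-l n) P(S_n >= n a) / n)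
  expresses the integrand through one-dimensional probabilities of the driftless walk S.
  Choose N = N(a) with b_N ~ N a.  On the scale l = x / N the exponent, compared with the
  exponent sum exp (-n / N) P(S_n > 0) / n of a regularly varying function of N, converges to an
  integral over the stable law: P(S_n >= n a) -> P(Y >= s^(1 - 1/alpha)) for n ~ s N.
  Small n are controlled by a concentration inequality, large n by a tail bound of order
  (n / N)^(-g) for any g < alpha - 1, both obtained from the characteristic function near zero.
  Dominated convergence gives that E tau^r is asymptotic to a constant multiple of
  N^(r-1) * exp (sum exp (-n / N) P(S_n > 0) / n), which varies regularly in N with index
  r + rho - 1, while N(a) varies regularly at 0 with index -alpha / (alpha - 1).
*)
theory Submission
  imports Defs
begin

section \<open>The Sparre Andersen identity\<close>

text \<open>The hypotheses supply only some norming sequence \<open>b\<close>. It need not be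
  monotone, and the law of \<open>X\<close> may be lattice. So neither the tails of \<open>X\<close>
  nor a theory of regular variation enters: the growth of \<open>b\<close> and the size of
  \<open>\<phi>\<close> near 0 are obtained by evaluating \<open>\<phi> (t / b n) ^ n\<close> at
  well chosen points, and no estimate resolves intervals shorter than a fixed \<open>h0\<close>. As
  \<open>a\<close> tends to 0 the exponents \<open>Q a (1 / N a)\<close> and
  \<open>P (1 / N a)\<close> both grow logarithmically in \<open>N a\<close>; only their differences
  converge, which is why the moment is measured against \<open>exp (P (1 / N a))\<close>. The range
  of \<open>r\<close> is that of the dominating function: the decay rate
  \<open>g < \<alpha> - 1\<close> gives integrability at 0 when \<open>r < \<alpha>\<close>, and the
  growth exponent \<open>1 - \<rho>\<close> of the integrand gives it at infinity when
  \<open>r > 1 - \<rho>\<close>. The limit constant must be positive for ratios of moments to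
  converge. This rests on \<open>\<rho> > 0\<close>, proved from \<open>\<alpha> > 1\<close>: a law
  on the negative half line whose characteristic function is that flat at 0 has no mass
  there.\<close>

definition path_sum :: "(nat \<Rightarrow> real) \<Rightarrow> nat \<Rightarrow> real" where
  "path_sum x n = (\<Sum>i=1..n. x i)"

definition nonneg_upto :: "(nat \<Rightarrow> real) \<Rightarrow> nat \<Rightarrow> bool" where
  "nonneg_upto x n \<longleftrightarrow> (\<forall>k\<in>{1..n}. path_sum x k \<ge> 0)"

text \<open>Strictly descending ladder epochs. Index 0 qualifies vacuously, so the record
  probabilities form a renewal sequence starting at 1.\<close>

definition strict_record :: "(nat \<Rightarrow> real) \<Rightarrow> nat \<Rightarrow> bool" where
  "strict_record x n \<longleftrightarrow> (\<forall>j<n. path_sum x n < path_sum x j)"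

definition first_argmin :: "(nat \<Rightarrow> real) \<Rightarrow> nat \<Rightarrow> nat \<Rightarrow> bool" where
  "first_argmin x n m \<longleftrightarrow> (\<forall>j<m. path_sum x m < path_sum x j) \<and> (\<forall>j\<in>{m..n}. path_sum x m \<le> path_sum x j)"

definition first_neg :: "(nat \<Rightarrow> real) \<Rightarrow> nat \<Rightarrow> bool" where
  "first_neg x k \<longleftrightarrow> k \<ge> 1 \<and> nonneg_upto x (k - 1) \<and> path_sum x k < 0"

text \<open>A rotated path runs through the increments \<open>i + 1, ..., n\<close> and then
  \<open>1, ..., i\<close>. All indices outside \<open>{1..n}\<close> are fixed, so that for
  \<open>i \<le> n\<close> the map is injective on the naturals and acts on infinite
  sequences.\<close>

definition rotate_index :: "nat \<Rightarrow> nat \<Rightarrow> nat \<Rightarrow> nat" where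
  "rotate_index i n l = (if l \<in> {1..n} then (if l + i \<le> n then l + i else l + i - n) else l)"

lemma path_sum_0 [simp]: "path_sum x 0 = 0"
  by (simp add: path_sum_def)

lemma path_sum_Suc: "path_sum x (Suc n) = path_sum x n + x (Suc n)"
  by (simp add: path_sum_def)

lemma path_sum_cong: "(\<And>i. 1 \<le> i \<Longrightarrow> i \<le> n \<Longrightarrow> x i = y i) \<Longrightarrow> path_sum x n = path_sum y n"
  by (auto simp: path_sum_def intro!: sum.cong)

lemma path_sum_shift: "path_sum (\<lambda>i. x (i + k)) n = path_sum x (n + k) - path_sum x k"
  by (induction n) (auto simp: path_sum_Suc)

lemma inj_rotate_index: "i \<le> n \<Longrightarrow> inj (rotate_index i n)"
  by (auto simp: inj_on_def rotate_index_def split: if_splits)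

lemma path_sum_rotate_index_low:
  assumes "l + i \<le> n"
  shows "path_sum (\<lambda>j. x (rotate_index i n j)) l = path_sum x (l + i) - path_sum x i"
proof -
  have "path_sum (\<lambda>j. x (rotate_index i n j)) l = path_sum (\<lambda>j. x (j + i)) l"
    using assms by (intro path_sum_cong) (auto simp: rotate_index_def)
  then show ?thesis by (simp add: path_sum_shift)
qed

lemma path_sum_rotate_index_high:
  assumes "j \<le> i" "i \<le> n"
  shows "path_sum (\<lambda>j. x (rotate_index i n j)) (n - i + j) = path_sum x n - path_sum x i + path_sum x j"
  using assms
proof (induction j)
  case 0
  then show ?case using path_sum_rotate_index_low[of "n - i" i n x] by simp
next
  case (Suc j)
  have "rotate_index i n (Suc (n - i + j)) = Suc j"
    using Suc.prems by (auto simp: rotate_index_def)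
  with Suc show ?case by (simp add: path_sum_Suc)
qed

text \<open>
  The right-hand events for \<open>i < n\<close> partition \<open>path_sum y n < 0\<close>, since the first minimum is
  unique; exchangeability thus turns the
  one-dimensional probability \<open>P(S\<^sub>n < 0)\<close> into a renewal convolution.
\<close>

lemma record_rotate:
  fixes x :: "nat \<Rightarrow> real"
  assumes "i < n" and y_def: "y = (\<lambda>j. x (rotate_index i n j))"
  shows "nonneg_upto x i \<and> strict_record x n \<longleftrightarrow> path_sum y n < 0 \<and> first_argmin y n (n - i)"
proof -
  define m where "m = n - i"
  have low: "path_sum y l = path_sum x (l + i) - path_sum x i" if "l \<le> m" for l
    using that assms(1) unfolding y_def by (intro path_sum_rotate_index_low) (auto simp: m_def)
  have high: "path_sum y (m + j) = path_sum x n - path_sum x i + path_sum x j" if "j \<le> i" for j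
    using that assms(1) unfolding y_def m_def by (intro path_sum_rotate_index_high) auto
  have m: "m + i = n" "m \<ge> 1" using assms(1) by (auto simp: m_def)
  have ym: "path_sum y m = path_sum x n - path_sum x i" using low[of m] m by simp
  have yn: "path_sum y n = path_sum x n" using high[of i] m by simp
  \<comment> \<open>The first \<open>m\<close> steps of \<open>y\<close> compare
    \<open>path_sum x n\<close> with the sums of \<open>x\<close> from \<open>i\<close> on; the last
    \<open>i\<close> steps compare 0 with the sums of \<open>x\<close> up to \<open>i\<close>. The
    latter sums also lie above the final one, being nonnegative while the final one is
    negative.\<close>
  show ?thesis unfolding m_def[symmetric]
  proof safe
    assume nn: "nonneg_upto x i" and rc: "strict_record x n"
    show "path_sum y n < 0" using rc assms(1) yn by (auto simp: strict_record_def dest!: spec[of _ 0])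
    show "first_argmin y n m" unfolding first_argmin_def
    proof (intro conjI allI impI ballI)
      fix j assume "j < m"
      then show "path_sum y m < path_sum y j"
        using rc low[of j] ym m by (auto simp: strict_record_def dest!: spec[of _ "j + i"])
    next
      fix j assume j: "j \<in> {m..n}"
      define l where "l = j - m"
      have l: "j = m + l" "l \<le> i" using j m by (auto simp: l_def)
      have "path_sum x l \<ge> 0"
        using nn l by (cases "l = 0") (auto simp: nonneg_upto_def)
      then show "path_sum y m \<le> path_sum y j" using high[OF l(2)] ym l by simp
    qed
  next
    assume neg: "path_sum y n < 0" and am: "first_argmin y n m"
    have nn: "path_sum x l \<ge> 0" if "l \<le> i" for l
      using am high[OF that] ym m that by (auto simp: first_argmin_def dest!: bspec[of _ _ "m + l"])
    then show "nonneg_upto x i" by (auto simp: nonneg_upto_def)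
    show "strict_record x n" unfolding strict_record_def
    proof (intro allI impI)
      fix j assume "j < n"
      show "path_sum x n < path_sum x j"
      proof (cases "j \<le> i")
        case True
        then show ?thesis using nn[OF True] neg yn by simp
      next
        case False
        then have "j - i < m" using \<open>j < n\<close> m by simp
        then have "path_sum y m < path_sum y (j - i)" using am by (auto simp: first_argmin_def)
        then show ?thesis using low[of "j - i"] \<open>j - i < m\<close> ym False by simp
      qed
    qed
  qed
qed

lemma first_argmin_exists_unique: "\<exists>!m. m \<le> n \<and> first_argmin x n m"
proof -
  define P where "P m \<longleftrightarrow> m \<le> n \<and> (\<forall>j\<le>n. path_sum x m \<le> path_sum x j)" for m
  have "\<exists>m\<in>{..n}. \<forall>j\<in>{..n}. path_sum x m \<le> path_sum x j"
    using ex_min_if_finite[of "path_sum x ` {..n}"] by (force simp: not_less)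
  then have ex: "\<exists>m. P m" by (auto simp: P_def)
  define m where "m = (LEAST m. P m)"
  have Pm: "P m" unfolding m_def using ex by (rule LeastI_ex)
  have "path_sum x m < path_sum x j" if "j < m" for j
  proof -
    have "\<not> P j" using that not_less_Least unfolding m_def by blast
    moreover have "j \<le> n" using that Pm by (auto simp: P_def)
    ultimately obtain l where "l \<le> n" "path_sum x l < path_sum x j"
      by (auto simp: P_def not_le)
    then show ?thesis using Pm by (auto simp: P_def dest: order.strict_trans1)
  qed
  then have m: "m \<le> n \<and> first_argmin x n m" using Pm by (auto simp: first_argmin_def P_def)
  show ?thesis
  proof (rule ex1I[of _ m], rule m)
    fix k assume k: "k \<le> n \<and> first_argmin x n k"
    show "k = m"
    proof (rule ccontr)
      assume "k \<noteq> m"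
      then consider "k < m" | "m < k" by linarith
      then show False
      proof cases
        case 1
        then show False using m k by (auto simp: first_argmin_def dest!: spec[of _ k] bspec[of _ _ m])
      next
        case 2
        then show False using m k by (auto simp: first_argmin_def dest!: spec[of _ m] bspec[of _ _ k])
      qed
    qed
  qed
qed

text \<open>A negative endpoint rules out a first minimum at 0, so the first minimum sits at
  \<open>n - i\<close> for some \<open>i < n\<close>. Unique existence is the shape that
  \<open>pr_partition\<close> consumes.\<close>

lemma path_sum_neg_iff_argmin:
  assumes "n \<ge> 1"
  shows "path_sum x n < 0 \<longleftrightarrow> (\<exists>!i. i < n \<and> path_sum x n < 0 \<and> first_argmin x n (n - i))"
proof
  assume neg: "path_sum x n < 0"
  obtain m where m: "m \<le> n" "first_argmin x n m" "\<And>k. k \<le> n \<Longrightarrow> first_argmin x n k \<Longrightarrow> k = m"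
    using first_argmin_exists_unique[of n x] by blast
  have "m \<noteq> 0"
  proof
    assume "m = 0"
    then have "path_sum x 0 \<le> path_sum x n" using m(2) by (auto simp: first_argmin_def)
    then show False using neg by simp
  qed
  show "\<exists>!i. i < n \<and> path_sum x n < 0 \<and> first_argmin x n (n - i)"
  proof (rule ex1I[of _ "n - m"])
    show "n - m < n \<and> path_sum x n < 0 \<and> first_argmin x n (n - (n - m))"
      using m(1,2) \<open>m \<noteq> 0\<close> neg by simp
    fix i assume "i < n \<and> path_sum x n < 0 \<and> first_argmin x n (n - i)"
    then show "i = n - m" using m(3)[of "n - i"] by auto
  qed
qed auto

text \<open>A strict record at \<open>n \<ge> 1\<close> lies below the start, so the path has become
  negative by time \<open>n\<close>. In terms of the first such time \<open>k\<close>, nonnegativity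
  up to \<open>i\<close> means exactly \<open>k > i\<close>.\<close>

lemma nonneg_record_iff_first_neg:
  assumes "n \<ge> 1"
  shows "nonneg_upto x i \<and> strict_record x n \<longleftrightarrow>
    (\<exists>!k. k \<in> {i+1..n} \<and> first_neg x k \<and> strict_record x n)"
proof
  assume a: "nonneg_upto x i \<and> strict_record x n"
  then have "path_sum x n < 0" using assms by (auto simp: strict_record_def dest!: spec[of _ 0])
  define k where "k = (LEAST k. path_sum x k < 0)"
  have k: "path_sum x k < 0" unfolding k_def using \<open>path_sum x n < 0\<close> by (rule LeastI)
  have kn: "k \<le> n" unfolding k_def using \<open>path_sum x n < 0\<close> by (rule Least_le)
  have nn: "path_sum x j \<ge> 0" if "j < k" for j
    using not_less_Least[of j "\<lambda>k. path_sum x k < 0"] that unfolding k_def by simp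
  have "k \<noteq> 0" using k by (metis path_sum_0 less_irrefl)
  have ik: "i < k" using a k \<open>k \<noteq> 0\<close> by (auto simp: nonneg_upto_def not_less[symmetric] dest!: bspec[of _ _ k])
  show "\<exists>!k. k \<in> {i+1..n} \<and> first_neg x k \<and> strict_record x n"
  proof (rule ex1I[of _ k])
    show "k \<in> {i+1..n} \<and> first_neg x k \<and> strict_record x n"
      using a k kn nn ik by (auto simp: first_neg_def nonneg_upto_def)
    fix l assume l: "l \<in> {i+1..n} \<and> first_neg x l \<and> strict_record x n"
    then have "\<not> l < k" using nn[of l] by (auto simp: first_neg_def)
    moreover have "\<not> k < l" using l k \<open>k \<noteq> 0\<close>
      by (auto simp: first_neg_def nonneg_upto_def dest!: bspec[of _ _ k])
    ultimately show "l = k" by simp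
  qed
next
  assume "\<exists>!k. k \<in> {i+1..n} \<and> first_neg x k \<and> strict_record x n"
  then show "nonneg_upto x i \<and> strict_record x n"
    by (auto simp: first_neg_def nonneg_upto_def)
qed

text \<open>The sums before \<open>k\<close> are nonnegative and the one at \<open>k\<close> is
  negative, so only comparisons with indices from \<open>k\<close> on matter, and these involve only
  increments after \<open>k\<close>. Independence of the two pieces becomes available.\<close>

lemma strict_record_after_first_neg:
  assumes "first_neg x k" "k \<le> n"
  shows "strict_record x n \<longleftrightarrow> strict_record (\<lambda>i. x (i + k)) (n - k)"
proof
  assume "strict_record x n"
  then show "strict_record (\<lambda>i. x (i + k)) (n - k)"
    using assms by (auto simp: strict_record_def path_sum_shift)
next
  assume r: "strict_record (\<lambda>i. x (i + k)) (n - k)"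
  have ge: "path_sum x n < path_sum x j" if "k \<le> j" "j < n" for j
    using r that assms(2) by (auto simp: strict_record_def path_sum_shift dest!: spec[of _ "j - k"])
  have le: "path_sum x n \<le> path_sum x k" using ge[of k] assms(2) by (cases "k = n") auto
  have "path_sum x n < path_sum x j" if "j < k" for j
  proof -
    have "path_sum x j \<ge> 0" using assms(1) that by (cases "j = 0") (auto simp: first_neg_def nonneg_upto_def)
    then show ?thesis using le assms(1) by (auto simp: first_neg_def)
  qed
  then show "strict_record x n" using ge by (auto simp: strict_record_def not_less[symmetric])
qed

section \<open>Path space, exchangeability and independent splitting\<close>

abbreviation path_space :: "(nat \<Rightarrow> real) measure" where
  "path_space \<equiv> PiM UNIV (\<lambda>_. borel)"

lemma measurable_path_sum [measurable]: "(\<lambda>x. path_sum x n) \<in> borel_measurable path_space"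
  unfolding path_sum_def by measurable

lemma pred_nonneg_upto [measurable]: "Measurable.pred path_space (\<lambda>x. nonneg_upto x n)"
  unfolding nonneg_upto_def by measurable

lemma pred_strict_record [measurable]: "Measurable.pred path_space (\<lambda>x. strict_record x n)"
  unfolding strict_record_def by measurable

lemma pred_first_argmin [measurable]: "Measurable.pred path_space (\<lambda>x. first_argmin x n m)"
proof -
  have [measurable]: "Measurable.pred path_space (\<lambda>x. path_sum x m \<le> path_sum x j)" for j
    unfolding not_less[symmetric] by measurable
  have "Measurable.pred path_space (\<lambda>x. \<forall>j<m. path_sum x m < path_sum x j)" by measurable
  moreover have "Measurable.pred path_space (\<lambda>x. \<forall>j\<in>{m..n}. path_sum x m \<le> path_sum x j)"
    by (intro pred_intros_finite) auto
  ultimately show ?thesis unfolding first_argmin_def by (rule pred_intros_logic)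
qed

lemma pred_first_neg [measurable]: "Measurable.pred path_space (\<lambda>x. first_neg x n)"
  unfolding first_neg_def by measurable

locale iid_reals = prob_space M for M :: "'a measure" +
  fixes X :: "nat \<Rightarrow> 'a \<Rightarrow> real"
  assumes iid: "iid_sequence M X"
begin

lemma indep_X: "indep_vars (\<lambda>_. borel) X UNIV"
  and distr_X: "distr M borel (X i) = distr M borel (X 0)"
  using iid unfolding iid_sequence_def by auto

lemma rv_X [measurable]: "X i \<in> borel_measurable M"
  using indep_X by (simp add: indep_vars_def)

lemma rv_path [measurable]: "(\<lambda>\<omega> i. X (f i) \<omega>) \<in> measurable M path_space"
  by (rule measurable_PiM_single') (auto simp: space_PiM)

lemma distr_path: "distr M path_space (\<lambda>\<omega> i. X i \<omega>) = PiM UNIV (\<lambda>_. distr M borel (X 0))"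
proof -
  have "distr M path_space (\<lambda>\<omega>. \<lambda>i\<in>UNIV. X i \<omega>) = PiM UNIV (\<lambda>i. distr M borel (X i))"
    by (rule indep_vars_iff_distr_eq_PiM[THEN iffD1, OF _ _ indep_X]) (simp, rule rv_X)
  also have "\<dots> = PiM UNIV (\<lambda>_. distr M borel (X 0))"
    by (intro PiM_cong refl distr_X)
  finally show ?thesis by (simp add: restrict_def)
qed

text \<open>Exchangeability and stationarity in one: a product of identical factors is invariant
  under every injective reindexing. The rotations and the shifts used below are both of this
  kind.\<close>

lemma distr_path_inj:
  assumes "inj f"
  shows "distr M path_space (\<lambda>\<omega> i. X (f i) \<omega>) = distr M path_space (\<lambda>\<omega> i. X i \<omega>)"
proof -
  let ?N = "\<lambda>_::nat. distr M borel (X 0)"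
  have pr: "prob_space (?N i)" for i by (rule prob_space_distr) simp
  have s: "sets (PiM UNIV ?N) = sets path_space" by (intro sets_PiM_cong) auto
  have "distr M path_space (\<lambda>\<omega> i. X (f i) \<omega>) =
      distr (distr M path_space (\<lambda>\<omega> i. X i \<omega>)) path_space (\<lambda>x i. x (f i))"
    by (subst distr_distr) (auto simp: o_def intro!: measurable_PiM_single' simp: space_PiM)
  also have "\<dots> = distr (PiM UNIV ?N) (PiM UNIV ?N) (\<lambda>x. \<lambda>i\<in>UNIV. x (f i))"
    by (intro distr_cong) (auto simp: distr_path s)
  also have "\<dots> = PiM UNIV ?N"
    using distr_PiM_reindex[of UNIV ?N f UNIV] pr assms by simp
  finally show ?thesis by (simp add: distr_path)
qed

lemma prob_path_inj:
  assumes "inj f" and Q [measurable]: "Measurable.pred path_space Q"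
  shows "prob {\<omega>\<in>space M. Q (\<lambda>i. X (f i) \<omega>)} = prob {\<omega>\<in>space M. Q (\<lambda>i. X i \<omega>)}"
proof -
  have eq: "prob {\<omega>\<in>space M. Q (\<lambda>i. X (g i) \<omega>)}
      = measure (distr M path_space (\<lambda>\<omega> i. X (g i) \<omega>)) {x\<in>space path_space. Q x}" for g
    by (subst measure_distr[OF rv_path]) (use Q in \<open>auto intro!: arg_cong[where f=prob] simp: space_PiM pred_def\<close>)
  show ?thesis using distr_path_inj[OF assms(1)] eq[of f] eq[of "\<lambda>i. i"] by simp
qed

lemma prob_path_split:
  assumes [measurable]: "Measurable.pred path_space Q" "Measurable.pred path_space R"
    and Q: "\<And>x y. (\<And>i. 1 \<le> i \<Longrightarrow> i \<le> k \<Longrightarrow> x i = y i) \<Longrightarrow> Q x \<Longrightarrow> Q y"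
    and R: "\<And>x y. (\<And>i. 1 \<le> i \<Longrightarrow> x i = y i) \<Longrightarrow> R x \<Longrightarrow> R y"
  shows "prob {\<omega>\<in>space M. Q (\<lambda>i. X i \<omega>) \<and> R (\<lambda>i. X (i + k) \<omega>)} =
    prob {\<omega>\<in>space M. Q (\<lambda>i. X i \<omega>)} * prob {\<omega>\<in>space M. R (\<lambda>i. X i \<omega>)}"
proof -
  let ?A = "{1..k}" and ?B = "{k<..}"
  let ?PA = "PiM ?A (\<lambda>_. borel) :: (nat \<Rightarrow> real) measure" and ?PB = "PiM ?B (\<lambda>_. borel) :: (nat \<Rightarrow> real) measure"
  \<comment> \<open>\<open>e\<close> and \<open>h\<close> pad restricted paths with zeros to full
    sequences; \<open>Q\<close> and \<open>R\<close> cannot see the filled-in values. Coordinate 0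
    belongs to neither block, since sums start at 1.\<close>
  define e where "e y = (\<lambda>i. if i \<in> ?A then y i else 0)" for y :: "nat \<Rightarrow> real"
  define h where "h y = (\<lambda>i. if i \<ge> 1 then y (i + k) else 0)" for y :: "nat \<Rightarrow> real"
  have [measurable]: "e \<in> measurable ?PA path_space"
    unfolding e_def
  proof (rule measurable_PiM_single')
    show "(\<lambda>y. if i \<in> ?A then y i else 0) \<in> borel_measurable ?PA" for i
      by (cases "i \<in> ?A") (simp_all del: atLeastAtMost_iff)
  qed (auto simp: space_PiM)
  have [measurable]: "h \<in> measurable ?PB path_space"
    unfolding h_def
  proof (rule measurable_PiM_single')
    show "(\<lambda>y. if i \<ge> 1 then y (i + k) else 0) \<in> borel_measurable ?PB" for i
      by (cases "i \<ge> 1") simp_all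
  qed (auto simp: space_PiM)
  have ind: "indep_var ?PA (\<lambda>\<omega>. restrict (\<lambda>i. X i \<omega>) ?A) ?PB (\<lambda>\<omega>. restrict (\<lambda>i. X i \<omega>) ?B)"
    by (rule indep_var_restrict[OF indep_X]) auto
  have QA: "Q (\<lambda>i. X i \<omega>) \<longleftrightarrow> Q (e (restrict (\<lambda>i. X i \<omega>) ?A))" for \<omega>
    by (auto intro: Q[rotated] simp: e_def)
  have RB: "R (\<lambda>i. X (i + k) \<omega>) \<longleftrightarrow> R (h (restrict (\<lambda>i. X i \<omega>) ?B))" for \<omega>
    by (auto intro: R[rotated] simp: h_def)
  have "prob ((\<lambda>\<omega>. (restrict (\<lambda>i. X i \<omega>) ?A, restrict (\<lambda>i. X i \<omega>) ?B)) -`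
       ({y\<in>space ?PA. Q (e y)} \<times> {y\<in>space ?PB. R (h y)}) \<inter> space M) =
     prob ((\<lambda>\<omega>. restrict (\<lambda>i. X i \<omega>) ?A) -` {y\<in>space ?PA. Q (e y)} \<inter> space M) *
     prob ((\<lambda>\<omega>. restrict (\<lambda>i. X i \<omega>) ?B) -` {y\<in>space ?PB. R (h y)} \<inter> space M)"
    by (rule indep_varD[OF ind]) measurable
  moreover have "(\<lambda>\<omega>. (restrict (\<lambda>i. X i \<omega>) ?A, restrict (\<lambda>i. X i \<omega>) ?B)) -`
       ({y\<in>space ?PA. Q (e y)} \<times> {y\<in>space ?PB. R (h y)}) \<inter> space M =
     {\<omega>\<in>space M. Q (\<lambda>i. X i \<omega>) \<and> R (\<lambda>i. X (i + k) \<omega>)}"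
    by (auto simp: QA RB space_PiM)
  moreover have "(\<lambda>\<omega>. restrict (\<lambda>i. X i \<omega>) ?A) -` {y\<in>space ?PA. Q (e y)} \<inter> space M =
     {\<omega>\<in>space M. Q (\<lambda>i. X i \<omega>)}"
    by (auto simp: QA space_PiM)
  moreover have "(\<lambda>\<omega>. restrict (\<lambda>i. X i \<omega>) ?B) -` {y\<in>space ?PB. R (h y)} \<inter> space M =
     {\<omega>\<in>space M. R (\<lambda>i. X (i + k) \<omega>)}"
    by (auto simp: RB space_PiM)
  ultimately show ?thesis
    using prob_path_inj[of "\<lambda>i. i + k" R] by (simp add: inj_def)
qed

section \<open>Renewal identities and their generating functions\<close>

definition pr :: "((nat \<Rightarrow> real) \<Rightarrow> bool) \<Rightarrow> real" where
  "pr Q = prob {\<omega>\<in>space M. Q (\<lambda>i. X i \<omega>)}"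

lemma pr_nonneg [simp]: "pr Q \<ge> 0" and pr_le_1 [simp]: "pr Q \<le> 1"
  by (auto simp: pr_def)

lemma pr_cong: "(\<And>x. Q x \<longleftrightarrow> R x) \<Longrightarrow> pr Q = pr R"
  by (auto simp: pr_def)

lemma pr_partition:
  assumes I: "finite I" and m [measurable]: "\<And>i. i \<in> I \<Longrightarrow> Measurable.pred path_space (R i)"
    and QR: "\<And>x. Q x \<longleftrightarrow> (\<exists>!i. i \<in> I \<and> R i x)"
    and R: "\<And>x i j. i \<in> I \<Longrightarrow> j \<in> I \<Longrightarrow> R i x \<Longrightarrow> R j x \<Longrightarrow> i = j"
  shows "pr Q = (\<Sum>i\<in>I. pr (R i))"
proof -
  have "{\<omega>\<in>space M. Q (\<lambda>i. X i \<omega>)} = (\<Union>i\<in>I. {\<omega>\<in>space M. R i (\<lambda>i. X i \<omega>)})"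
  proof (intro set_eqI)
    fix \<omega>
    have "Q (\<lambda>i. X i \<omega>) \<longleftrightarrow> (\<exists>i\<in>I. R i (\<lambda>i. X i \<omega>))"
      using QR[of "\<lambda>i. X i \<omega>"] R[of _ _ "\<lambda>i. X i \<omega>"] by metis
    then show "\<omega> \<in> {\<omega>\<in>space M. Q (\<lambda>i. X i \<omega>)} \<longleftrightarrow> \<omega> \<in> (\<Union>i\<in>I. {\<omega>\<in>space M. R i (\<lambda>i. X i \<omega>)})"
      by auto
  qed
  moreover have "prob (\<Union>i\<in>I. {\<omega>\<in>space M. R i (\<lambda>i. X i \<omega>)}) = (\<Sum>i\<in>I. prob {\<omega>\<in>space M. R i (\<lambda>i. X i \<omega>)})"
  proof (rule finite_measure_finite_Union[OF I])
    show "(\<lambda>i. {\<omega>\<in>space M. R i (\<lambda>i. X i \<omega>)}) ` I \<subseteq> events"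
      using measurable_compose[OF rv_path[of "\<lambda>i. i"] m] by (simp add: pred_def image_subset_iff)
    show "disjoint_family_on (\<lambda>i. {\<omega>\<in>space M. R i (\<lambda>i. X i \<omega>)}) I"
      using R by (auto simp: disjoint_family_on_def)
  qed
  ultimately show ?thesis by (simp add: pr_def)
qed

lemma pr_first_neg_record:
  assumes "k \<le> n"
  shows "pr (\<lambda>x. first_neg x k \<and> strict_record x n) =
    pr (\<lambda>x. first_neg x k) * pr (\<lambda>x. strict_record x (n - k))"
proof -
  have "pr (\<lambda>x. first_neg x k \<and> strict_record x n) =
      prob {\<omega>\<in>space M. first_neg (\<lambda>i. X i \<omega>) k \<and> strict_record (\<lambda>i. X (i + k) \<omega>) (n - k)}"
    using strict_record_after_first_neg[OF _ assms] by (auto simp: pr_def intro!: arg_cong[where f=prob])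
  also have "\<dots> = pr (\<lambda>x. first_neg x k) * pr (\<lambda>x. strict_record x (n - k))"
    unfolding pr_def
  proof (rule prob_path_split)
    fix x y :: "nat \<Rightarrow> real"
    assume eq: "\<And>i. 1 \<le> i \<Longrightarrow> i \<le> k \<Longrightarrow> x i = y i" and x: "first_neg x k"
    have "path_sum x j = path_sum y j" if "j \<le> k" for j
      using eq that by (intro path_sum_cong) auto
    then have "path_sum y j = path_sum x j" if "j \<in> {1..k - 1} \<union> {k}" for j
      using that by (metis UnE atLeastAtMost_iff diff_le_self le_trans order_refl singletonD)
    then show "first_neg y k" using x by (simp add: first_neg_def nonneg_upto_def)
  next
    fix x y :: "nat \<Rightarrow> real"
    assume eq: "\<And>i. 1 \<le> i \<Longrightarrow> x i = y i" and x: "strict_record x (n - k)"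
    have "path_sum x j = path_sum y j" for j
      using eq by (intro path_sum_cong) auto
    then show "strict_record y (n - k)" using x by (auto simp: strict_record_def)
  qed measurable
  finally show ?thesis .
qed

lemma pr_nonneg_record:
  assumes "n \<ge> 1"
  shows "pr (\<lambda>x. nonneg_upto x i \<and> strict_record x n) =
    (\<Sum>k\<in>{i+1..n}. pr (\<lambda>x. first_neg x k) * pr (\<lambda>x. strict_record x (n - k)))"
proof -
  have "pr (\<lambda>x. nonneg_upto x i \<and> strict_record x n) =
      (\<Sum>k\<in>{i+1..n}. pr (\<lambda>x. first_neg x k \<and> strict_record x n))"
  proof (rule pr_partition)
    fix x k l assume *: "k \<in> {i+1..n}" "l \<in> {i+1..n}"
      "first_neg x k \<and> strict_record x n" "first_neg x l \<and> strict_record x n"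
    then have "nonneg_upto x i \<and> strict_record x n"
      by (auto simp: first_neg_def nonneg_upto_def)
    with nonneg_record_iff_first_neg[OF assms] * show "k = l" by blast
  qed (use nonneg_record_iff_first_neg[OF assms] in auto)
  then show ?thesis by (simp add: pr_first_neg_record)
qed

lemma pr_record_renewal:
  assumes "n \<ge> 1"
  shows "pr (\<lambda>x. strict_record x n) =
    (\<Sum>k\<in>{1..n}. pr (\<lambda>x. first_neg x k) * pr (\<lambda>x. strict_record x (n - k)))"
proof -
  have "pr (\<lambda>x. strict_record x n) = pr (\<lambda>x. nonneg_upto x 0 \<and> strict_record x n)"
    by (rule pr_cong) (simp add: nonneg_upto_def)
  then show ?thesis using pr_nonneg_record[OF assms, of 0] by simp
qed

lemma sum_triangle:
  fixes c :: "nat \<Rightarrow> real"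
  shows "(\<Sum>i<n. \<Sum>k\<in>{i+1..n}. c k) = (\<Sum>k\<in>{1..n}. real k * c k)"
proof -
  have "(\<Sum>i<n. \<Sum>k\<in>{i+1..n}. c k) = (\<Sum>i<n. \<Sum>k\<in>{1..n}. if i < k then c k else 0)"
    by (intro sum.cong refl sum.mono_neutral_cong_left) auto
  also have "\<dots> = (\<Sum>k\<in>{1..n}. \<Sum>i<n. if i < k then c k else 0)"
    by (rule sum.swap)
  also have "\<dots> = (\<Sum>k\<in>{1..n}. real k * c k)"
  proof (rule sum.cong[OF refl])
    fix k assume k: "k \<in> {1..n}"
    have "(\<Sum>i<n. if i < k then c k else 0) = (\<Sum>i<k. c k)"
      using k by (intro sum.mono_neutral_cong_right) auto
    then show "(\<Sum>i<n. if i < k then c k else 0) = real k * c k" by simp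
  qed
  finally show ?thesis .
qed

text \<open>Rotation turns "first minimum at \<open>n - i\<close>" into "nonnegative up to
  \<open>i\<close>, record at \<open>n\<close>". Decomposing the latter at the first passage
  \<open>k > i\<close> and summing over \<open>i < n\<close> counts each \<open>k\<close> exactly
  \<open>k\<close> times.\<close>

lemma pr_path_sum_neg:
  assumes "n \<ge> 1"
  shows "pr (\<lambda>x. path_sum x n < 0) =
    (\<Sum>k\<in>{1..n}. real k * pr (\<lambda>x. first_neg x k) * pr (\<lambda>x. strict_record x (n - k)))"
proof -
  have "pr (\<lambda>x. path_sum x n < 0) = (\<Sum>i<n. pr (\<lambda>x. path_sum x n < 0 \<and> first_argmin x n (n - i)))"
  proof (rule pr_partition)
    fix x i j assume *: "i \<in> {..<n}" "j \<in> {..<n}"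
      "path_sum x n < 0 \<and> first_argmin x n (n - i)" "path_sum x n < 0 \<and> first_argmin x n (n - j)"
    with path_sum_neg_iff_argmin[OF assms, of x] show "i = j" by blast
  qed (use path_sum_neg_iff_argmin[OF assms] in auto)
  also have "\<dots> = (\<Sum>i<n. pr (\<lambda>x. nonneg_upto x i \<and> strict_record x n))"
  proof (rule sum.cong[OF refl])
    fix i assume "i \<in> {..<n}"
    then have i: "i < n" by simp
    have "pr (\<lambda>x. path_sum x n < 0 \<and> first_argmin x n (n - i)) =
      prob {\<omega>\<in>space M. path_sum (\<lambda>j. X (rotate_index i n j) \<omega>) n < 0 \<and> first_argmin (\<lambda>j. X (rotate_index i n j) \<omega>) n (n - i)}"
      unfolding pr_def using i by (intro prob_path_inj[symmetric] inj_rotate_index) measurable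
    also have "\<dots> = pr (\<lambda>x. nonneg_upto x i \<and> strict_record x n)"
      unfolding pr_def using record_rotate[OF i refl] by simp
    finally show "pr (\<lambda>x. path_sum x n < 0 \<and> first_argmin x n (n - i)) =
      pr (\<lambda>x. nonneg_upto x i \<and> strict_record x n)" .
  qed
  finally show ?thesis
    by (simp add: pr_nonneg_record[OF assms] sum_triangle[simplified] mult.assoc)
qed

text \<open>
  With \<open>H\<close>, \<open>G\<close>, \<open>B\<close> the generating functions of first passage, records and \<open>P(S\<^sub>n < 0) / n\<close>,
  the two convolution identities read \<open>G (1 - H) = 1\<close> and \<open>B' = H' G\<close>, so
  \<open>(1 - H) exp B\<close> has derivative zero.
\<close>

theorem sparre_andersen:
  assumes "0 \<le> z" "z < 1"
  shows "1 - (\<Sum>n. pr (\<lambda>x. first_neg x n) * z ^ n) =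
    exp (- (\<Sum>n. pr (\<lambda>x. path_sum x n < 0) / real n * z ^ n))"
proof -
  define f where "f n = pr (\<lambda>x. first_neg x n)" for n
  define g where "g n = pr (\<lambda>x. strict_record x n)" for n
  define w where "w n = pr (\<lambda>x. path_sum x n < 0)" for n
  have f0: "f 0 = 0" by (simp add: f_def first_neg_def pr_def)
  have g0: "g 0 = 1" by (simp add: g_def strict_record_def pr_def prob_space)
  have bd: "\<bar>f n\<bar> \<le> 1" "\<bar>g n\<bar> \<le> 1" "\<bar>w n\<bar> \<le> 1" for n
    by (simp_all add: f_def g_def w_def)
  have sm: "summable (\<lambda>n. \<bar>c n * t ^ n\<bar>)" if "\<And>n. \<bar>c n\<bar> \<le> 1" "\<bar>t\<bar> < 1" for c :: "nat \<Rightarrow> real" and t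
  proof (rule summable_comparison_test'[of "\<lambda>n. \<bar>t\<bar> ^ n" 0])
    show "summable (\<lambda>n. \<bar>t\<bar> ^ n)" using that by (simp add: summable_geometric)
    show "norm \<bar>c n * t ^ n\<bar> \<le> \<bar>t\<bar> ^ n" for n
      using that(1)[of n] by (simp add: abs_mult power_abs mult_left_le_one_le)
  qed
  have sm': "summable (\<lambda>n. c n * t ^ n)" if "\<And>n. \<bar>c n\<bar> \<le> 1" "\<bar>t\<bar> < 1" for c :: "nat \<Rightarrow> real" and t
    using sm[OF that] by (rule summable_rabs_cancel)
  define H where "H t = (\<Sum>n. f n * t ^ n)" for t :: real
  define G where "G t = (\<Sum>n. g n * t ^ n)" for t :: real
  \<comment> \<open>The term at \<open>n = 0\<close> is 0, since division by 0 gives 0.\<close>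
  define B where "B t = (\<Sum>n. w n / real n * t ^ n)" for t :: real
  \<comment> \<open>The renewal convolution holds for \<open>n \<ge> 1\<close>; at
    \<open>n = 0\<close> the convolution is 0 while \<open>g 0 = 1\<close>, which produces the
    \<open>- 1\<close>.\<close>
  have HG: "H t * G t = G t - 1" if t: "\<bar>t\<bar> < 1" for t
  proof -
    have "H t * G t = (\<Sum>n. \<Sum>k\<le>n. f k * t ^ k * (g (n - k) * t ^ (n - k)))"
      unfolding H_def G_def using sm[OF bd(1) t] sm[OF bd(2) t] by (intro Cauchy_product) auto
    also have "(\<lambda>n. \<Sum>k\<le>n. f k * t ^ k * (g (n - k) * t ^ (n - k))) = (\<lambda>n. g n * t ^ n - (if n = 0 then 1 else 0))"
    proof
      fix n
      have "(\<Sum>k\<le>n. f k * t ^ k * (g (n - k) * t ^ (n - k))) = (\<Sum>k\<le>n. f k * g (n - k)) * t ^ n"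
        unfolding sum_distrib_right
      proof (rule sum.cong[OF refl])
        fix k assume "k \<in> {..n}"
        then have "t ^ n = t ^ k * t ^ (n - k)" by (simp flip: power_add)
        then show "f k * t ^ k * (g (n - k) * t ^ (n - k)) = f k * g (n - k) * t ^ n"
          by (simp only: mult_ac)
      qed
      also have "(\<Sum>k\<le>n. f k * g (n - k)) = (\<Sum>k\<in>{1..n}. f k * g (n - k))"
        by (rule sum.mono_neutral_right) (use f0 in \<open>auto simp: not_le intro: Suc_leI gr0I\<close>)
      also have "\<dots> = g n - (if n = 0 then 1 else 0)"
        using pr_record_renewal[of n] g0 by (cases "n = 0") (auto simp: f_def g_def)
      finally show "(\<Sum>k\<le>n. f k * t ^ k * (g (n - k) * t ^ (n - k))) = g n * t ^ n - (if n = 0 then 1 else 0)"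
        by (simp add: left_diff_distrib)
    qed
    also have "(\<Sum>n. g n * t ^ n - (if n = 0 then 1 else 0)) = G t - (\<Sum>n. if n = 0 then 1 else 0)"
      unfolding G_def by (rule suminf_diff[symmetric, OF sm'[OF bd(2) t]]) (rule summable_If_finite, simp)
    also have "(\<Sum>n. if n = 0 then 1 else 0) = (1::real)"
      using suminf_finite[of "{0}" "\<lambda>n. if n = 0 then 1 else (0::real)"] by simp
    finally show ?thesis .
  qed
  have dH: "(H has_real_derivative (\<Sum>n. diffs f n * t ^ n)) (at t)" if t: "\<bar>t\<bar> < 1" for t
    unfolding H_def
    by (rule termdiffs_strong[of f "(\<bar>t\<bar> + 1) / 2"]) (use t in \<open>auto intro!: sm'[OF bd(1)]\<close>)
  have bB: "\<bar>w n / real n\<bar> \<le> 1" for n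
    using bd(3)[of n] by (cases "n = 0") (auto simp: divide_simps)
  have dB: "(B has_real_derivative (\<Sum>n. diffs (\<lambda>n. w n / real n) n * t ^ n)) (at t)" if t: "\<bar>t\<bar> < 1" for t
    unfolding B_def
    by (rule termdiffs_strong[of "\<lambda>n. w n / real n" "(\<bar>t\<bar> + 1) / 2", OF sm'[OF bB]]) (use t in auto)
  have dfs: "summable (\<lambda>n. \<bar>diffs f n * t ^ n\<bar>)" if t: "\<bar>t\<bar> < 1" for t
  proof -
    have "summable (\<lambda>n. diffs f n * \<bar>t\<bar> ^ n)"
      by (rule termdiff_converges[of "\<bar>t\<bar>" 1]) (use t in \<open>auto intro!: sm'[OF bd(1)]\<close>)
    moreover have "\<bar>diffs f n * t ^ n\<bar> = diffs f n * \<bar>t\<bar> ^ n" for n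
      by (simp add: diffs_def f_def abs_mult power_abs)
    ultimately show ?thesis by simp
  qed
  have key: "(\<Sum>n. diffs (\<lambda>n. w n / real n) n * t ^ n) = (\<Sum>n. diffs f n * t ^ n) * G t" if t: "\<bar>t\<bar> < 1" for t
  proof -
    have "(\<Sum>n. diffs f n * t ^ n) * G t = (\<Sum>n. \<Sum>k\<le>n. diffs f k * t ^ k * (g (n - k) * t ^ (n - k)))"
      unfolding G_def using dfs[OF t] sm[OF bd(2) t] by (intro Cauchy_product) auto
    also have "(\<lambda>n. \<Sum>k\<le>n. diffs f k * t ^ k * (g (n - k) * t ^ (n - k))) = (\<lambda>n. diffs (\<lambda>n. w n / real n) n * t ^ n)"
    proof
      fix n
      have "(\<Sum>k\<le>n. diffs f k * t ^ k * (g (n - k) * t ^ (n - k))) = (\<Sum>k\<le>n. diffs f k * g (n - k)) * t ^ n"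
        unfolding sum_distrib_right
      proof (rule sum.cong[OF refl])
        fix k assume "k \<in> {..n}"
        then have "t ^ n = t ^ k * t ^ (n - k)" by (simp flip: power_add)
        then show "diffs f k * t ^ k * (g (n - k) * t ^ (n - k)) = diffs f k * g (n - k) * t ^ n"
          by (simp only: mult_ac)
      qed
      \<comment> \<open>\<open>diffs\<close> shifts the index and multiplies by it, which absorbs
        the factor \<open>k\<close> of \<open>pr_path_sum_neg\<close> into the derivative of
        \<open>H\<close>.\<close>
      also have "(\<Sum>k\<le>n. diffs f k * g (n - k)) = w (Suc n)"
        using pr_path_sum_neg[of "Suc n"] sum.shift_bounds_cl_Suc_ivl[of "\<lambda>k. real k * f k * g (Suc n - k)" 0 n]
        by (simp add: w_def f_def g_def diffs_def atMost_atLeast0 mult_ac)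
      also have "w (Suc n) = diffs (\<lambda>n. w n / real n) n" by (simp add: diffs_def)
      finally show "(\<Sum>k\<le>n. diffs f k * t ^ k * (g (n - k) * t ^ (n - k))) = diffs (\<lambda>n. w n / real n) n * t ^ n" .
    qed
    finally show ?thesis by simp
  qed
  define A where "A t = (1 - H t) * exp (B t)" for t
  have "(A has_real_derivative 0) (at t within {0..z})" if "t \<in> {0..z}" for t
  proof -
    have t: "\<bar>t\<bar> < 1" using that assms by auto
    have "(1 - H t) * G t = 1" using HG[OF t] by (simp add: algebra_simps)
    then have "- (\<Sum>n. diffs f n * t ^ n) + (1 - H t) * ((\<Sum>n. diffs f n * t ^ n) * G t) = 0"
      by (simp add: mult.left_commute)
    then have "exp (B t) * (- (\<Sum>n. diffs f n * t ^ n) + (1 - H t) * ((\<Sum>n. diffs f n * t ^ n) * G t)) = 0"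
      by simp
    then have *: "- (\<Sum>n. diffs f n * t ^ n) * exp (B t) + exp (B t) * ((\<Sum>n. diffs f n * t ^ n) * G t) * (1 - H t) = 0"
      by (simp only: distrib_left mult_ac)
    have "(A has_real_derivative (- (\<Sum>n. diffs f n * t ^ n) * exp (B t) + exp (B t) * ((\<Sum>n. diffs f n * t ^ n) * G t) * (1 - H t))) (at t)"
      unfolding A_def key[OF t, symmetric]
      by (rule derivative_eq_intros dH[OF t] dB[OF t] refl)+ simp
    then show ?thesis unfolding * by (rule has_field_derivative_at_within)
  qed
  then obtain c where c: "\<And>t. t \<in> {0..z} \<Longrightarrow> A t = c"
    using has_field_derivative_zero_constant[of "{0..z}" A] by auto
  have "A 0 = 1"
    using powser_zero[of f] powser_zero[of "\<lambda>n. w n / real n"] by (simp add: A_def H_def B_def f0)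
  then have "A z = 1" using c[of 0] c[of z] assms by simp
  then have "1 - H z = exp (- B z)"
    by (simp add: A_def exp_minus field_simps)
  then show ?thesis by (simp add: H_def B_def f_def w_def)
qed

end

section \<open>Norming sequences and characteristic functions near zero\<close>

text \<open>Abstract setting for one increment with characteristic function \<open>\<phi>\<close>
  and a limit \<open>G\<close>. Apart from behaviour at 0 it records only locally uniform
  convergence of the powers and the modulus of \<open>G\<close>; comparability and regular variation
  of \<open>b\<close> are derived from this.\<close>

locale attraction =
  fixes \<phi> G :: "real \<Rightarrow> complex" and b :: "nat \<Rightarrow> real" and \<alpha> :: real
  assumes \<phi>_cont: "isCont \<phi> 0" and \<phi>_0: "\<phi> 0 = 1" and \<phi>_le: "cmod (\<phi> t) \<le> 1"
    and b_pos: "b n > 0"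
    and conv: "uniform_limit {-T..T} (\<lambda>n t. \<phi> (t / b n) ^ n) G sequentially"
    and G_norm: "cmod (G t) = exp (- (\<bar>t\<bar> powr \<alpha>))"
    and G_cont: "isCont G 0" and G_0: "G 0 = 1"
    and \<alpha>: "\<alpha> > 1"
begin

section \<open>Convergence of the moduli and growth of the norming sequence\<close>

lemma conv_unif:
  assumes "e > 0"
  shows "\<exists>n0. \<forall>n\<ge>n0. \<forall>t. \<bar>t\<bar> \<le> T \<longrightarrow> cmod (\<phi> (t / b n) ^ n - G t) < e"
  using uniform_limitD[OF conv[of T] assms] unfolding eventually_sequentially
  by (force simp: dist_norm abs_le_iff)

lemma norm_conv_unif:
  assumes "e > 0"
  shows "\<exists>n0. \<forall>n\<ge>n0. \<forall>t. \<bar>t\<bar> \<le> T \<longrightarrow> \<bar>cmod (\<phi> (t / b n)) ^ n - exp (- (\<bar>t\<bar> powr \<alpha>))\<bar> < e"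
proof -
  have "\<bar>cmod (\<phi> (t / b n)) ^ n - exp (- (\<bar>t\<bar> powr \<alpha>))\<bar> \<le> cmod (\<phi> (t / b n) ^ n - G t)" for n t
    using norm_triangle_ineq3[of "\<phi> (t / b n) ^ n" "G t"] by (simp add: G_norm norm_power)
  with conv_unif[OF assms, of T] show ?thesis by (meson le_less_trans)
qed

lemma norm_conv_filter:
  assumes n: "filterlim n sequentially F" and t: "\<And>i. \<bar>t i\<bar> \<le> T"
  shows "((\<lambda>i. cmod (\<phi> (t i / b (n i))) ^ n i - exp (- (\<bar>t i\<bar> powr \<alpha>))) \<longlongrightarrow> 0) F"
proof (rule tendstoI)
  fix e :: real assume "e > 0"
  then obtain n0 where "\<forall>n\<ge>n0. \<forall>t. \<bar>t\<bar> \<le> T \<longrightarrow> \<bar>cmod (\<phi> (t / b n)) ^ n - exp (- (\<bar>t\<bar> powr \<alpha>))\<bar> < e"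
    using norm_conv_unif by blast
  moreover have "eventually (\<lambda>i. n i \<ge> n0) F"
    using n by (auto simp: filterlim_at_top)
  ultimately show "eventually (\<lambda>i. dist (cmod (\<phi> (t i / b (n i))) ^ n i - exp (- (\<bar>t i\<bar> powr \<alpha>))) 0 < e) F"
    using t by (auto elim!: eventually_mono)
qed

lemma norm_conv_1:
  assumes n: "filterlim n sequentially F"
  shows "((\<lambda>i. cmod (\<phi> (1 / b (n i))) ^ n i) \<longlongrightarrow> exp (- 1)) F"
  using norm_conv_filter[OF n, of "\<lambda>_. 1" 1] by (simp add: LIM_zero_iff)

text \<open>Suppose \<open>b n < B\<close> infinitely often. If \<open>cmod (\<phi> u) < 1\<close>,
  its powers tend to 0, yet along these \<open>n\<close> the point \<open>u * b n\<close> stays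
  bounded and the limit modulus stays away from 0. So \<open>\<phi>\<close> would have modulus 1
  everywhere, contradicting the limit \<open>exp (- 1)\<close> at \<open>t = 1\<close>.\<close>

lemma b_at_top: "filterlim b at_top sequentially"
proof (rule ccontr)
  assume "\<not> filterlim b at_top sequentially"
  then obtain B where B: "\<not> eventually (\<lambda>n. b n \<ge> B) sequentially"
    by (auto simp: filterlim_at_top)
  have one: "cmod (\<phi> u) = 1" for u
  proof (rule ccontr)
    assume "cmod (\<phi> u) \<noteq> 1"
    then have u: "cmod (\<phi> u) < 1" using \<phi>_le[of u] by simp
    define T where "T = \<bar>u\<bar> * \<bar>B\<bar>"
    define c where "c = exp (- (T powr \<alpha>)) / 2"
    have c: "c > 0" by (simp add: c_def)
    obtain n0 where n0: "\<forall>n\<ge>n0. \<forall>t. \<bar>t\<bar> \<le> T \<longrightarrow> \<bar>cmod (\<phi> (t / b n)) ^ n - exp (- (\<bar>t\<bar> powr \<alpha>))\<bar> < c"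
      using norm_conv_unif[OF c] by blast
    have "eventually (\<lambda>n. cmod (\<phi> u) ^ n < c) sequentially"
      using LIMSEQ_power_zero[of "cmod (\<phi> u)"] u c by (auto intro: order_tendstoD)
    then have "eventually (\<lambda>n. b n \<ge> B) sequentially"
      using eventually_ge_at_top[of n0]
    proof eventually_elim
      case (elim n)
      show ?case
      proof (rule ccontr)
        assume "\<not> b n \<ge> B"
        then have le: "\<bar>u * b n\<bar> \<le> T"
          using b_pos[of n] by (auto simp: T_def abs_mult intro!: mult_left_mono)
        have "exp (- (T powr \<alpha>)) \<le> exp (- (\<bar>u * b n\<bar> powr \<alpha>))"
          using le \<alpha> by (auto intro!: powr_mono2)
        moreover have "\<bar>cmod (\<phi> (u * b n / b n)) ^ n - exp (- (\<bar>u * b n\<bar> powr \<alpha>))\<bar> < c"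
          using n0 elim(2) le by blast
        moreover have "u * b n / b n = u" using b_pos[of n] by simp
        ultimately have "cmod (\<phi> u) ^ n > c"
          unfolding c_def by (simp only: abs_less_iff) linarith
        then show False using elim(1) by simp
      qed
    qed
    then show False using B by simp
  qed
  have "(\<lambda>n. 1::real) \<longlonglongrightarrow> exp (- 1)"
    using norm_conv_1[OF filterlim_ident] by (simp add: one)
  then show False using LIMSEQ_unique[OF tendsto_const] by fastforce
qed

text \<open>The \<open>n\<close>-th powers tend to \<open>exp (- 1)\<close>; raise them to the
  exponent \<open>m / n\<close>, which tends to \<open>s\<close>. Eventual positivity of the modulus
  makes real powers legitimate.\<close>

lemma norm_power_quot:
  assumes m: "filterlim m sequentially F" and n: "filterlim n sequentially F"
    and s: "((\<lambda>i. real (m i) / real (n i)) \<longlongrightarrow> s) F"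
  shows "((\<lambda>i. cmod (\<phi> (1 / b (n i))) ^ m i) \<longlongrightarrow> exp (- s)) F"
proof -
  let ?x = "\<lambda>i. cmod (\<phi> (1 / b (n i)))"
  have lim: "((\<lambda>i. ?x i ^ n i) \<longlongrightarrow> exp (- 1)) F" by (rule norm_conv_1[OF n])
  have "((\<lambda>i. (?x i ^ n i) powr (real (m i) / real (n i))) \<longlongrightarrow> exp (- 1) powr s) F"
    by (rule tendsto_powr[OF lim s]) simp
  moreover have "eventually (\<lambda>i. (?x i ^ n i) powr (real (m i) / real (n i)) = ?x i ^ m i) F"
  proof -
    have "eventually (\<lambda>i. n i \<ge> 1) F" using n by (auto simp: filterlim_at_top)
    moreover have "eventually (\<lambda>i. ?x i ^ n i > 0) F" using order_tendstoD(1)[OF lim, of 0] by simp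
    ultimately show ?thesis
    proof eventually_elim
      case (elim i)
      then have "?x i > 0" by (metis less_le_not_le not_less zero_less_norm_iff power_0_left not_one_le_zero norm_zero norm_le_zero_iff)
      then show ?case using elim(1) by (simp add: powr_powr flip: powr_realpow)
    qed
  qed
  ultimately show ?thesis
    using tendsto_cong[of "\<lambda>i. (?x i ^ n i) powr (real (m i) / real (n i))" "\<lambda>i. ?x i ^ m i" F] by (simp add: powr_def)
qed

text \<open>
  Since \<open>b\<close> need not be monotone, the ratio \<open>q = b n / b m\<close> is controlled by evaluating \<open>\<phi>\<close> at
  \<open>1 / b m = q / b n\<close> if \<open>q \<le> 1\<close> and at \<open>1 / b n = (1 / q) / b m\<close> otherwise; either way the argument
  stays in the range where the convergence to the stable law is uniform.
\<close>

lemma b_quot: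
  assumes m: "filterlim m sequentially F" and n: "filterlim n sequentially F"
    and s: "((\<lambda>i. real (m i) / real (n i)) \<longlongrightarrow> s) F" and "s > 0"
  shows "((\<lambda>i. b (m i) / b (n i)) \<longlongrightarrow> s powr (1 / \<alpha>)) F"
proof -
  define q where "q i = b (n i) / b (m i)" for i
  have q: "q i > 0" for i by (simp add: q_def b_pos)
  \<comment> \<open>Clamping the arguments by 1 makes both errors tend to 0 unconditionally; at each
    \<open>i\<close> only the one whose clamp is inactive gets used.\<close>
  define e where "e i = cmod (\<phi> (min 1 (q i) / b (n i))) ^ n i - exp (- (\<bar>min 1 (q i)\<bar> powr \<alpha>))" for i
  define e' where "e' i = cmod (\<phi> (min 1 (1 / q i) / b (m i))) ^ m i - exp (- (\<bar>min 1 (1 / q i)\<bar> powr \<alpha>))" for i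
  have s': "((\<lambda>i. real (n i) / real (m i)) \<longlongrightarrow> 1 / s) F"
    using tendsto_inverse[OF s] \<open>s > 0\<close> by (simp add: inverse_eq_divide)
  have "(e \<longlongrightarrow> 0) F" unfolding e_def
    using q by (intro norm_conv_filter[OF n, where T=1]) (simp add: less_imp_le min_def)
  from tendsto_diff[OF norm_power_quot[OF n m s'] this]
  have "((\<lambda>i. cmod (\<phi> (1 / b (m i))) ^ n i - e i) \<longlongrightarrow> exp (- (1 / s))) F" by simp
  then have "((\<lambda>i. - ln (cmod (\<phi> (1 / b (m i))) ^ n i - e i)) \<longlongrightarrow> - ln (exp (- (1 / s)))) F"
    by (intro tendsto_intros) auto
  then have 1: "((\<lambda>i. - ln (cmod (\<phi> (1 / b (m i))) ^ n i - e i)) \<longlongrightarrow> 1 / s) F" by simp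
  have "(e' \<longlongrightarrow> 0) F" unfolding e'_def
    using q by (intro norm_conv_filter[OF m, where T=1]) (simp add: less_imp_le min_def)
  from tendsto_diff[OF norm_power_quot[OF m n s] this]
  have "((\<lambda>i. cmod (\<phi> (1 / b (n i))) ^ m i - e' i) \<longlongrightarrow> exp (- s)) F" by simp
  then have "((\<lambda>i. 1 / (- ln (cmod (\<phi> (1 / b (n i))) ^ m i - e' i))) \<longlongrightarrow> 1 / (- ln (exp (- s)))) F"
    using \<open>s > 0\<close> by (intro tendsto_intros) auto
  then have 2: "((\<lambda>i. 1 / (- ln (cmod (\<phi> (1 / b (n i))) ^ m i - e' i))) \<longlongrightarrow> 1 / s) F" by simp
  have "((\<lambda>i. if q i \<le> 1 then - ln (cmod (\<phi> (1 / b (m i))) ^ n i - e i)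
      else 1 / (- ln (cmod (\<phi> (1 / b (n i))) ^ m i - e' i))) \<longlongrightarrow> 1 / s) F"
    by (rule filterlim_If) (rule tendsto_mono[OF _ 1] tendsto_mono[OF _ 2], rule inf_le1)+
  moreover have "(if q i \<le> 1 then - ln (cmod (\<phi> (1 / b (m i))) ^ n i - e i)
      else 1 / (- ln (cmod (\<phi> (1 / b (n i))) ^ m i - e' i))) = q i powr \<alpha>" for i
  proof (cases "q i \<le> 1")
    case True
    have "min 1 (q i) / b (n i) = 1 / b (m i)" using True b_pos by (simp add: q_def less_imp_neq[symmetric])
    then show ?thesis using True q[of i] by (simp add: e_def min_def)
  next
    case False
    then have mi: "min 1 (1 / q i) = 1 / q i" by (simp add: min_def)
    have "min 1 (1 / q i) / b (m i) = 1 / b (n i)" unfolding mi using b_pos by (simp add: q_def less_imp_neq[symmetric])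
    then show ?thesis using False q[of i] mi by (simp add: e'_def powr_divide)
  qed
  ultimately have "((\<lambda>i. q i powr \<alpha>) \<longlongrightarrow> 1 / s) F" by simp
  then have "((\<lambda>i. (q i powr \<alpha>) powr (- 1 / \<alpha>)) \<longlongrightarrow> (1 / s) powr (- 1 / \<alpha>)) F"
    using \<open>s > 0\<close> by (intro tendsto_intros) auto
  moreover have "(q i powr \<alpha>) powr (- 1 / \<alpha>) = b (m i) / b (n i)" for i
    using \<alpha> q[of i] by (simp add: powr_powr powr_minus) (simp add: q_def)
  moreover have "(1 / s) powr (- 1 / \<alpha>) = s powr (1 / \<alpha>)"
    using \<open>s > 0\<close> by (simp add: powr_divide powr_minus field_simps)
  ultimately show ?thesis by simp
qed

lemma b_Suc_quot: "(\<lambda>n. b (Suc n) / b n) \<longlonglongrightarrow> 1"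
proof -
  have "(\<lambda>n. real (Suc n) / real n) \<longlonglongrightarrow> 1" by real_asymp
  from b_quot[OF filterlim_Suc filterlim_ident this] show ?thesis by simp
qed

lemma b_double_quot: "(\<lambda>n. b (2 * n) / b n) \<longlonglongrightarrow> 2 powr (1 / \<alpha>)"
proof (rule b_quot)
  show "filterlim (\<lambda>n::nat. 2 * n) sequentially sequentially"
    by (rule filterlim_subseq) (simp add: strict_mono_def)
  show "(\<lambda>n. real (2 * n) / real n) \<longlonglongrightarrow> 2" by real_asymp
qed (auto simp: filterlim_ident)

text \<open>\<open>b_quot\<close> needs convergent index ratios; this covers all \<open>n\<close>
  between \<open>m\<close> and \<open>2 * m\<close> at once. If one of the two values of
  \<open>b\<close> were much smaller, the corresponding power of \<open>\<phi>\<close> would be at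
  least 8/10, or its square 64/100 after passing from \<open>m\<close> to \<open>2 * m\<close>,
  against the upper bound 6/10 at \<open>t = 1\<close>.\<close>

lemma b_comparable:
  "\<exists>C n0. C \<ge> 1 \<and> (\<forall>m n. n0 \<le> m \<longrightarrow> m \<le> n \<longrightarrow> n \<le> 2 * m \<longrightarrow> b n \<le> C * b m \<and> b m \<le> C * b n)"
proof -
  have "((\<lambda>w. exp (- (\<bar>w\<bar> powr \<alpha>))) \<longlongrightarrow> exp (- (\<bar>0\<bar> powr \<alpha>))) (at_right (0::real))"
    using \<alpha> by (intro tendsto_intros) auto
  then have "eventually (\<lambda>w. exp (- (\<bar>w\<bar> powr \<alpha>)) > 9/10) (at_right (0::real))"
    by (rule order_tendstoD) simp
  then obtain w1 where w1: "w1 > 0" "\<And>w. 0 < w \<Longrightarrow> w < w1 \<Longrightarrow> exp (- (\<bar>w\<bar> powr \<alpha>)) > 9/10"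
    by (auto simp: eventually_at_right_field)
  define w0 where "w0 = min 1 w1"
  have w0: "w0 > 0" "w0 \<le> 1" using w1 by (auto simp: w0_def)
  obtain n0 where n0: "\<And>n t. n \<ge> n0 \<Longrightarrow> \<bar>t\<bar> \<le> 1 \<Longrightarrow> \<bar>cmod (\<phi> (t / b n)) ^ n - exp (- (\<bar>t\<bar> powr \<alpha>))\<bar> < 1/10"
    using norm_conv_unif[of "1/10" 1] by auto
  have "exp (- 1) \<le> (1/2::real)"
    using exp_ge_add_one_self[of 1] by (simp add: exp_minus inverse_eq_divide)
  then have at1: "cmod (\<phi> (1 / b n)) ^ n \<le> 6/10" if "n \<ge> n0" for n
    using n0[OF that, of 1] unfolding abs_less_iff by simp
  have low: "cmod (\<phi> (w / b n)) ^ n \<ge> 8/10" if "n \<ge> n0" "0 < w" "w < w0" for n w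
  proof -
    have "\<bar>w\<bar> \<le> 1" "w < w1" using that by (auto simp: w0_def)
    with n0[OF that(1), of w] w1(2)[OF that(2)] show ?thesis
      unfolding abs_less_iff by linarith
  qed
  have "b n \<le> 1 / w0 * b m \<and> b m \<le> 1 / w0 * b n" if mn: "n0 \<le> m" "m \<le> n" "n \<le> 2 * m" for m n
  proof (rule ccontr)
    assume "\<not> ?thesis"
    then consider "b m / b n < w0" | "b n / b m < w0"
      using w0 b_pos[of n] b_pos[of m] by (auto simp: field_simps not_le)
    then show False
    proof cases
      case 1
      have eq: "b m / b n / b m = 1 / b n" using b_pos[of m] by simp
      have "8/10 \<le> cmod (\<phi> (1 / b n)) ^ m"
        using low[OF mn(1) _ 1] b_pos[of n] b_pos[of m] unfolding eq by simp
      then have "(8/10) ^ 2 \<le> (cmod (\<phi> (1 / b n)) ^ m) ^ 2" by (intro power_mono) auto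
      also have "\<dots> = cmod (\<phi> (1 / b n)) ^ (m * 2)" by (rule power_mult[symmetric])
      also have "\<dots> \<le> cmod (\<phi> (1 / b n)) ^ n"
        using mn \<phi>_le by (intro power_decreasing) auto
      also have "\<dots> \<le> 6/10" using at1[of n] mn by simp
      finally show False by (simp add: power2_eq_square)
    next
      case 2
      have eq: "b n / b m / b n = 1 / b m" using b_pos[of n] by simp
      have "8/10 \<le> cmod (\<phi> (1 / b m)) ^ n"
        using low[OF order_trans[OF mn(1,2)] _ 2] b_pos[of n] b_pos[of m] unfolding eq by simp
      also have "\<dots> \<le> cmod (\<phi> (1 / b m)) ^ m"
        using mn \<phi>_le by (intro power_decreasing) auto
      also have "\<dots> \<le> 6/10" using at1[of m] mn by simp
      finally show False by simp
    qed
  qed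
  moreover have "1 / w0 \<ge> 1" using w0 by simp
  ultimately show ?thesis by blast
qed

text \<open>Potter bounds for index \<open>1 / \<alpha>\<close>. The doubling ratio tends to
  \<open>2 powr (1 / \<alpha>)\<close>, hence eventually lies between \<open>2 powr p\<close> and
  \<open>2 powr p'\<close>; iterating covers dyadic multiples of \<open>m\<close>, and
  \<open>b_comparable\<close> fills the gaps. The extra factor \<open>2 powr p\<close> pays for
  \<open>n / m\<close> exceeding its dyadic part.\<close>

lemma potter:
  assumes p: "0 \<le> p" "p < 1 / \<alpha>" "1 / \<alpha> < p'"
  shows "\<exists>C n0. C \<ge> 1 \<and> n0 \<ge> 1 \<and> (\<forall>m n. n0 \<le> m \<longrightarrow> m \<le> n \<longrightarrow>
    b n \<le> C * (real n / real m) powr p' * b m \<and> (real n / real m) powr p * b m \<le> C * b n)"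
proof -
  obtain C n1 where C: "C \<ge> 1"
    "\<And>m n. n1 \<le> m \<Longrightarrow> m \<le> n \<Longrightarrow> n \<le> 2 * m \<Longrightarrow> b n \<le> C * b m \<and> b m \<le> C * b n"
    using b_comparable by blast
  have "2 powr p < (2::real) powr (1 / \<alpha>)" "2 powr (1 / \<alpha>) < (2::real) powr p'"
    using p by simp_all
  then have "eventually (\<lambda>n. 2 powr p < b (2 * n) / b n) sequentially"
    "eventually (\<lambda>n. b (2 * n) / b n < 2 powr p') sequentially"
    using order_tendstoD[OF b_double_quot] by blast+
  then obtain n2 where n2: "\<And>n. n \<ge> n2 \<Longrightarrow> 2 powr p < b (2 * n) / b n \<and> b (2 * n) / b n < 2 powr p'"
    using eventually_conj unfolding eventually_sequentially by (metis (no_types, lifting) nat_le_linear order_trans)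
  have dbl: "2 powr p * b n \<le> b (2 * n)" "b (2 * n) \<le> 2 powr p' * b n" if "n \<ge> n2" for n
    using n2[OF that] b_pos[of n] by (auto simp: field_simps)
  define n0 where "n0 = max 1 (max n1 n2)"
  have iter: "(2 ^ j) powr p * b m \<le> b (2 ^ j * m) \<and> b (2 ^ j * m) \<le> (2 ^ j) powr p' * b m" if "m \<ge> n0" for m j
  proof (induction j)
    case (Suc j)
    have "1 * m \<le> 2 ^ j * m" by (intro mult_right_mono) auto
    then have "m \<le> 2 ^ j * m" by simp
    moreover have "n2 \<le> m" using that by (simp add: n0_def)
    ultimately have ge: "2 ^ j * m \<ge> n2" by (rule order_trans[rotated])
    have broken_powr: "(2 ^ Suc j) powr r = 2 powr r * (2 ^ j) powr r" for r :: real
      by (simp add: powr_mult)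
    have eq: "2 ^ Suc j * m = 2 * (2 ^ j * m)" by simp
    have "2 powr p * ((2 ^ j) powr p * b m) \<le> 2 powr p * b (2 ^ j * m)"
      using Suc by (intro mult_left_mono) auto
    also have "\<dots> \<le> b (2 * (2 ^ j * m))" by (rule dbl[OF ge])
    finally have 1: "(2 ^ Suc j) powr p * b m \<le> b (2 ^ Suc j * m)" unfolding broken_powr eq by (simp add: mult_ac)
    have "b (2 * (2 ^ j * m)) \<le> 2 powr p' * b (2 ^ j * m)" by (rule dbl[OF ge])
    also have "\<dots> \<le> 2 powr p' * ((2 ^ j) powr p' * b m)"
      using Suc by (intro mult_left_mono) auto
    finally have 2: "b (2 ^ Suc j * m) \<le> (2 ^ Suc j) powr p' * b m" unfolding broken_powr eq by (simp add: mult_ac)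
    show ?case using 1 2 by blast
  qed simp
  have p': "p' > 0" using p by linarith
  have "b n \<le> (C * 2 powr p) * (real n / real m) powr p' * b m \<and> (real n / real m) powr p * b m \<le> (C * 2 powr p) * b n"
    if mn: "n0 \<le> m" "m \<le> n" for m n
  proof -
    have m: "m \<ge> 1" using mn by (simp add: n0_def)
    have "n div m \<ge> 1" using mn m by (simp add: Suc_le_eq div_greater_zero_iff)
    then obtain j where j: "2 ^ j \<le> n div m" "n div m < 2 ^ (j + 1)"
      using ex_power_ivl1[of 2 "n div m"] by auto
    have j1: "2 ^ j * m \<le> n" using j(1) by (metis div_times_less_eq_dividend mult_le_mono1 order_trans)
    have j2: "n < 2 * (2 ^ j * m)" using j(2) m by (simp add: div_less_iff_less_mult mult_ac)
    have "1 * m \<le> 2 ^ j * m" by (intro mult_right_mono) auto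
    then have "m \<le> 2 ^ j * m" by simp
    moreover have "n1 \<le> m" using mn by (simp add: n0_def)
    ultimately have ge: "2 ^ j * m \<ge> n1" by (rule order_trans[rotated])
    have cmp: "b n \<le> C * b (2 ^ j * m)" "b (2 ^ j * m) \<le> C * b n"
      using C(2)[OF ge j1] j2 by auto
    have "real (2 ^ j * m) \<le> real n" using j1 of_nat_le_iff by blast
    then have r1: "2 ^ j \<le> real n / real m" using m by (simp add: le_divide_eq)
    have "real n \<le> real (2 * (2 ^ j * m))" using j2 of_nat_le_iff less_imp_le by blast
    then have r2: "real n / real m \<le> 2 * 2 ^ j" using m by (simp add: divide_le_eq)
    have "b n \<le> C * b (2 ^ j * m)" by (rule cmp)
    also have "\<dots> \<le> C * ((2 ^ j) powr p' * b m)" using iter[OF mn(1)] C by (intro mult_left_mono) auto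
    also have "\<dots> \<le> C * ((real n / real m) powr p' * b m)"
      using r1 p' C b_pos[of m] by (intro mult_left_mono mult_right_mono powr_mono2) auto
    also have "\<dots> \<le> C * 2 powr p * ((real n / real m) powr p' * b m)"
      using C p b_pos[of m] by (intro mult_right_mono) (auto simp: ge_one_powr_ge_zero)
    finally have 1: "b n \<le> (C * 2 powr p) * (real n / real m) powr p' * b m" by (simp add: mult_ac)
    have "(real n / real m) powr p * b m \<le> (2 * 2 ^ j) powr p * b m"
      using r2 p b_pos[of m] by (intro mult_right_mono powr_mono2) auto
    also have "\<dots> = 2 powr p * ((2 ^ j) powr p * b m)" by (simp add: powr_mult)
    also have "\<dots> \<le> 2 powr p * (C * b n)"
      using iter[OF mn(1), of j] cmp by (intro mult_left_mono) auto
    finally show ?thesis using 1 by (simp add: mult_ac)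
  qed
  moreover have "C * 2 powr p \<ge> 1" using mult_mono[of 1 C 1 "2 powr p"] C(1) p(1) by (simp add: ge_one_powr_ge_zero)
  moreover have "n0 \<ge> 1" by (simp add: n0_def)
  ultimately show ?thesis by blast
qed

text \<open>A substitute for inverting \<open>b\<close>: take the first index from \<open>n\<close>
  on where \<open>b\<close> reaches \<open>x\<close>. Since consecutive ratios are eventually below
  2, the overshoot is at most a factor 2.\<close>

lemma scale_point:
  "\<exists>n1\<ge>1. \<forall>n\<ge>n1. \<forall>x\<ge>b n. \<exists>m\<ge>n. x \<le> b m \<and> b m \<le> 2 * x \<and> (\<forall>j. n \<le> j \<and> j < m \<longrightarrow> b j < x)"
proof -
  have "eventually (\<lambda>n. b (Suc n) / b n < 2) sequentially"
    by (rule order_tendstoD(2)[OF b_Suc_quot]) simp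
  then obtain n1 where n1: "\<And>n. n \<ge> n1 \<Longrightarrow> b (Suc n) / b n < 2"
    by (auto simp: eventually_sequentially)
  show ?thesis
  proof (rule exI[of _ "max 1 n1"], intro conjI allI impI)
    fix n x assume n: "n \<ge> max 1 n1" and x: "b n \<le> x"
    have "eventually (\<lambda>m. b m \<ge> x) sequentially"
      using b_at_top by (simp add: filterlim_at_top)
    then obtain m0 where "\<And>m. m \<ge> m0 \<Longrightarrow> b m \<ge> x" by (auto simp: eventually_sequentially)
    then have ex: "max m0 n \<ge> n \<and> b (max m0 n) \<ge> x" by simp
    define m where "m = (LEAST m. m \<ge> n \<and> b m \<ge> x)"
    have m: "m \<ge> n" "b m \<ge> x" unfolding m_def using LeastI[of "\<lambda>m. m \<ge> n \<and> b m \<ge> x", OF ex] by auto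
    have lt: "b j < x" if "n \<le> j" "j < m" for j
      using not_less_Least[of j "\<lambda>m. m \<ge> n \<and> b m \<ge> x"] that unfolding m_def by auto
    have "b m \<le> 2 * x"
    proof (cases "m = n")
      case True
      then show ?thesis using x m b_pos[of n] by auto
    next
      case False
      then obtain k where k: "m = Suc k" "k \<ge> n" using m by (cases m) auto
      have "b m / b k < 2" using n1[of k] k n by simp
      then have "b m < 2 * b k" using b_pos[of k] by (simp add: divide_less_eq)
      then show ?thesis using lt[of k] k by simp
    qed
    then show "\<exists>m\<ge>n. x \<le> b m \<and> b m \<le> 2 * x \<and> (\<forall>j. n \<le> j \<and> j < m \<longrightarrow> b j < x)"
      using m lt by blast
  qed simp
qed

text \<open>Choose \<open>m\<close> with \<open>b m\<close> between \<open>1 / s\<close> and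
  \<open>2 / s\<close>; then \<open>cmod (\<phi> s) ^ m \<le> 3/5\<close>, from the limit at most
  1/2 plus an error 1/10. Iterating gives \<open>(3/5) ^ (n div m)\<close>, and the Potter bound
  with exponent 1 turns \<open>n / m\<close> into a multiple of \<open>b n * s\<close>. A linear
  exponent is weaker than the true power \<open>\<alpha>\<close> but integrates over
  \<open>s\<close> to order \<open>1 / b n\<close>.\<close>

lemma norm_power_le_exp:
  "\<exists>c C t0 n0. c > 0 \<and> C > 0 \<and> t0 > 0 \<and>
     (\<forall>n\<ge>n0. \<forall>s. 0 \<le> s \<longrightarrow> s \<le> t0 \<longrightarrow> cmod (\<phi> s) ^ n \<le> C * exp (- (c * b n * s)))"
proof -
  obtain C n1 where C: "C \<ge> 1" "n1 \<ge> 1"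
    "\<And>m n. n1 \<le> m \<Longrightarrow> m \<le> n \<Longrightarrow> b n \<le> C * (real n / real m) powr 1 * b m"
    using potter[of 0 1] \<alpha> by auto
  obtain n2 where n2: "n2 \<ge> 1" "\<And>n x. n \<ge> n2 \<Longrightarrow> x \<ge> b n \<Longrightarrow>
      \<exists>m\<ge>n. x \<le> b m \<and> b m \<le> 2 * x \<and> (\<forall>j. n \<le> j \<and> j < m \<longrightarrow> b j < x)"
    using scale_point by blast
  obtain n3 where n3: "\<And>n t. n \<ge> n3 \<Longrightarrow> \<bar>t\<bar> \<le> 2 \<Longrightarrow> \<bar>cmod (\<phi> (t / b n)) ^ n - exp (- (\<bar>t\<bar> powr \<alpha>))\<bar> < 1/10"
    using norm_conv_unif[of "1/10" 2] by auto
  define k where "k = max n1 (max n2 n3)"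
  have k: "k \<ge> n1" "k \<ge> n2" "k \<ge> n3" by (auto simp: k_def)
  have "exp (- 1) \<le> (1/2::real)"
    using exp_ge_add_one_self[of 1] by (simp add: exp_minus inverse_eq_divide)
  then have at1: "cmod (\<phi> (t / b n)) ^ n \<le> 3/5" if "n \<ge> k" "1 \<le> t" "t \<le> 2" for n t
  proof -
    have "\<bar>t\<bar> powr \<alpha> \<ge> 1" using that \<alpha> by (simp add: ge_one_powr_ge_zero)
    then have "exp (- (\<bar>t\<bar> powr \<alpha>)) \<le> exp (- 1)" by simp
    moreover have "\<bar>t\<bar> \<le> 2" "n \<ge> n3" using that k by auto
    then have "\<bar>cmod (\<phi> (t / b n)) ^ n - exp (- (\<bar>t\<bar> powr \<alpha>))\<bar> < 1/10" using n3 by blast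
    ultimately show ?thesis using \<open>exp (- 1) \<le> (1/2::real)\<close> unfolding abs_less_iff by linarith
  qed
  define L where "L = ln (5/3::real)"
  have L: "L > 0" by (simp add: L_def)
  define c where "c = L / (2 * C)"
  have c: "c > 0" using L C by (simp add: c_def)
  \<comment> \<open>The summand \<open>exp c\<close> pays for \<open>b n * s \<le> 1\<close>, where
    the modulus is bounded by 1; the summand 5/3 pays for rounding \<open>n / m\<close>
    down.\<close>
  have "cmod (\<phi> s) ^ n \<le> (exp c + 5/3) * exp (- (c * b n * s))"
    if n: "n \<ge> k" and s: "0 \<le> s" "s \<le> 1 / b k" for n s
  proof (cases "b n * s \<le> 1")
    case True
    have "cmod (\<phi> s) ^ n \<le> 1" using \<phi>_le by (simp add: power_le_one)
    also have "1 \<le> exp (c * (1 - b n * s))" using True c by simp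
    also have "\<dots> = exp c * exp (- (c * b n * s))" by (simp add: algebra_simps flip: exp_add)
    also have "\<dots> \<le> (exp c + 5/3) * exp (- (c * b n * s))" by (intro mult_right_mono) auto
    finally show ?thesis .
  next
    case False
    then have s0: "s > 0" using s by (cases "s = 0") auto
    have "b k \<le> 1 / s" using s(2) s0 b_pos[of k] by (simp add: field_simps)
    then obtain m where m: "m \<ge> k" "1 / s \<le> b m" "b m \<le> 2 * (1 / s)" "\<And>j. k \<le> j \<Longrightarrow> j < m \<Longrightarrow> b j < 1 / s"
      using n2(2)[OF k(2)] by blast
    have "1 / s < b n" using False s0 by (simp add: field_simps)
    then have mn: "m \<le> n" using m(4)[OF n] by (meson not_less order_less_asym)
    have m1: "m \<ge> 1" using m(1) k(1) C(2) by simp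
    have "cmod (\<phi> (b m * s / b m)) ^ m \<le> 3/5"
      using m s0 by (intro at1) (auto simp: field_simps)
    then have "cmod (\<phi> s) ^ m \<le> 3/5" using b_pos[of m] by simp
    then have le: "(cmod (\<phi> s) ^ m) ^ (n div m) \<le> (3/5) ^ (n div m)" by (intro power_mono) auto
    have "cmod (\<phi> s) ^ n \<le> cmod (\<phi> s) ^ (m * (n div m))"
      using \<phi>_le by (intro power_decreasing) auto
    also have "\<dots> \<le> (3/5) ^ (n div m)" using le by (simp add: power_mult)
    also have "\<dots> = exp (- (L * real (n div m)))"
    proof -
      have "(3/5::real) = exp (- L)" by (simp add: L_def exp_minus)
      then show ?thesis by (metis exp_of_nat_mult mult.commute mult_minus_left)
    qed
    also have "\<dots> \<le> exp (- (L * (b n * s / (2 * C) - 1)))"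
    proof -
      have fl: "real n / real m < real (n div m) + 1"
        using floor_correct[of "real n / real m"] by (simp add: floor_divide_of_nat_eq)
      have "b n \<le> C * (real n / real m) * b m" using C(3)[OF order_trans[OF k(1) m(1)] mn] by simp
      then have "b n * s \<le> C * (real n / real m) * b m * s"
        using s0 by (intro mult_right_mono) auto
      also have "\<dots> = C * (real n / real m) * (b m * s)" by simp
      also have "\<dots> \<le> C * (real n / real m) * 2"
        using m(3) s0 C(1) by (intro mult_left_mono) (auto simp: field_simps)
      finally have "b n * s \<le> (real n / real m) * (2 * C)" by (simp only: mult_ac)
      then have "b n * s / (2 * C) \<le> real n / real m" using C(1) by (subst pos_divide_le_eq) auto
      then have "b n * s / (2 * C) - 1 \<le> real (n div m)" using fl by linarith
      then show ?thesis using L by simp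
    qed
    also have "\<dots> = 5/3 * exp (- (c * b n * s))"
    proof -
      have "- (L * (b n * s / (2 * C) - 1)) = L + - (c * b n * s)" using C(1) by (simp add: c_def algebra_simps)
      moreover have "exp L = 5/3" by (simp add: L_def)
      ultimately show ?thesis by (simp only: exp_add)
    qed
    also have "\<dots> \<le> (exp c + 5/3) * exp (- (c * b n * s))" by (intro mult_right_mono) auto
    finally show ?thesis .
  qed
  moreover have "1 / b k > 0" using b_pos[of k] by simp
  moreover have "exp c + 5/3 > 0" by (simp add: add_pos_pos)
  ultimately show ?thesis using c by blast
qed

text \<open>
  No logarithm of \<open>\<phi>\<close> is needed: if all powers \<open>z ^ j\<close> with \<open>j \<le> n\<close> are near 1, then
  \<open>1 - z ^ n = (1 - z) (1 + z + \<dots> + z ^ (n - 1))\<close> has norm at least \<open>n \<bar>1 - z\<bar> / 2\<close>.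
\<close>

lemma one_minus_bound:
  "\<exists>T n0. T > 0 \<and> (\<forall>n\<ge>n0. \<forall>t. \<bar>t\<bar> \<le> T \<longrightarrow> real n * cmod (1 - \<phi> (t / b n)) \<le> 4)"
proof -
  obtain C n1 where C: "C \<ge> 1" "n1 \<ge> 1"
    "\<And>m n. n1 \<le> m \<Longrightarrow> m \<le> n \<Longrightarrow> (real n / real m) powr 0 * b m \<le> C * b n"
    using potter[of 0 1] \<alpha> by auto
  have mono: "b m \<le> C * b n" if "n1 \<le> m" "m \<le> n" for m n
    using C(3)[OF that] that C(2) by auto
  obtain d where d: "d > 0" "\<And>t. \<bar>t\<bar> < d \<Longrightarrow> cmod (1 - G t) < 1/4"
    using G_cont[unfolded continuous_at_eps_delta, rule_format, of "1/4"] by (auto simp: G_0 dist_norm norm_minus_commute)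
  obtain n2 where n2: "\<And>n t. n \<ge> n2 \<Longrightarrow> \<bar>t\<bar> \<le> 1 \<Longrightarrow> cmod (\<phi> (t / b n) ^ n - G t) < 1/4"
    using conv_unif[of "1/4" 1] by auto
  define k where "k = max n1 n2"
  \<comment> \<open>By almost monotonicity of \<open>b\<close>, the point
    \<open>t * b j / b n\<close> is bounded by \<open>C * T\<close>; it has to stay both in the
    range of uniform convergence and where \<open>G\<close> is within 1/4 of 1.\<close>
  define T where "T = min (d / 2) 1 / C"
  have T: "T > 0" "C * T \<le> 1" "C * T < d" using d C by (auto simp: T_def)
  have k0: "1 / (2 * (real k + 1)) > 0" by simp
  obtain u where u: "u > 0" "\<And>t. \<bar>t\<bar> < u \<Longrightarrow> cmod (1 - \<phi> t) < 1 / (2 * (real k + 1))"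
    using \<phi>_cont[unfolded continuous_at_eps_delta, rule_format, OF k0] by (auto simp: \<phi>_0 dist_norm norm_minus_commute)
  have "eventually (\<lambda>n. b n \<ge> T / u + 1) sequentially"
    using b_at_top by (simp add: filterlim_at_top)
  then obtain n3 where n3: "\<And>n. n \<ge> n3 \<Longrightarrow> b n \<ge> T / u + 1" by (auto simp: eventually_sequentially)
  have "real n * cmod (1 - \<phi> (t / b n)) \<le> 4" if n: "n \<ge> n3" and t: "\<bar>t\<bar> \<le> T" for n t
  proof -
    define z where "z = \<phi> (t / b n)"
    \<comment> \<open>Exponents \<open>j < k\<close> are too small for the limit theorem. They are
      finitely many, and continuity of \<open>\<phi>\<close> at 0 handles them once
      \<open>b n\<close> is large.\<close>
    have near: "cmod (1 - z ^ j) \<le> 1/2" if j: "j \<le> n" for j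
    proof (cases "j < k")
      case True
      have "b n > T / u" using n3[OF n] by simp
      then have "\<bar>t\<bar> / b n < u" using t b_pos[of n] u(1) by (simp add: field_simps)
      then have "cmod (1 - z) < 1 / (2 * (real k + 1))"
        unfolding z_def using b_pos[of n] by (intro u(2)) simp
      moreover have "cmod (1 ^ j - z ^ j) \<le> real j * cmod (1 - z)"
        using norm_power_diff[of 1 z j] \<phi>_le by (simp add: z_def)
      moreover have "real j * cmod (1 - z) \<le> real j * (1 / (2 * (real k + 1)))"
        using calculation(1) by (intro mult_left_mono) auto
      ultimately have "cmod (1 - z ^ j) \<le> real j * (1 / (2 * (real k + 1)))" by simp
      also have "\<dots> \<le> 1/2" using True by (simp add: field_simps)
      finally show ?thesis .
    next
      case False
      define t' where "t' = t * b j / b n"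
      have "b j \<le> C * b n" using mono[of j n] False j by (simp add: k_def)
      then have "b j / b n \<le> C" using b_pos[of n] by (simp add: divide_le_eq)
      then have "\<bar>t'\<bar> \<le> T * C"
        unfolding t'_def using t b_pos[of n] b_pos[of j] C(1)
        by (simp only: abs_mult abs_divide times_divide_eq_right[symmetric]) (intro mult_mono, auto)
      then have "\<bar>t'\<bar> \<le> 1" "\<bar>t'\<bar> < d" using T by (auto simp: mult.commute)
      moreover have "t' / b j = t / b n" using b_pos[of j] by (simp add: t'_def)
      ultimately have "cmod (z ^ j - G t') < 1/4" "cmod (1 - G t') < 1/4"
        using n2[of j t'] d(2)[of t'] False by (auto simp: k_def z_def)
      then have "cmod ((1 - G t') - (z ^ j - G t')) < 1/4 + 1/4"
        using norm_triangle_ineq4 by (meson add_strict_mono le_less_trans)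
      then show ?thesis by simp
    qed
    have "real n * (1/2) \<le> Re (\<Sum>j<n. z ^ j)"
    proof -
      have "Re (z ^ j) \<ge> 1/2" if "j < n" for j
        using near[of j] that complex_Re_le_cmod[of "1 - z ^ j"] by simp
      then have "(\<Sum>j<n. 1/2) \<le> (\<Sum>j<n. Re (z ^ j))" by (intro sum_mono) auto
      then show ?thesis by simp
    qed
    also have "\<dots> \<le> cmod (\<Sum>j<n. z ^ j)" by (rule complex_Re_le_cmod)
    finally have "cmod (1 - z) * (real n * (1/2)) \<le> cmod (1 - z) * cmod (\<Sum>j<n. z ^ j)"
      by (intro mult_left_mono) auto
    also have "\<dots> = cmod (1 - z ^ n)" by (simp add: one_diff_power_eq norm_mult)
    also have "\<dots> \<le> 1 + cmod z ^ n" using norm_triangle_ineq4[of 1 "z ^ n"] by (simp add: norm_power)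
    also have "\<dots> \<le> 2" using \<phi>_le by (simp add: z_def power_le_one)
    finally show ?thesis by (simp add: z_def mult_ac)
  qed
  then show ?thesis using T by blast
qed

text \<open>Given \<open>t\<close>, pick \<open>m \<ge> n\<close> with \<open>b m\<close> comparable
  to \<open>T / \<bar>t\<bar>\<close>. Then \<open>m * cmod (1 - \<phi> t) \<le> 4\<close>, while
  \<open>x * b n \<le> b m\<close> forces \<open>m / n\<close> to be at least of order
  \<open>x powr (1 / p')\<close>. As \<open>p'\<close> approaches \<open>1 / \<alpha>\<close>, the
  decay exponent approaches \<open>\<alpha>\<close>.\<close>

lemma one_minus_decay:
  assumes p': "1 / \<alpha> < p'"
  shows "\<exists>C T n0. C > 0 \<and> T > 0 \<and> (\<forall>n\<ge>n0. \<forall>x\<ge>1. \<forall>t. \<bar>t\<bar> * (x * b n) \<le> T \<longrightarrow>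
     real n * cmod (1 - \<phi> t) \<le> C * x powr (- 1 / p'))"
proof -
  obtain T n1 where T: "T > 0" "\<And>n t. n \<ge> n1 \<Longrightarrow> \<bar>t\<bar> \<le> T \<Longrightarrow> real n * cmod (1 - \<phi> (t / b n)) \<le> 4"
    using one_minus_bound by blast
  obtain C n2 where C: "C \<ge> 1" "n2 \<ge> 1"
    "\<And>m n. n2 \<le> m \<Longrightarrow> m \<le> n \<Longrightarrow> b n \<le> C * (real n / real m) powr p' * b m"
    using potter[of 0 p'] \<alpha> p' by auto
  obtain n3 where n3: "n3 \<ge> 1" "\<And>n x. n \<ge> n3 \<Longrightarrow> x \<ge> b n \<Longrightarrow>
      \<exists>m\<ge>n. x \<le> b m \<and> b m \<le> 2 * x \<and> (\<forall>j. n \<le> j \<and> j < m \<longrightarrow> b j < x)"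
    using scale_point by blast
  have "1 / \<alpha> > 0" using \<alpha> by simp
  then have p0: "p' > 0" using p' by linarith
  define k where "k = max n1 (max n2 n3)"
  have k: "k \<ge> n1" "k \<ge> n2" "k \<ge> n3" by (auto simp: k_def)
  have "real n * cmod (1 - \<phi> t) \<le> (4 * C powr (1 / p')) * x powr (- 1 / p')"
    if n: "n \<ge> k" and x: "x \<ge> 1" and t: "\<bar>t\<bar> * (x * b n) \<le> T / 2" for n x t
  proof (cases "t = 0")
    case True
    then show ?thesis by (simp add: \<phi>_0)
  next
    case False
    define X where "X = T / (2 * \<bar>t\<bar>)"
    have X: "x * b n \<le> X" using t False by (simp add: X_def field_simps)
    have "b n \<le> x * b n" using x b_pos[of n] by simp
    then have "b n \<le> X" using X by linarith
    then obtain m where m: "m \<ge> n" "X \<le> b m" "b m \<le> 2 * X"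
      using n3(2)[OF order_trans[OF k(3) n]] by blast
    have n0: "n \<ge> 1" using n k n3 by linarith
    have "\<bar>t * b m\<bar> \<le> T" using m(3) b_pos[of m] False by (simp add: X_def abs_mult field_simps)
    then have "real m * cmod (1 - \<phi> (t * b m / b m)) \<le> 4" using m n k by (intro T(2)) auto
    then have 4: "real m * cmod (1 - \<phi> t) \<le> 4" using b_pos[of m] by simp
    have "x * b n \<le> C * (real m / real n) powr p' * b n"
      using X m C(3)[OF order_trans[OF k(2) n] m(1)] by linarith
    then have "x \<le> C * (real m / real n) powr p'" using b_pos[of n] by simp
    then have "x powr (1 / p') \<le> (C * (real m / real n) powr p') powr (1 / p')"
      using x p0 by (intro powr_mono2) auto
    also have "\<dots> = C powr (1 / p') * (real m / real n)"
      using C(1) p0 m n0 by (simp add: powr_mult powr_powr)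
    finally have "x powr (1 / p') * real n \<le> C powr (1 / p') * real m"
      using n0 by (simp add: field_simps)
    then have "x powr (1 / p') * real n * cmod (1 - \<phi> t) \<le> C powr (1 / p') * real m * cmod (1 - \<phi> t)"
      by (intro mult_right_mono) auto
    also have "\<dots> \<le> C powr (1 / p') * 4" unfolding mult.assoc using 4 by (intro mult_left_mono) auto
    finally have "real n * cmod (1 - \<phi> t) \<le> C powr (1 / p') * 4 / x powr (1 / p')"
      using x by (simp add: field_simps)
    then show ?thesis by (simp add: powr_minus divide_simps mult_ac)
  qed
  moreover have "T / 2 > 0" using T by simp
  moreover have "4 * C powr (1 / p') > 0" using C(1) by simp
  ultimately show ?thesis by blast
qed

end

section \<open>Characteristic function inequalities\<close>

text \<open>Frequencies are averaged against a probability measure, so that bounded functions are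
  integrable and Fubini applies on a finite product.\<close>

definition unit_uniform :: "real measure" where
  "unit_uniform = density lborel (\<lambda>t. ennreal (indicator {0..1} t))"

lemma sets_unit_uniform [simp, measurable_cong]: "sets unit_uniform = sets borel"
  by (simp add: unit_uniform_def)

lemma space_unit_uniform [simp]: "space unit_uniform = UNIV"
  by (simp add: unit_uniform_def)

lemma prob_space_unit_uniform: "prob_space unit_uniform"
proof
  have "emeasure unit_uniform (space unit_uniform) = emeasure lborel {0..1::real}"
    unfolding unit_uniform_def by (subst emeasure_density) (auto simp: ennreal_indicator)
  then show "emeasure unit_uniform (space unit_uniform) = 1" by simp
qed

lemma AE_unit_uniform: "AE t in unit_uniform. 0 \<le> t \<and> t \<le> 1"
  unfolding unit_uniform_def by (subst AE_density) (auto simp: indicator_def)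

lemma integral_unit_uniform_FTC:
  fixes f F :: "real \<Rightarrow> real"
  assumes "\<And>t. (F has_real_derivative f t) (at t)" "continuous_on UNIV f"
  shows "integral\<^sup>L unit_uniform f = F 1 - F 0"
proof -
  have [measurable]: "f \<in> borel_measurable borel" using assms(2) by (rule borel_measurable_continuous_onI)
  have "integral\<^sup>L unit_uniform f = (\<integral>t. indicator {0..1} t * f t \<partial>lborel)"
    unfolding unit_uniform_def by (subst integral_real_density) auto
  also have "\<dots> = F 1 - F 0"
    using integral_FTC_Icc_real[of 0 1 F f] assms continuous_on_eq_continuous_at[of UNIV f]
    by (simp add: mult.commute)
  finally show ?thesis .
qed

lemma integral_unit_uniform_cos: "w \<noteq> 0 \<Longrightarrow> (\<integral>t. cos (t * w) \<partial>unit_uniform) = sin w / w"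
  by (subst integral_unit_uniform_FTC[where F = "\<lambda>t. sin (t * w) / w"])
     (auto intro!: derivative_eq_intros continuous_intros)

lemma integral_unit_uniform_sin: "w \<noteq> 0 \<Longrightarrow> (\<integral>t. sin (t * w) \<partial>unit_uniform) = (1 - cos w) / w"
  by (subst integral_unit_uniform_FTC[where F = "\<lambda>t. - cos (t * w) / w"])
     (auto intro!: derivative_eq_intros continuous_intros simp: field_simps)

text \<open>The cosine transform of the triangular weight is the Fejer kernel. Its nonnegativity
  allows it to majorise an indicator.\<close>

lemma integral_unit_uniform_fejer: "w \<noteq> 0 \<Longrightarrow> (\<integral>t. (1 - t) * cos (t * w) \<partial>unit_uniform) = (1 - cos w) / w\<^sup>2"
  by (subst integral_unit_uniform_FTC[where F = "\<lambda>t. (1 - t) * sin (t * w) / w - cos (t * w) / w\<^sup>2"])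
     (auto intro!: derivative_eq_intros continuous_intros simp: field_simps power2_eq_square)

lemma integrable_unit_uniform:
  fixes f :: "real \<Rightarrow> 'b::{banach, second_countable_topology}"
  assumes "f \<in> borel_measurable borel" "\<And>t. 0 \<le> t \<Longrightarrow> t \<le> 1 \<Longrightarrow> norm (f t) \<le> B"
  shows "integrable unit_uniform f"
proof -
  interpret prob_space unit_uniform by (rule prob_space_unit_uniform)
  show ?thesis
    by (rule integrable_const_bound[where B=B]) (use AE_unit_uniform assms in auto)
qed

lemma fejer_nonneg: "0 \<le> (\<integral>t. (1 - t) * cos (t * w) \<partial>unit_uniform)"
proof (cases "w = 0")
  case True
  have "(\<integral>t. 1 - t \<partial>unit_uniform) = 1 / 2"
    by (subst integral_unit_uniform_FTC[where F = "\<lambda>t. t - t\<^sup>2 / 2"])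
       (auto intro!: derivative_eq_intros continuous_intros)
  then show ?thesis using True by simp
qed (simp add: integral_unit_uniform_fejer)

text \<open>Here \<open>\<bar>t * w\<bar> \<le> 1 < pi / 3\<close>, so the cosine is at least 1/2,
  and the weight \<open>1 - t\<close> has mean 1/2.\<close>

lemma fejer_ge:
  assumes "\<bar>w\<bar> \<le> 1"
  shows "1 / 4 \<le> (\<integral>t. (1 - t) * cos (t * w) \<partial>unit_uniform)"
proof -
  have half: "1 / 2 \<le> cos (t * w)" if "0 \<le> t" "t \<le> 1" for t
  proof -
    have "\<bar>t * w\<bar> \<le> 1" using that assms by (simp add: abs_mult mult_le_one)
    then have "\<bar>t * w\<bar> \<le> pi / 3" using pi_gt3 by simp
    then have "cos (pi / 3) \<le> cos \<bar>t * w\<bar>" by (intro cos_monotone_0_pi_le) auto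
    then show ?thesis by (simp add: cos_60)
  qed
  have "(\<integral>t. (1 - t) * (1 / 2) \<partial>unit_uniform) \<le> (\<integral>t. (1 - t) * cos (t * w) \<partial>unit_uniform)"
  proof (rule integral_mono_AE)
    show "integrable unit_uniform (\<lambda>t. (1 - t) * (1 / 2))"
      by (rule integrable_unit_uniform[where B=1]) (auto simp: abs_mult)
    show "integrable unit_uniform (\<lambda>t. (1 - t) * cos (t * w))"
      by (rule integrable_unit_uniform[where B=1]) (auto simp: abs_mult mult_le_one)
    show "AE t in unit_uniform. (1 - t) * (1 / 2) \<le> (1 - t) * cos (t * w)"
      using AE_unit_uniform by eventually_elim (intro mult_left_mono half, auto)
  qed
  moreover have "(\<integral>t. (1 - t) * (1 / 2) \<partial>unit_uniform) = 1 / 4"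
    by (subst integral_unit_uniform_FTC[where F = "\<lambda>t. (t - t\<^sup>2 / 2) / 2"])
       (auto intro!: derivative_eq_intros continuous_intros)
  ultimately show ?thesis by simp
qed

lemma fubini_unit_uniform:
  fixes f :: "real \<Rightarrow> real \<Rightarrow> real"
  assumes D: "real_distribution D" and [measurable]: "case_prod f \<in> borel_measurable (borel \<Otimes>\<^sub>M borel)"
    and bd: "\<And>t y. 0 \<le> t \<Longrightarrow> t \<le> 1 \<Longrightarrow> \<bar>f t y\<bar> \<le> B"
  shows "(\<integral>y. (\<integral>t. f t y \<partial>unit_uniform) \<partial>D) = (\<integral>t. (\<integral>y. f t y \<partial>D) \<partial>unit_uniform)"
    and "integrable D (\<lambda>y. \<integral>t. f t y \<partial>unit_uniform)"
proof -
  interpret D: real_distribution D by fact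
  interpret U: prob_space unit_uniform by (rule prob_space_unit_uniform)
  interpret P: pair_prob_space unit_uniform D ..
  have m [measurable]: "case_prod f \<in> borel_measurable (unit_uniform \<Otimes>\<^sub>M D)"
    by (simp cong: measurable_cong_sets)
  have "AE p in unit_uniform \<Otimes>\<^sub>M D. 0 \<le> fst p \<and> fst p \<le> 1"
  proof (rule P.AE_pair_measure)
    show "{p \<in> space (unit_uniform \<Otimes>\<^sub>M D). 0 \<le> fst p \<and> fst p \<le> 1} \<in> sets (unit_uniform \<Otimes>\<^sub>M D)"
      by measurable
    show "AE x in unit_uniform. AE y in D. 0 \<le> fst (x, y) \<and> fst (x, y) \<le> 1"
      using AE_unit_uniform by eventually_elim simp
  qed
  then have "AE p in unit_uniform \<Otimes>\<^sub>M D. norm (case_prod f p) \<le> B"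
    by (rule eventually_mono) (auto simp: bd split: prod.splits)
  then have int: "integrable (unit_uniform \<Otimes>\<^sub>M D) (case_prod f)"
    by (rule P.integrable_const_bound) (rule m)
  show "(\<integral>y. (\<integral>t. f t y \<partial>unit_uniform) \<partial>D) = (\<integral>t. (\<integral>y. f t y \<partial>D) \<partial>unit_uniform)"
    by (rule P.Fubini_integral[OF int])
  show "integrable D (\<lambda>y. \<integral>t. f t y \<partial>unit_uniform)"
    using P.integrable_snd[OF int] .
qed

section \<open>Concentration, truncation and support inequalities\<close>

lemma (in real_distribution) char_cos_sin:
  "(\<integral>y. cos (t * y) \<partial>M) = Re (char M t)" "(\<integral>y. sin (t * y) \<partial>M) = Im (char M t)"
proof -
  have int: "integrable M (\<lambda>y. iexp (t * y))" by (rule integrable_iexp) auto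
  show "(\<integral>y. cos (t * y) \<partial>M) = Re (char M t)"
    unfolding char_def by (subst integral_Re[OF int, symmetric]) (simp add: Re_exp)
  show "(\<integral>y. sin (t * y) \<partial>M) = Im (char M t)"
    unfolding char_def by (subst integral_Im[OF int, symmetric]) (simp add: Im_exp)
qed

text \<open>Esseen-type inequality. By \<open>fejer_nonneg\<close> and \<open>fejer_ge\<close>, 4
  times the Fejer kernel at \<open>(y - x) / h\<close> dominates the indicator of the interval;
  Fubini expresses its expectation through the characteristic function.\<close>

lemma (in real_distribution) concentration_le:
  assumes h: "h > 0"
  shows "measure M {x - h..x + h} \<le> 4 * (\<integral>t. cmod (char M (t / h)) \<partial>unit_uniform)"
proof -
  define K where "K y = (\<integral>t. (1 - t) * cos (t * ((y - x) / h)) \<partial>unit_uniform)" for y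
  note fub = fubini_unit_uniform[OF real_distribution_axioms, of "\<lambda>t y. (1 - t) * cos (t * ((y - x) / h))" 1]
  have bd: "\<bar>(1 - t) * cos (t * ((y - x) / h))\<bar> \<le> 1" if "0 \<le> t" "t \<le> 1" for t y
    using that by (simp add: abs_mult mult_le_one)
  have "measure M {x - h..x + h} = (\<integral>y. indicator {x - h..x + h} y \<partial>M)" by simp
  also have "\<dots> \<le> (\<integral>y. 4 * K y \<partial>M)"
  proof (rule integral_mono)
    show "integrable M (\<lambda>y. 4 * K y)" unfolding K_def
      by (intro integrable_mult_right fub(2)) (use bd in auto)
    fix y
    show "indicator {x - h..x + h} y \<le> 4 * K y"
    proof (cases "y \<in> {x - h..x + h}")
      case True
      then have "\<bar>(y - x) / h\<bar> \<le> 1" using h by (auto simp: abs_le_iff field_simps)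
      then show ?thesis using fejer_ge[of "(y - x) / h"] True by (simp add: K_def)
    qed (use fejer_nonneg[of "(y - x) / h"] in \<open>simp add: K_def\<close>)
  qed (auto simp: less_top[symmetric])
  also have "\<dots> = 4 * (\<integral>t. (\<integral>y. (1 - t) * cos (t * ((y - x) / h)) \<partial>M) \<partial>unit_uniform)"
    unfolding K_def by (subst fub(1)[symmetric]) (use bd in auto)
  also have "\<dots> \<le> 4 * (\<integral>t. cmod (char M (t / h)) \<partial>unit_uniform)"
  proof (intro mult_left_mono integral_mono_AE)
    \<comment> \<open>Centering at \<open>x\<close> only contributes a factor of modulus 1, so the
      bound is uniform in \<open>x\<close>.\<close>
    have eq: "(\<integral>y. cos (t * ((y - x) / h)) \<partial>M) = Re (iexp (- (t * x / h)) * char M (t / h))" for t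
    proof -
      have int: "integrable M (\<lambda>y. iexp (t / h * y))" by (rule integrable_iexp) auto
      have int2: "integrable M (\<lambda>y. iexp (- (t * x / h)) * iexp (t / h * y))" using int by simp
      have "iexp (- (t * x / h)) * char M (t / h) = (CLINT y|M. iexp (- (t * x / h)) * iexp (t / h * y))"
        unfolding char_def using int by simp
      also have "Re \<dots> = (\<integral>y. Re (iexp (- (t * x / h)) * iexp (t / h * y)) \<partial>M)"
        by (rule integral_Re[OF int2, symmetric])
      also have "\<dots> = (\<integral>y. cos (t * ((y - x) / h)) \<partial>M)"
      proof (rule Bochner_Integration.integral_cong[OF refl])
        fix y
        have "iexp (- (t * x / h)) * iexp (t / h * y) = iexp (t * ((y - x) / h))"
          unfolding exp_add[symmetric] by (simp add: diff_divide_distrib right_diff_distrib)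
        then show "Re (iexp (- (t * x / h)) * iexp (t / h * y)) = cos (t * ((y - x) / h))"
          by (simp add: Re_exp)
      qed
      finally show ?thesis ..
    qed
    have le: "(\<integral>y. (1 - t) * cos (t * ((y - x) / h)) \<partial>M) \<le> cmod (char M (t / h))" if "0 \<le> t" "t \<le> 1" for t
    proof -
      have "(\<integral>y. cos (t * ((y - x) / h)) \<partial>M) \<le> cmod (char M (t / h))"
        unfolding eq using complex_Re_le_cmod[of "iexp (- (t * x / h)) * char M (t / h)"]
          norm_exp_i_times[of "- (t * x / h)"] by (simp add: norm_mult)
      then have "(1 - t) * (\<integral>y. cos (t * ((y - x) / h)) \<partial>M) \<le> (1 - t) * cmod (char M (t / h))"
        using that by (intro mult_left_mono) auto
      also have "\<dots> \<le> cmod (char M (t / h))" using that by (intro mult_left_le_one_le) auto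
      finally show ?thesis by simp
    qed
    show "AE t in unit_uniform. (\<integral>y. (1 - t) * cos (t * ((y - x) / h)) \<partial>M) \<le> cmod (char M (t / h))"
      using AE_unit_uniform by eventually_elim (rule le, auto)
    show "integrable unit_uniform (\<lambda>t. cmod (char M (t / h)))"
      by (rule integrable_unit_uniform[where B=1]) (auto simp: cmod_char_le_1)
    have "\<bar>\<integral>y. (1 - t) * cos (t * ((y - x) / h)) \<partial>M\<bar> \<le> 1" if "0 \<le> t" "t \<le> 1" for t
    proof -
      have "\<bar>\<integral>y. (1 - t) * cos (t * ((y - x) / h)) \<partial>M\<bar> \<le> (\<integral>y. 1 \<partial>M)"
        by (rule integral_abs_bound_integral)
           (use bd[OF that] in \<open>auto intro!: integrable_const_bound[where B=1]\<close>)
      then show ?thesis by (simp add: prob_space[simplified])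
    qed
    then show "integrable unit_uniform (\<lambda>t. \<integral>y. (1 - t) * cos (t * ((y - x) / h)) \<partial>M)"
      by (intro integrable_unit_uniform[where B=1]) auto
  qed simp
  finally show ?thesis .
qed

text \<open>Averaging \<open>1 - cos\<close> over frequencies up to \<open>u\<close> gives
  \<open>1 - sin w / w\<close> with \<open>w = u * y\<close>. This is nonnegative and at least 1/2
  once \<open>\<bar>w\<bar> \<ge> 2\<close>, which explains the threshold \<open>2 / u\<close> and
  the factor 2.\<close>

lemma (in real_distribution) tail_le:
  assumes u: "u > 0" and B: "\<And>t. 0 \<le> t \<Longrightarrow> t \<le> u \<Longrightarrow> cmod (1 - char M t) \<le> B"
  shows "measure M {y. \<bar>y\<bar> \<ge> 2 / u} \<le> 2 * B"
proof -
  interpret U: prob_space unit_uniform by (rule prob_space_unit_uniform)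
  define K where "K y = (\<integral>t. 1 - cos (t * (u * y)) \<partial>unit_uniform)" for y
  have bd: "\<bar>1 - cos (t * (u * y))\<bar> \<le> 2" for t y
    using cos_ge_minus_one[of "t * (u * y)"] cos_le_one[of "t * (u * y)"] by (simp add: abs_le_iff)
  note fub = fubini_unit_uniform[OF real_distribution_axioms, of "\<lambda>t y. 1 - cos (t * (u * y))" 2]
  have "measure M {y. \<bar>y\<bar> \<ge> 2 / u} = (\<integral>y. indicator {y. \<bar>y\<bar> \<ge> 2 / u} y \<partial>M)" by simp
  also have "\<dots> \<le> (\<integral>y. 2 * K y \<partial>M)"
  proof (rule integral_mono)
    show "integrable M (\<lambda>y. 2 * K y)" unfolding K_def
      by (intro integrable_mult_right fub(2)) (use bd in auto)
    fix y
    show "indicator {y. \<bar>y\<bar> \<ge> 2 / u} y \<le> 2 * K y"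
    proof (cases "\<bar>y\<bar> \<ge> 2 / u")
      case True
      define w where "w = u * y"
      have w: "\<bar>w\<bar> \<ge> 2" using True u by (simp add: w_def abs_mult field_simps)
      have "K y = 1 - sin w / w"
      proof -
        have "K y = (\<integral>t. 1 \<partial>unit_uniform) - (\<integral>t. cos (t * w) \<partial>unit_uniform)"
          unfolding K_def w_def by (intro Bochner_Integration.integral_diff integrable_unit_uniform[where B=1]) auto
        then show ?thesis using w by (simp add: integral_unit_uniform_cos U.prob_space[simplified])
      qed
      moreover have "\<bar>sin w / w\<bar> \<le> 1 / 2"
        using w order_trans[OF abs_sin_le_one[of w], of "\<bar>w\<bar> / 2"] by (simp add: abs_divide field_simps)
      then have "sin w / w \<le> 1 / 2" by (rule abs_le_D1)
      ultimately have "1 \<le> 2 * K y" by linarith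
      then show ?thesis using True by simp
    next
      case False
      have "K y \<ge> 0" unfolding K_def by (intro integral_nonneg_AE) auto
      then show ?thesis using False by simp
    qed
  qed (auto simp: less_top[symmetric])
  also have "\<dots> = 2 * (\<integral>t. (\<integral>y. 1 - cos (t * (u * y)) \<partial>M) \<partial>unit_uniform)"
    unfolding K_def by (subst fub(1)[symmetric]) (use bd in auto)
  also have "\<dots> \<le> 2 * (\<integral>t. B \<partial>unit_uniform)"
  proof (intro mult_left_mono integral_mono_AE)
    have eq: "(\<integral>y. 1 - cos (t * (u * y)) \<partial>M) = 1 - Re (char M (t * u))" for t
    proof -
      have "(\<integral>y. 1 - cos (t * u * y) \<partial>M) = (\<integral>y. 1 \<partial>M) - (\<integral>y. cos (t * u * y) \<partial>M)"
        by (intro Bochner_Integration.integral_diff integrable_const_bound[where B=1]) auto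
      then show ?thesis by (simp add: char_cos_sin prob_space[simplified] flip: mult.assoc)
    qed
    have le: "1 - Re (char M (t * u)) \<le> B" if "0 \<le> t" "t \<le> 1" for t
    proof -
      have "t * u \<le> 1 * u" using that u by (intro mult_right_mono) auto
      then have "cmod (1 - char M (t * u)) \<le> B" using that u by (intro B) auto
      then show ?thesis using complex_Re_le_cmod[of "1 - char M (t * u)"] by simp
    qed
    show "AE t in unit_uniform. (\<integral>y. 1 - cos (t * (u * y)) \<partial>M) \<le> B"
      unfolding eq using AE_unit_uniform by eventually_elim (rule le, auto)
    show "integrable unit_uniform (\<lambda>t. B)" by simp
    have "\<bar>1 - Re (char M (t * u))\<bar> \<le> 2" for t
      using abs_Re_le_cmod[of "char M (t * u)"] cmod_char_le_1[of "t * u"] by simp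
    then show "integrable unit_uniform (\<lambda>t. \<integral>y. 1 - cos (t * (u * y)) \<partial>M)"
      unfolding eq by (intro integrable_unit_uniform[where B=2]) auto
  qed simp
  finally show ?thesis by (simp add: U.prob_space[simplified])
qed

text \<open>On the negative half line the sine averaged over frequencies up to \<open>T\<close> has
  one sign, and on \<open>[-1/e, -e]\<close> it has size at least \<open>T * e / 4\<close>: linear
  in \<open>T\<close>. The hypothesis bounds its expectation by order \<open>T powr \<gamma>\<close>
  with \<open>\<gamma> > 1\<close>, so letting \<open>T\<close> tend to 0 leaves no mass on the
  interval.\<close>

lemma (in real_distribution) negative_support_degenerate:
  assumes \<gamma>: "\<gamma> > 1" and C: "\<And>t. 0 \<le> t \<Longrightarrow> t \<le> 1 \<Longrightarrow> cmod (1 - char M t) \<le> C * t powr \<gamma>"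
    and neg: "measure M {0<..} = 0"
  shows "measure M {..<0} = 0"
proof -
  interpret U: prob_space unit_uniform by (rule prob_space_unit_uniform)
  have AEneg: "AE y in M. y \<le> 0"
    using neg by (subst AE_iff_measurable[OF _ refl]) (auto simp: emeasure_eq_measure not_le greaterThan_def)
  have C0: "C \<ge> 0" using C[of 1] norm_ge_zero[of "1 - char M 1"] by (simp del: norm_ge_zero)
  have bnd: "measure M {-1/e..-e} * (T * e / 4) \<le> C * T powr \<gamma>"
    if e: "0 < e" and T: "0 < T" "T \<le> e" "T \<le> 1" for e T
  proof -
    define K where "K y = (\<integral>t. sin (t * (T * y)) \<partial>unit_uniform)" for y
    note fub = fubini_unit_uniform[OF real_distribution_axioms, of "\<lambda>t y. sin (t * (T * y))" 1]
    have K: "K y = (1 - cos (T * y)) / (T * y)" if "y \<noteq> 0" for y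
      unfolding K_def using that T by (intro integral_unit_uniform_sin) auto
    have K0: "K 0 = 0" by (simp add: K_def)
    have Kle: "K y \<le> 0" if "y \<le> 0" for y
    proof (cases "y = 0")
      case False
      have "T * y \<le> 0" using that T by (simp add: mult_nonneg_nonpos)
      then show ?thesis unfolding K[OF False] by (intro divide_nonneg_nonpos) auto
    qed (simp add: K0)
    \<comment> \<open>\<open>T \<le> e\<close> keeps \<open>w = - T * y\<close> in
      \<open>(0, 1]\<close>, where \<open>fejer_ge\<close> yields
      \<open>1 - cos w \<ge> w * w / 4\<close>.\<close>
    have Kge: "T * e / 4 \<le> - K y" if "y \<in> {-1/e..-e}" for y
    proof -
      define w where "w = - (T * y)"
      have y: "y < 0" using that e by auto
      have w0: "w > 0" using y T by (simp add: w_def mult_pos_neg)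
      have "T * (- y) \<le> e * (1 / e)" using that T e y by (intro mult_mono) auto
      then have w1: "w \<le> 1" using e by (simp add: w_def)
      have "T * e \<le> T * (- y)" using that T by (intro mult_left_mono) auto
      then have we: "w \<ge> T * e" by (simp add: w_def)
      have "1 / 4 \<le> (1 - cos w) / w\<^sup>2"
        using fejer_ge[of w] w0 w1 by (simp add: integral_unit_uniform_fejer)
      then have "w * w / 4 \<le> 1 - cos w" using w0 by (simp add: power2_eq_square field_simps)
      then have "w / 4 \<le> (1 - cos w) / w" using w0 by (simp add: field_simps)
      also have "(1 - cos w) / w = - K y" using y T by (simp add: K w_def)
      finally show ?thesis using we by simp
    qed
    have "integrable M K" unfolding K_def by (rule fub(2)) simp_all
    then have int: "integrable M (\<lambda>y. - K y)" by simp
    have "measure M {-1/e..-e} * (T * e / 4) = (\<integral>y. indicator {-1/e..-e} y * (T * e / 4) \<partial>M)" by simp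
    also have "\<dots> \<le> (\<integral>y. - K y \<partial>M)"
    proof (rule integral_mono_AE[OF _ int])
      show "AE y in M. indicator {-1/e..-e} y * (T * e / 4) \<le> - K y"
        using AEneg by eventually_elim (use Kge Kle in \<open>auto simp: indicator_def\<close>)
    qed (auto simp: less_top[symmetric])
    also have "\<dots> = - (\<integral>t. (\<integral>y. sin (t * (T * y)) \<partial>M) \<partial>unit_uniform)"
      unfolding K_def by (subst fub(1)[symmetric]) auto
    also have "\<dots> = (\<integral>t. - Im (char M (t * T)) \<partial>unit_uniform)"
      by (simp add: char_cos_sin flip: mult.assoc)
    also have "\<dots> \<le> (\<integral>t. C * T powr \<gamma> \<partial>unit_uniform)"
    proof (intro integral_mono_AE)
      have le: "- Im (char M (t * T)) \<le> C * T powr \<gamma>" if "0 \<le> t" "t \<le> 1" for t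
      proof -
        have tT: "t * T \<le> T" using that T by (simp add: mult_left_le_one_le)
        then have tT1: "t * T \<le> 1" using T by linarith
        have "- Im (char M (t * T)) \<le> cmod (1 - char M (t * T))"
          using abs_Im_le_cmod[of "1 - char M (t * T)"] by simp
        also have "\<dots> \<le> C * (t * T) powr \<gamma>" using that T tT1 by (intro C) auto
        also have "\<dots> \<le> C * T powr \<gamma>" using C0 that T tT \<gamma> by (intro mult_left_mono powr_mono2) auto
        finally show ?thesis .
      qed
      show "AE t in unit_uniform. - Im (char M (t * T)) \<le> C * T powr \<gamma>"
        using AE_unit_uniform by eventually_elim (rule le, auto)
      have "\<bar>Im (char M (t * T))\<bar> \<le> 1" for t
        using abs_Im_le_cmod[of "char M (t * T)"] cmod_char_le_1[of "t * T"] by simp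
      then show "integrable unit_uniform (\<lambda>t. - Im (char M (t * T)))"
        by (intro integrable_unit_uniform[where B=1]) auto
    qed simp
    finally show ?thesis by (simp add: U.prob_space[simplified])
  qed
  have zero: "measure M {-1/e..-e} = 0" if e: "e > 0" for e
  proof -
    have "eventually (\<lambda>T. measure M {-1/e..-e} \<le> 4 * C / e * T powr (\<gamma> - 1)) (at_right 0)"
    proof -
      have "eventually (\<lambda>T. 0 < T \<and> T < min e 1) (at_right 0)"
        using e by (auto simp: eventually_at_right_field intro!: exI[of _ "min e 1"])
      then show ?thesis
      proof eventually_elim
        case (elim T)
        have "measure M {-1/e..-e} * (T * e / 4) \<le> C * T powr \<gamma>" using elim e by (intro bnd) auto
        moreover have "T powr \<gamma> = T powr (\<gamma> - 1) * T" using elim by (simp add: powr_diff)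
        ultimately have "measure M {-1/e..-e} * (T * e / 4) \<le> (4 * C / e * T powr (\<gamma> - 1)) * (T * e / 4)"
          using e elim by (simp add: field_simps)
        then show ?case using elim e by (subst (asm) mult_le_cancel_right_pos) auto
      qed
    qed
    moreover have "((\<lambda>T. 4 * C / e * T powr (\<gamma> - 1)) \<longlongrightarrow> 4 * C / e * 0) (at_right 0)"
    proof (intro tendsto_mult tendsto_const)
      have "filterlim (\<lambda>T. T powr (\<gamma> - 1)) (nhds (0 powr (\<gamma> - 1))) (at_right (0::real))"
        using \<gamma> by (intro tendsto_powr' tendsto_intros) (auto simp: eventually_at_right_field intro!: exI[of _ 1])
      then show "((\<lambda>T. T powr (\<gamma> - 1)) \<longlongrightarrow> 0) (at_right 0)" by simp
    qed
    ultimately have "measure M {-1/e..-e} \<le> 4 * C / e * 0"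
      by (intro tendsto_lowerbound[of _ _ "at_right (0::real)"]) auto
    then have "measure M {-1/e..-e} \<le> 0" by simp
    then show ?thesis using measure_nonneg[of M "{-1/e..-e}"] by linarith
  qed
  have "{..<0} = (\<Union>n::nat. {- 1 / inverse (real (Suc n)) .. - inverse (real (Suc n))})"
  proof safe
    fix y :: real assume y: "y < 0"
    obtain n1 where n1: "inverse (real (Suc n1)) < - y" using reals_Archimedean[of "- y"] y by auto
    obtain n2 :: nat where n2: "- y < real n2" using reals_Archimedean2 by blast
    let ?n = "max n1 n2"
    have "inverse (real (Suc ?n)) \<le> inverse (real (Suc n1))" by (intro le_imp_inverse_le) auto
    moreover have "- 1 / inverse (real (Suc ?n)) = - real (Suc ?n)" by (simp add: divide_inverse)
    moreover have "- y < real (Suc ?n)" using n2 by simp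
    ultimately have "y \<in> {- 1 / inverse (real (Suc ?n)) .. - inverse (real (Suc ?n))}"
      using n1 by (simp only: atLeastAtMost_iff) linarith
    then show "y \<in> (\<Union>n::nat. {- 1 / inverse (real (Suc n)) .. - inverse (real (Suc n))})" by blast
  next
    fix y n assume "y \<in> {- 1 / inverse (real (Suc n)) .. - inverse (real (Suc n))}"
    then show "y < 0" using inverse_positive_iff_positive[of "real (Suc n)"] by (auto simp del: inverse_positive_iff_positive)
  qed
  moreover have "(\<Union>n::nat. {- 1 / inverse (real (Suc n)) .. - inverse (real (Suc n))}) \<in> null_sets M"
    using zero by (intro null_sets_UN) (auto simp: null_sets_def emeasure_eq_measure)
  ultimately have "{..<0} \<in> null_sets M" by simp
  then show ?thesis by (rule measure_eq_0_null_sets)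
qed

section \<open>Uniform continuity theorem and moving thresholds\<close>

lemma norm_iexp_diff_le: "cmod (iexp u - iexp v) \<le> \<bar>u - v\<bar>"
proof -
  have "iexp u - iexp v = iexp v * (iexp (u - v) - 1)"
    by (simp add: right_diff_distrib algebra_simps flip: exp_add)
  then have "cmod (iexp u - iexp v) = cmod (iexp (u - v) - 1)"
    using norm_exp_i_times[of v] by (simp add: norm_mult)
  also have "\<dots> \<le> \<bar>u - v\<bar>" using iexp_approx1[of "u - v" 0] by simp
  finally show ?thesis .
qed

text \<open>Under a Skorohod coupling the difference of the characteristic functions is at most the
  expectation of \<open>min 2 (\<bar>T\<bar> * \<bar>Y n - Y'\<bar>)\<close>. This does not depend
  on \<open>t\<close> and tends to 0 by dominated convergence.\<close>

lemma levy_continuity_uniform: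
  assumes D: "\<And>n. real_distribution (D n)" "real_distribution D'" and w: "weak_conv_m D D'"
  shows "uniform_limit {-T..T} (\<lambda>n. char (D n)) (char D') sequentially"
proof -
  obtain \<Omega> :: "real measure" and Y Y' where \<Omega>: "prob_space \<Omega>"
    and Y: "\<And>n. Y n \<in> measurable \<Omega> borel" "\<And>n. distr \<Omega> borel (Y n) = D n"
    and Y': "Y' \<in> measurable \<Omega> lborel" "distr \<Omega> borel Y' = D'"
    and lim: "\<And>x. x \<in> space \<Omega> \<Longrightarrow> (\<lambda>n. Y n x) \<longlonglongrightarrow> Y' x"
    using Skorohod[OF D w] by blast
  interpret prob_space \<Omega> by fact
  have [measurable]: "Y n \<in> borel_measurable \<Omega>" "Y' \<in> borel_measurable \<Omega>" for n
    using Y Y' by (auto cong: measurable_cong_sets)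
  define e where "e n = (\<integral>x. min 2 (\<bar>T\<bar> * \<bar>Y n x - Y' x\<bar>) \<partial>\<Omega>)" for n
  have "e \<longlonglongrightarrow> (\<integral>x. 0 \<partial>\<Omega>)" unfolding e_def
  proof (rule integral_dominated_convergence[where w="\<lambda>_. 2"])
    show "AE x in \<Omega>. (\<lambda>n. min 2 (\<bar>T\<bar> * \<bar>Y n x - Y' x\<bar>)) \<longlonglongrightarrow> 0"
    proof (rule AE_I2)
      fix x assume "x \<in> space \<Omega>"
      from lim[OF this] have "(\<lambda>n. min 2 (\<bar>T\<bar> * \<bar>Y n x - Y' x\<bar>)) \<longlonglongrightarrow> min 2 (\<bar>T\<bar> * \<bar>Y' x - Y' x\<bar>)"
        by (intro tendsto_intros)
      then show "(\<lambda>n. min 2 (\<bar>T\<bar> * \<bar>Y n x - Y' x\<bar>)) \<longlonglongrightarrow> 0" by simp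
    qed
  qed (auto simp: min_def)
  then have e0: "e \<longlonglongrightarrow> 0" by simp
  have le: "cmod (char (D n) t - char D' t) \<le> e n" if "t \<in> {-T..T}" for n t
  proof -
    have i: "integrable \<Omega> (\<lambda>x. iexp (t * Z x))" if [measurable]: "Z \<in> borel_measurable \<Omega>" for Z
      by (rule integrable_const_bound[where B=1]) (auto simp del: of_real_mult)
    have "char (D n) t - char D' t = (CLINT x|\<Omega>. iexp (t * Y n x)) - (CLINT x|\<Omega>. iexp (t * Y' x))"
      unfolding char_def Y(2)[symmetric] Y'(2)[symmetric] by (simp add: integral_distr)
    also have "\<dots> = (CLINT x|\<Omega>. iexp (t * Y n x) - iexp (t * Y' x))"
      by (intro Bochner_Integration.integral_diff[symmetric] i) auto
    finally have eq: "char (D n) t - char D' t = (CLINT x|\<Omega>. iexp (t * Y n x) - iexp (t * Y' x))" .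
    show ?thesis unfolding eq e_def
    proof (rule order_trans[OF integral_norm_bound integral_mono])
      show "integrable \<Omega> (\<lambda>x. cmod (iexp (t * Y n x) - iexp (t * Y' x)))"
        by (intro integrable_norm Bochner_Integration.integrable_diff i) auto
      show "integrable \<Omega> (\<lambda>x. min 2 (\<bar>T\<bar> * \<bar>Y n x - Y' x\<bar>))"
        by (rule integrable_const_bound[where B=2]) (auto simp: min_def)
      fix x
      have "cmod (iexp (t * Y n x) - iexp (t * Y' x)) \<le> \<bar>t * Y n x - t * Y' x\<bar>" by (rule norm_iexp_diff_le)
      also have "\<dots> = \<bar>t\<bar> * \<bar>Y n x - Y' x\<bar>" by (simp add: abs_mult flip: right_diff_distrib)
      also have "\<dots> \<le> \<bar>T\<bar> * \<bar>Y n x - Y' x\<bar>" using that by (intro mult_right_mono) auto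
      finally have 1: "cmod (iexp (t * Y n x) - iexp (t * Y' x)) \<le> \<bar>T\<bar> * \<bar>Y n x - Y' x\<bar>" .
      have "cmod (iexp (t * Y n x) - iexp (t * Y' x)) \<le> 1 + 1"
        by (rule order_trans[OF norm_triangle_ineq4]) (simp only: norm_exp_i_times order_refl)
      then show "cmod (iexp (t * Y n x) - iexp (t * Y' x)) \<le> min 2 (\<bar>T\<bar> * \<bar>Y n x - Y' x\<bar>)" using 1 by simp
    qed
  qed
  show ?thesis
  proof (rule uniform_limitI)
    fix r :: real assume "r > 0"
    with e0 have "eventually (\<lambda>n. e n < r) sequentially" by (rule order_tendstoD)
    then show "eventually (\<lambda>n. \<forall>t\<in>{-T..T}. dist (char (D n) t) (char D' t) < r) sequentially"
      by eventually_elim (auto simp: dist_norm intro: le_less_trans[OF le])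
  qed
qed

text \<open>Without atoms the limit distribution function is continuous, so tails at the moving
  point \<open>x i\<close> are squeezed between values of the distribution function at
  \<open>x0 - d\<close> and \<open>x0 + d\<close>. The index runs along an arbitrary filter because
  it will be a function of the drift \<open>a\<close>.\<close>

lemma weak_conv_moving_threshold:
  assumes D: "\<And>n. real_distribution (D n)" "real_distribution D'" and w: "weak_conv_m D D'"
    and atomless: "\<And>y. measure D' {y} = 0"
    and n: "filterlim n sequentially F" and x: "(x \<longlongrightarrow> x0) F"
  shows "((\<lambda>i. measure (D (n i)) {x i..}) \<longlongrightarrow> measure D' {x0..}) F"
    and "((\<lambda>i. measure (D (n i)) {x i<..}) \<longlongrightarrow> measure D' {x0..}) F"
proof -
  interpret D': real_distribution D' by fact
  have cont: "isCont (cdf D') y" for y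
    using atomless by (simp add: D'.isCont_cdf)
  have lim: "((\<lambda>i. cdf (D (n i)) y) \<longlongrightarrow> cdf D' y) F" for y
    using w cont by (auto simp: weak_conv_m_def weak_conv_def intro: filterlim_compose[OF _ n])
  have tail': "measure D' {x0..} = 1 - cdf D' x0"
  proof -
    have "measure D' {x0..} = measure D' ({x0} \<union> {x0<..})" by (intro arg_cong[where f="measure D'"]) auto
    also have "\<dots> = measure D' {x0} + measure D' {x0<..}"
      by (rule D'.finite_measure_Union) auto
    also have "measure D' {x0<..} = 1 - measure D' {..x0}"
      using D'.prob_compl[of "{..x0}"] by (simp add: Compl_eq_Diff_UNIV[symmetric])
    finally show ?thesis using atomless by (simp add: cdf_def)
  qed
  have sand: "1 - cdf (D m) z \<le> measure (D m) {y<..}" "measure (D m) {y<..} \<le> measure (D m) {y..}"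
     "measure (D m) {y..} \<le> 1 - cdf (D m) v" if "v < y" "y < z" for m v y z
  proof -
    interpret Dm: real_distribution "D m" by (rule D)
    have c: "1 - cdf (D m) v = measure (D m) {v<..}" for v
      using Dm.prob_compl[of "{..v}"] by (simp add: Compl_eq_Diff_UNIV[symmetric] cdf_def)
    show "1 - cdf (D m) z \<le> measure (D m) {y<..}" "measure (D m) {y<..} \<le> measure (D m) {y..}"
     "measure (D m) {y..} \<le> 1 - cdf (D m) v"
      unfolding c using that by (auto intro!: Dm.finite_measure_mono)
  qed
  have "eventually (\<lambda>i. cdf D' x0 - e < cdf (D (n i)) (x0 - d) \<and> cdf (D (n i)) (x0 + d) < cdf D' x0 + e
      \<and> x0 - d < x i \<and> x i < x0 + d) F"
    if "e > 0" "d > 0" "cdf D' x0 - e < cdf D' (x0 - d)" "cdf D' (x0 + d) < cdf D' x0 + e" for e d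
    using order_tendstoD(1)[OF lim that(3)] order_tendstoD(2)[OF lim that(4)]
      order_tendstoD(1)[OF x, of "x0 - d"] order_tendstoD(2)[OF x, of "x0 + d"] \<open>d > 0\<close>
    by (auto simp: eventually_conj_iff)
  moreover have "\<exists>d>0. cdf D' x0 - e < cdf D' (x0 - d) \<and> cdf D' (x0 + d) < cdf D' x0 + e" if "e > 0" for e
  proof -
    have "\<exists>d>0. \<forall>y. \<bar>y - x0\<bar> < d \<longrightarrow> \<bar>cdf D' y - cdf D' x0\<bar> < e"
      using cont[of x0] that unfolding continuous_at_eps_delta dist_real_def by simp
    then obtain d where d: "d > 0" "\<And>y. \<bar>y - x0\<bar> < d \<Longrightarrow> \<bar>cdf D' y - cdf D' x0\<bar> < e"
      by blast
    show ?thesis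
      using d(1) d(2)[of "x0 - d / 2"] d(2)[of "x0 + d / 2"] by (intro exI[of _ "d / 2"]) (auto simp: abs_less_iff)
  qed
  ultimately have ev: "\<exists>d>0. eventually (\<lambda>i. cdf D' x0 - e < cdf (D (n i)) (x0 - d) \<and> cdf (D (n i)) (x0 + d) < cdf D' x0 + e
      \<and> x0 - d < x i \<and> x i < x0 + d) F" if "e > 0" for e
    using that by meson
  have close: "eventually (\<lambda>i. \<bar>measure (D (n i)) {x i..} - measure D' {x0..}\<bar> < e \<and>
      \<bar>measure (D (n i)) {x i<..} - measure D' {x0..}\<bar> < e) F" if e: "e > 0" for e
  proof -
    from ev[OF e] obtain d where "eventually (\<lambda>i. cdf D' x0 - e < cdf (D (n i)) (x0 - d) \<and> cdf (D (n i)) (x0 + d) < cdf D' x0 + e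
      \<and> x0 - d < x i \<and> x i < x0 + d) F" by blast
    then show ?thesis
    proof eventually_elim
      case (elim i)
      then show ?case using sand[of "x0 - d" "x i" "x0 + d" "n i"] tail'
        by (auto simp: abs_less_iff)
    qed
  qed
  show "((\<lambda>i. measure (D (n i)) {x i..}) \<longlongrightarrow> measure D' {x0..}) F"
    "((\<lambda>i. measure (D (n i)) {x i<..}) \<longlongrightarrow> measure D' {x0..}) F"
    using close by (auto simp: tendsto_iff dist_real_def eventually_conj_iff)
qed

section \<open>Marginal estimates for the attracted walk\<close>

lemma norm_stable_char: "cmod (stable_char \<alpha> \<beta> t) = exp (- (\<bar>t\<bar> powr \<alpha>))"
  by (simp add: stable_char_def)

text \<open>The exponent stays in a fixed ball, where \<open>exp\<close> is Lipschitz. The order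
  \<open>\<alpha> > 1\<close> is what \<open>negative_support_degenerate\<close> requires.\<close>

lemma norm_one_minus_stable_char:
  assumes "\<alpha> > 0"
  shows "\<exists>C. \<forall>t. 0 \<le> t \<longrightarrow> t \<le> 1 \<longrightarrow> cmod (1 - stable_char \<alpha> \<beta> t) \<le> C * t powr \<alpha>"
proof -
  define z where "z = 1 - \<i> * complex_of_real (\<beta> * tan (pi * \<alpha> / 2))"
  have "cmod (1 - stable_char \<alpha> \<beta> t) \<le> (cmod z * exp (cmod z)) * t powr \<alpha>" if t: "0 \<le> t" "t \<le> 1" for t
  proof (cases "t = 0")
    case False
    define u where "u = - complex_of_real (t powr \<alpha>) * z"
    have eq: "stable_char \<alpha> \<beta> t = exp u"
      using t False by (simp add: stable_char_def u_def z_def)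
    have t1: "t powr \<alpha> \<le> 1" using t assms powr_mono2[of \<alpha> t 1] by simp
    have nu: "cmod u = t powr \<alpha> * cmod z" by (simp add: u_def norm_mult)
    have le: "cmod u \<le> cmod z" unfolding nu using t1 by (simp add: mult_left_le_one_le)
    have "cmod (exp u - exp 0) \<le> exp (cmod z) * cmod (u - 0)"
    proof (rule field_differentiable_bound[of "cball 0 (cmod z)" exp exp])
      fix w :: complex assume "w \<in> cball 0 (cmod z)"
      then have "Re w \<le> cmod z" using complex_Re_le_cmod[of w] by (simp add: dist_norm)
      then show "cmod (exp w) \<le> exp (cmod z)" by simp
    qed (use le in \<open>auto simp: dist_norm intro: DERIV_subset[OF DERIV_exp]\<close>)
    then have "cmod (exp u - 1) \<le> exp (cmod z) * (t powr \<alpha> * cmod z)" unfolding nu[symmetric] by simp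
    then show ?thesis unfolding eq by (simp add: norm_minus_commute mult_ac)
  qed (use assms in \<open>simp add: stable_char_def\<close>)
  then show ?thesis by blast
qed

locale attracted_walk = iid_reals M X for M :: "'a measure" and X +
  fixes \<alpha> \<beta> :: real and \<mu> :: "real measure" and b :: "nat \<Rightarrow> real"
  assumes \<alpha>: "1 < \<alpha>" "\<alpha> \<le> 2"
    and stable: "stable_law \<alpha> \<beta> \<mu>"
    and b_gt_0: "b n > 0"
    and attr: "weak_conv_m (\<lambda>n. distr M borel (\<lambda>\<omega>. (\<Sum>i=1..n. X i \<omega>) / b n)) \<mu>"
begin

definition S :: "nat \<Rightarrow> 'a \<Rightarrow> real" where
  "S n \<omega> = (\<Sum>i=1..n. X i \<omega>)"

definition \<phi> :: "real \<Rightarrow> complex" where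
  "\<phi> = char (distr M borel (X 0))"

definition D :: "nat \<Rightarrow> real measure" where
  "D n = distr M borel (\<lambda>\<omega>. S n \<omega> / b n)"

lemma rv_S [measurable]: "S n \<in> borel_measurable M"
  unfolding S_def by measurable

lemma real_distribution_\<mu>: "real_distribution \<mu>" and char_\<mu>: "char \<mu> = stable_char \<alpha> \<beta>"
  using stable by (auto simp: stable_law_def)

sublocale \<mu>: real_distribution \<mu> by (rule real_distribution_\<mu>)

lemma real_distribution_D: "real_distribution (D n)"
  unfolding D_def by (rule real_distribution_distr) simp

lemma weak_conv_D: "weak_conv_m D \<mu>"
  using attr unfolding D_def S_def .

lemma char_S: "char (distr M borel (S n)) t = \<phi> t ^ n"
proof -
  have "char (distr M borel (\<lambda>\<omega>. \<Sum>i\<in>{1..n}. X i \<omega>)) t = (\<Prod>i\<in>{1..n}. char (distr M borel (X i)) t)"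
    by (rule char_distr_sum) (rule indep_vars_subset[OF indep_X], simp)
  also have "\<dots> = (\<Prod>i\<in>{1..n}. \<phi> t)"
    unfolding \<phi>_def by (intro prod.cong refl arg_cong2[where f=char] distr_X)
  finally show ?thesis by (simp add: S_def[abs_def])
qed

lemma char_D: "char (D n) t = \<phi> (t / b n) ^ n"
proof -
  have "char (D n) t = char (distr M borel (S n)) (t / b n)"
    unfolding D_def char_def by (simp add: integral_distr)
  then show ?thesis by (simp add: char_S)
qed

sublocale Law: real_distribution "distr M borel (X 0)"
  by (rule real_distribution_distr) simp

sublocale attraction \<phi> "stable_char \<alpha> \<beta>" b \<alpha>
proof
  show "isCont \<phi> 0" "\<phi> 0 = 1" "cmod (\<phi> t) \<le> 1" for t
    by (auto simp: \<phi>_def Law.isCont_char Law.char_zero Law.cmod_char_le_1)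
  show "uniform_limit {-T..T} (\<lambda>n t. \<phi> (t / b n) ^ n) (stable_char \<alpha> \<beta>) sequentially" for T
    using levy_continuity_uniform[OF real_distribution_D real_distribution_\<mu> weak_conv_D, of T]
    by (simp add: char_D[abs_def] char_\<mu>)
  show "isCont (stable_char \<alpha> \<beta>) 0" using \<mu>.isCont_char by (simp add: char_\<mu>)
  show "stable_char \<alpha> \<beta> 0 = 1" using \<mu>.char_zero by (simp add: char_\<mu>)
qed (use \<alpha> b_gt_0 in \<open>auto simp: norm_stable_char\<close>)

text \<open>The concentration bound for radius \<open>1 / n\<close> is an average of
  \<open>exp (- ((t * n) powr \<alpha>))\<close> over \<open>[0, 1]\<close>, which vanishes in the
  limit.\<close>

lemma \<mu>_atomless: "measure \<mu> {x} = 0"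
proof -
  interpret U: prob_space unit_uniform by (rule prob_space_unit_uniform)
  have "(\<lambda>n. 4 * (\<integral>t. exp (- ((t * real n) powr \<alpha>)) \<partial>unit_uniform)) \<longlonglongrightarrow> 4 * (\<integral>t. 0 \<partial>unit_uniform)"
  proof (intro tendsto_mult tendsto_const integral_dominated_convergence[where w="\<lambda>_. 1"])
    have "AE t in unit_uniform. t \<noteq> 0" unfolding unit_uniform_def by (subst AE_density) (auto intro: eventually_mono[OF AE_lborel_singleton[of 0]])
    then show "AE t in unit_uniform. (\<lambda>n. exp (- ((t * real n) powr \<alpha>))) \<longlonglongrightarrow> 0"
      using AE_unit_uniform
    proof eventually_elim
      case (elim t)
      then have "t > 0" by simp
      then show ?case using \<alpha> by real_asymp
    qed
  qed auto
  moreover have "measure \<mu> {x} \<le> 4 * (\<integral>t. exp (- ((t * real (Suc n)) powr \<alpha>)) \<partial>unit_uniform)" for n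
  proof -
    have "measure \<mu> {x} \<le> measure \<mu> {x - 1 / real (Suc n)..x + 1 / real (Suc n)}"
      by (intro \<mu>.finite_measure_mono) auto
    also have "\<dots> \<le> 4 * (\<integral>t. cmod (char \<mu> (t / (1 / real (Suc n)))) \<partial>unit_uniform)"
      by (intro \<mu>.concentration_le) simp
    also have "(\<integral>t. cmod (char \<mu> (t / (1 / real (Suc n)))) \<partial>unit_uniform) = (\<integral>t. exp (- ((t * real (Suc n)) powr \<alpha>)) \<partial>unit_uniform)"
    proof (rule integral_cong_AE)
      show "AE t in unit_uniform. cmod (char \<mu> (t / (1 / real (Suc n)))) = exp (- ((t * real (Suc n)) powr \<alpha>))"
        using AE_unit_uniform by eventually_elim (simp add: char_\<mu> norm_stable_char abs_mult del: of_nat_Suc)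
      show "(\<lambda>t. cmod (char \<mu> (t / (1 / real (Suc n))))) \<in> borel_measurable unit_uniform" by simp
    qed auto
    finally show ?thesis .
  qed
  moreover define f where "f n = 4 * (\<integral>t. exp (- ((t * real n) powr \<alpha>)) \<partial>unit_uniform)" for n
  ultimately have "f \<longlonglongrightarrow> 4 * (\<integral>t. 0 \<partial>unit_uniform)" "\<And>n. measure \<mu> {x} \<le> f (Suc n)"
    unfolding f_def[abs_def] by blast+
  then have "measure \<mu> {x} \<le> 4 * (\<integral>t. 0 \<partial>unit_uniform)"
    by (intro LIMSEQ_le_const[OF LIMSEQ_Suc[of f]]) blast+
  then show ?thesis using measure_nonneg[of \<mu> "{x}"] by simp
qed

section \<open>Positivity probabilities, their estimates and the time scale\<close>

definition \<rho> :: real where "\<rho> = measure \<mu> {0..}"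

text \<open>The inequality in \<open>p\<close> is strict: otherwise an atom of \<open>S n\<close> at
  0 would survive in \<open>p n - q a n\<close> as \<open>a\<close> tends to 0. \<open>q a n\<close>
  is the probability that the walk with drift \<open>- a\<close> is nonnegative at time
  \<open>n\<close>.\<close>

definition p :: "nat \<Rightarrow> real" where "p n = prob {\<omega>\<in>space M. S n \<omega> > 0}"

definition q :: "real \<Rightarrow> nat \<Rightarrow> real" where "q a n = prob {\<omega>\<in>space M. S n \<omega> \<ge> real n * a}"

lemma p_bounds: "0 \<le> p n" "p n \<le> 1" and q_bounds: "0 \<le> q a n" "q a n \<le> 1"
  by (simp_all add: p_def q_def)

lemma \<rho>_bounds: "0 \<le> \<rho>" "\<rho> \<le> 1"
  by (simp_all add: \<rho>_def)

lemma measure_D: "x \<in> sets borel \<Longrightarrow> measure (D n) x = prob {\<omega>\<in>space M. S n \<omega> / b n \<in> x}"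
  unfolding D_def by (subst measure_distr) (auto intro!: arg_cong[where f=prob])

lemma p_tendsto: "p \<longlonglongrightarrow> \<rho>"
proof -
  have "(\<lambda>n. measure (D n) {0<..}) \<longlonglongrightarrow> measure \<mu> {0..}"
    by (rule weak_conv_moving_threshold(2)[OF real_distribution_D real_distribution_\<mu> weak_conv_D \<mu>_atomless filterlim_ident tendsto_const])
  moreover have "measure (D n) {0<..} = p n" for n
    using b_gt_0[of n] by (simp add: measure_D p_def zero_less_divide_iff)
  ultimately show ?thesis by (simp add: \<rho>_def)
qed

lemma q_tendsto:
  assumes n: "filterlim n sequentially F" and x: "((\<lambda>i. real (n i) * a i / b (n i)) \<longlongrightarrow> x) F"
  shows "((\<lambda>i. q (a i) (n i)) \<longlongrightarrow> measure \<mu> {x..}) F"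
proof -
  have "((\<lambda>i. measure (D (n i)) {real (n i) * a i / b (n i)..}) \<longlongrightarrow> measure \<mu> {x..}) F"
    by (rule weak_conv_moving_threshold(1)[OF real_distribution_D real_distribution_\<mu> weak_conv_D \<mu>_atomless n x])
  moreover have "measure (D n) {real n * a / b n..} = q a n" for n a
    using b_gt_0[of n] by (simp add: measure_D q_def divide_le_cancel) 
  ultimately show ?thesis by simp
qed

text \<open>\<open>concentration_le\<close> with interval length \<open>h\<close> uses frequencies
  up to \<open>1 / h\<close>, and \<open>\<phi>\<close> is controlled only on
  \<open>[0, t0]\<close>; a lattice law returns to modulus 1 further out. Hence the restriction to
  \<open>h \<ge> h0 = 1 / t0\<close>.\<close>

lemma prob_interval_le:
  "\<exists>C h0. C > 0 \<and> h0 > 0 \<and> (\<forall>n h. h \<ge> h0 \<longrightarrow> prob {\<omega>\<in>space M. 0 < S n \<omega> \<and> S n \<omega> < h} \<le> C * h / b n)"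
proof -
  interpret U: prob_space unit_uniform by (rule prob_space_unit_uniform)
  obtain c C t0 n0 where c: "c > 0" "C > 0" "t0 > 0"
    and le: "\<And>n s. n \<ge> n0 \<Longrightarrow> 0 \<le> s \<Longrightarrow> s \<le> t0 \<Longrightarrow> cmod (\<phi> s) ^ n \<le> C * exp (- (c * b n * s))"
    using norm_power_le_exp by blast
  define h0 where "h0 = 1 / t0"
  have h0: "h0 > 0" using c by (simp add: h0_def)
  have A: "prob {\<omega>\<in>space M. 0 < S n \<omega> \<and> S n \<omega> < h} \<le> 4 * C / c * h / b n" if n: "n \<ge> n0" and h: "h \<ge> h0" for n h
  proof -
    interpret L: real_distribution "distr M borel (S n)" by (rule real_distribution_distr) simp
    have hp: "h > 0" using h h0 by simp
    define k where "k = c * b n / h"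
    have k: "k > 0" using c b_gt_0[of n] hp by (simp add: k_def)
    have "prob {\<omega>\<in>space M. 0 < S n \<omega> \<and> S n \<omega> < h} \<le> prob (S n -` {0 - h..0 + h} \<inter> space M)"
      using hp by (intro finite_measure_mono) auto
    also have "\<dots> = measure (distr M borel (S n)) {0 - h..0 + h}" by (subst measure_distr) auto
    also have "\<dots> \<le> 4 * (\<integral>t. cmod (char (distr M borel (S n)) (t / h)) \<partial>unit_uniform)" by (rule L.concentration_le[OF hp])
    also have "\<dots> \<le> 4 * (\<integral>t. C * exp (- (k * t)) \<partial>unit_uniform)"
    proof (intro mult_left_mono integral_mono_AE)
      show "integrable unit_uniform (\<lambda>t. cmod (char (distr M borel (S n)) (t / h)))"
        by (rule integrable_unit_uniform[where B=1]) (auto simp: L.cmod_char_le_1)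
      show "integrable unit_uniform (\<lambda>t. C * exp (- (k * t)))"
        using k c by (intro integrable_unit_uniform[where B=C]) (auto simp: abs_mult)
      show "AE t in unit_uniform. cmod (char (distr M borel (S n)) (t / h)) \<le> C * exp (- (k * t))"
        using AE_unit_uniform
      proof eventually_elim
        case (elim t)
        have "t / h \<le> 1 / h0" using elim h h0 by (intro frac_le) auto
        then have "cmod (\<phi> (t / h)) ^ n \<le> C * exp (- (c * b n * (t / h)))"
          using elim hp by (intro le[OF n]) (auto simp: h0_def)
        then show ?case by (simp add: char_S norm_power k_def)
      qed
    qed simp
    also have "(\<integral>t. C * exp (- (k * t)) \<partial>unit_uniform) = C * (1 - exp (- k)) / k"
      using k by (subst integral_unit_uniform_FTC[where F = "\<lambda>t. - C * exp (- (k * t)) / k"])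
        (auto intro!: derivative_eq_intros continuous_intros simp: field_simps)
    also have "4 * (C * (1 - exp (- k)) / k) \<le> 4 * (C * 1 / k)"
      using k c by (intro mult_left_mono divide_right_mono) auto
    also have "\<dots> = 4 * C / c * h / b n" using c by (simp add: k_def)
    finally show ?thesis .
  qed
  define B where "B = (\<Sum>n<n0. b n)"
  have bB: "b n \<le> B" if "n < n0" for n
    unfolding B_def using that b_gt_0 by (intro member_le_sum) (auto simp: less_imp_le)
  have B0: "B \<ge> 0" unfolding B_def using b_gt_0 by (intro sum_nonneg) (auto simp: less_imp_le)
  \<comment> \<open>The second summand makes the bound at least 1 for the finitely many
    \<open>n < n0\<close>.\<close>
  define C' where "C' = 4 * C / c + B / h0"
  have "prob {\<omega>\<in>space M. 0 < S n \<omega> \<and> S n \<omega> < h} \<le> C' * h / b n" if h: "h \<ge> h0" for n h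
  proof (cases "n \<ge> n0")
    case True
    have "4 * C / c * h / b n \<le> C' * h / b n"
      unfolding C'_def using h h0 b_gt_0[of n] B0 by (intro divide_right_mono mult_right_mono) auto
    then show ?thesis using A[OF True h] by linarith
  next
    case False
    have "b n * h0 \<le> B * h" using False h h0 B0 bB[of n] by (intro mult_mono) auto
    then have "1 \<le> B / h0 * h / b n" using h0 b_gt_0[of n] by (simp add: field_simps)
    also have "\<dots> \<le> C' * h / b n"
      unfolding C'_def using h h0 b_gt_0[of n] c by (intro divide_right_mono mult_right_mono) auto
    finally show ?thesis by (rule order_trans[OF prob_le_1])
  qed
  moreover have "C' > 0" unfolding C'_def using c B0 h0 by (intro add_pos_nonneg) auto
  ultimately show ?thesis using h0 by blast
qed

text \<open>The truncation inequality at frequency \<open>T / (x * b n)\<close>, with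
  \<open>cmod (1 - z ^ n) \<le> n * cmod (1 - z)\<close> on the unit disc.\<close>

lemma tail_S:
  assumes p': "1 / \<alpha> < p'"
  shows "\<exists>C T n0. C > 0 \<and> T > 0 \<and> (\<forall>n\<ge>n0. \<forall>x\<ge>1. prob {\<omega>\<in>space M. \<bar>S n \<omega>\<bar> \<ge> 2 * x * b n / T} \<le> C * x powr (- 1 / p'))"
proof -
  obtain C T n0 where C: "C > 0" "T > 0" and le: "\<And>n x t. n \<ge> n0 \<Longrightarrow> x \<ge> 1 \<Longrightarrow> \<bar>t\<bar> * (x * b n) \<le> T \<Longrightarrow>
     real n * cmod (1 - \<phi> t) \<le> C * x powr (- 1 / p')"
    using one_minus_decay[OF p'] by blast
  have "prob {\<omega>\<in>space M. \<bar>S n \<omega>\<bar> \<ge> 2 * x * b n / T} \<le> (2 * C) * x powr (- 1 / p')" if n: "n \<ge> n0" and x: "x \<ge> 1" for n x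
  proof -
    interpret L: real_distribution "distr M borel (S n)" by (rule real_distribution_distr) simp
    define u where "u = T / (x * b n)"
    have u: "u > 0" using C x b_gt_0[of n] by (simp add: u_def)
    have "prob {\<omega>\<in>space M. \<bar>S n \<omega>\<bar> \<ge> 2 * x * b n / T} = measure (distr M borel (S n)) {y. \<bar>y\<bar> \<ge> 2 / u}"
      by (subst measure_distr) (auto simp: u_def mult.assoc intro!: arg_cong[where f=prob])
    also have "\<dots> \<le> 2 * (C * x powr (- 1 / p'))"
    proof (rule L.tail_le[OF u])
      fix t assume t: "0 \<le> t" "t \<le> u"
      have "cmod (1 ^ n - \<phi> t ^ n) \<le> real n * cmod (1 - \<phi> t)"
        by (rule norm_power_diff) (auto simp: \<phi>_le)
      also have "\<dots> \<le> C * x powr (- 1 / p')"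
        using t x b_gt_0[of n] by (intro le[OF n x]) (auto simp: u_def field_simps)
      finally show "cmod (1 - char (distr M borel (S n)) t) \<le> C * x powr (- 1 / p')"
        by (simp add: char_S)
    qed
    finally show ?thesis by simp
  qed
  then show ?thesis using C by (intro exI[of _ "2 * C"] exI[of _ T] exI[of _ n0]) auto
qed

text \<open>Without mass on the nonnegative half line the limit would be a law to which
  \<open>negative_support_degenerate\<close> applies, leaving no mass at all. This positivity feeds
  \<open>J_strict\<close> and thereby the positive limit constant.\<close>

lemma \<rho>_pos: "\<rho> > 0"
proof (rule ccontr)
  assume "\<not> \<rho> > 0"
  then have z: "measure \<mu> {0..} = 0" by (simp add: \<rho>_def not_less measure_le_0_iff)
  then have "measure \<mu> {0<..} \<le> 0"
    using \<mu>.finite_measure_mono[of "{0<..}" "{0..}"] by (simp add: subset_eq)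
  then have z2: "measure \<mu> {0<..} = 0" using measure_nonneg[of \<mu> "{0<..}"] by linarith
  obtain C where "\<And>t. 0 \<le> t \<Longrightarrow> t \<le> 1 \<Longrightarrow> cmod (1 - stable_char \<alpha> \<beta> t) \<le> C * t powr \<alpha>"
    using norm_one_minus_stable_char[of \<alpha> \<beta>] \<alpha> by auto
  then have "measure \<mu> {..<0} = 0"
    by (intro \<mu>.negative_support_degenerate[of \<alpha> C] \<alpha> z2) (simp add: char_\<mu>)
  moreover have "measure \<mu> (space \<mu>) = measure \<mu> {..<0} + measure \<mu> {0..}"
  proof -
    have "{..<0} \<union> {0..} = (UNIV :: real set)" by auto
    moreover have "measure \<mu> ({..<0} \<union> {0..}) = measure \<mu> {..<0} + measure \<mu> {0..}"
      by (rule \<mu>.finite_measure_Union) auto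
    ultimately show ?thesis by simp
  qed
  ultimately show False using z \<mu>.prob_space by simp
qed

text \<open>Since \<open>\<alpha> > 1\<close>, a Potter exponent \<open>p' < 1\<close> is available:
  the drift eventually beats the fluctuations, so the least index defining \<open>N\<close>
  exists.\<close>

lemma b_over_n: "(\<lambda>n. b n / real n) \<longlonglongrightarrow> 0"
proof -
  define p' where "p' = (1 / \<alpha> + 1) / 2"
  have "1 / \<alpha> < 1" using \<alpha> by simp
  then have p': "1 / \<alpha> < p'" "p' < 1" by (auto simp: p'_def)
  obtain C n0 where C: "C \<ge> 1" "n0 \<ge> 1"
    "\<And>m n. n0 \<le> m \<Longrightarrow> m \<le> n \<Longrightarrow> b n \<le> C * (real n / real m) powr p' * b m"
    using potter[of 0 p'] \<alpha> p' by auto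
  define K where "K = C * b n0 / real n0 powr p'"
  have "eventually (\<lambda>n. norm (b n / real n) \<le> K * real n powr (p' - 1)) sequentially"
    using eventually_ge_at_top[of n0]
  proof eventually_elim
    case (elim n)
    have n: "n \<ge> 1" using elim C by simp
    have "b n / real n \<le> C * (real n / real n0) powr p' * b n0 / real n"
      using C(3)[OF order_refl elim] by (intro divide_right_mono) auto
    also have "\<dots> = K * real n powr (p' - 1)"
      using n C by (simp add: K_def powr_divide powr_diff)
    finally show ?case using b_gt_0[of n] by simp
  qed
  moreover have "(\<lambda>n. real n powr (p' - 1)) \<longlonglongrightarrow> 0"
    using p' by real_asymp
  from tendsto_mult_left[OF this, of K] have "(\<lambda>n. K * real n powr (p' - 1)) \<longlonglongrightarrow> 0" by simp
  ultimately show ?thesis by (rule Lim_null_comparison)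
qed

text \<open>The time scale on which the drift \<open>a\<close> becomes visible: \<open>b (N a)\<close> is asymptotic to \<open>N a * a\<close>.\<close>

definition N :: "real \<Rightarrow> nat" where
  "N a = (LEAST n. n \<ge> 1 \<and> b n \<le> real n * a)"

lemma N_props:
  assumes "a > 0"
  shows "N a \<ge> 1" "b (N a) \<le> real (N a) * a" "\<And>n. 1 \<le> n \<Longrightarrow> n < N a \<Longrightarrow> real n * a < b n"
proof -
  have "eventually (\<lambda>n. b n / real n < a) sequentially"
    using order_tendstoD(2)[OF b_over_n assms] .
  then have "eventually (\<lambda>n. n \<ge> 1 \<and> b n \<le> real n * a) sequentially"
    using eventually_ge_at_top[of 1] by eventually_elim (simp add: divide_less_eq mult.commute)
  then obtain n where "n \<ge> 1 \<and> b n \<le> real n * a"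
    by (auto simp: eventually_sequentially)
  then have *: "N a \<ge> 1 \<and> b (N a) \<le> real (N a) * a" unfolding N_def by (rule LeastI)
  then show "N a \<ge> 1" "b (N a) \<le> real (N a) * a" by auto
  fix n assume "1 \<le> n" "n < N a"
  then show "real n * a < b n"
    using not_less_Least[of n "\<lambda>n. n \<ge> 1 \<and> b n \<le> real n * a"] unfolding N_def by auto
qed

lemma N_le: "n \<ge> 1 \<Longrightarrow> b n \<le> real n * a \<Longrightarrow> N a \<le> n"
  unfolding N_def by (rule Least_le) simp

lemma N_at_top: "filterlim N sequentially (at_right 0)"
  unfolding filterlim_at_top
proof
  fix K :: nat
  have "eventually (\<lambda>a. \<forall>n\<in>{1..K}. real n * a < b n) (at_right 0)"
  proof (rule eventually_ball_finite, simp, rule ballI)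
    fix n assume "n \<in> {1..K}"
    have "((\<lambda>a. real n * a) \<longlongrightarrow> real n * 0) (at_right 0)" by (intro tendsto_intros)
    then show "eventually (\<lambda>a. real n * a < b n) (at_right 0)"
      using b_gt_0[of n] by (intro order_tendstoD) auto
  qed
  moreover have "eventually (\<lambda>a::real. a > 0) (at_right 0)" by (simp add: eventually_at_right_less)
  ultimately show "eventually (\<lambda>a. N a \<ge> K) (at_right 0)"
  proof eventually_elim
    case (elim a)
    show ?case
    proof (rule ccontr)
      assume "\<not> N a \<ge> K"
      then have "real (N a) * a < b (N a)" using elim N_props(1)[of a] by auto
      then show False using N_props(2)[of a] elim by auto
    qed
  qed
qed

text \<open>Minimality says that the defining inequality fails at \<open>N a - 1\<close>; the
  squeeze closes because consecutive values of \<open>b\<close> have ratio tending to 1.\<close>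

lemma N_scale: "((\<lambda>a. b (N a) / (real (N a) * a)) \<longlongrightarrow> 1) (at_right 0)"
proof (rule tendsto_sandwich)
  have "(\<lambda>n. b (Suc n) / b n * (real n / real (Suc n))) \<longlonglongrightarrow> 1 * 1"
    by (intro tendsto_mult b_Suc_quot) real_asymp
  moreover have "filterlim (\<lambda>a. N a - 1) sequentially (at_right 0)"
    by (rule filterlim_compose[OF filterlim_minus_const_nat_at_top N_at_top])
  ultimately have "((\<lambda>a. b (Suc (N a - 1)) / b (N a - 1) * (real (N a - 1) / real (Suc (N a - 1)))) \<longlongrightarrow> 1 * 1) (at_right 0)"
    by (rule filterlim_compose)
  then show "((\<lambda>a. b (Suc (N a - 1)) / b (N a - 1) * (real (N a - 1) / real (Suc (N a - 1)))) \<longlongrightarrow> 1) (at_right 0)" by simp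
  have pos: "eventually (\<lambda>a::real. a > 0) (at_right 0)" by (simp add: eventually_at_right_less)
  have "eventually (\<lambda>a. N a \<ge> 2) (at_right 0)" using N_at_top by (simp add: filterlim_at_top)
  with pos show "eventually (\<lambda>a. b (Suc (N a - 1)) / b (N a - 1) * (real (N a - 1) / real (Suc (N a - 1))) \<le> b (N a) / (real (N a) * a)) (at_right 0)"
  proof eventually_elim
    case (elim a)
    define n where "n = N a - 1"
    have n: "N a = Suc n" "n \<ge> 1" using elim by (auto simp: n_def)
    have "real n * a < b n" using N_props(3)[of a n] elim n by auto
    then have "real n / b n \<le> 1 / a" using elim b_gt_0[of n] by (simp add: field_simps)
    then have "b (Suc n) / real (Suc n) * (real n / b n) \<le> b (Suc n) / real (Suc n) * (1 / a)"
      using b_gt_0[of "Suc n"] by (intro mult_left_mono) auto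
    then show ?case using elim unfolding n_def[symmetric] n by (simp add: mult_ac)
  qed
  show "eventually (\<lambda>a. b (N a) / (real (N a) * a) \<le> 1) (at_right 0)"
    using pos
  proof eventually_elim
    case (elim a)
    have "N a \<ge> 1" "b (N a) \<le> real (N a) * a" using N_props[OF elim] by auto
    then show ?case using elim by simp
  qed
qed simp

lemma filterlim_scale_at_right: "c > 0 \<Longrightarrow> filterlim (\<lambda>a. c * a) (at_right 0) (at_right (0::real))"
  by real_asymp

text \<open>Test the index \<open>m\<close> near \<open>s * N a\<close>: there
  \<open>b m / (m * a)\<close> tends to \<open>s powr (1 / \<alpha> - 1)\<close>. This equals
  \<open>c\<close> at \<open>s = c powr (- \<alpha> / (\<alpha> - 1))\<close> and is below
  \<open>c\<close> for larger \<open>s\<close>, in which case \<open>m\<close> is admissible for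
  drift \<open>c * a\<close> and bounds \<open>N (c * a)\<close>.\<close>

lemma N_quot_upper:
  assumes c: "c > 0" and e: "e > 0"
  shows "eventually (\<lambda>a. real (N (c * a)) / real (N a) \<le> c powr (- \<alpha> / (\<alpha> - 1)) + e) (at_right 0)"
proof -
  define s where "s = c powr (- \<alpha> / (\<alpha> - 1)) + e / 2"
  have s: "s > c powr (- \<alpha> / (\<alpha> - 1))" "s > 0" using e c by (auto simp: s_def add_pos_pos)
  define m where "m a = nat \<lceil>s * real (N a)\<rceil>" for a
  have NN: "filterlim (\<lambda>a. real (N a)) at_top (at_right 0)"
    by (rule filterlim_compose[OF filterlim_real_sequentially N_at_top])
  have mN: "((\<lambda>a. real (m a) / real (N a)) \<longlongrightarrow> s) (at_right 0)"
  proof -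
    have "((\<lambda>x. real (nat \<lceil>s * x\<rceil>) / x) \<longlongrightarrow> s) at_top" using s by real_asymp
    then show ?thesis unfolding m_def by (rule filterlim_compose[OF _ NN])
  qed
  have m_top: "filterlim m sequentially (at_right 0)"
  proof -
    have "filterlim (\<lambda>x::real. nat \<lceil>s * x\<rceil>) at_top at_top" using s by real_asymp
    then show ?thesis unfolding m_def by (rule filterlim_compose[OF _ NN])
  qed
  have "((\<lambda>a. b (m a) / b (N a) * (b (N a) / (real (N a) * a)) / (real (m a) / real (N a))) \<longlongrightarrow> s powr (1 / \<alpha>) * 1 / s) (at_right 0)"
    using s by (intro tendsto_intros b_quot m_top N_at_top mN N_scale) auto
  moreover have "s powr (1 / \<alpha>) * 1 / s < c"
  proof -
    have "s powr (1 / \<alpha> - 1) < (c powr (- \<alpha> / (\<alpha> - 1))) powr (1 / \<alpha> - 1)"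
      using s c \<alpha> by (intro powr_less_mono2_neg) auto
    also have "\<dots> = c powr 1" unfolding powr_powr
      by (intro arg_cong2[where f="(powr)"]) (use \<alpha> in \<open>auto simp: field_simps\<close>)
    finally show ?thesis using s c by (simp add: powr_diff)
  qed
  ultimately have "eventually (\<lambda>a. b (m a) / b (N a) * (b (N a) / (real (N a) * a)) / (real (m a) / real (N a)) < c) (at_right 0)"
    by (rule order_tendstoD)
  moreover have "eventually (\<lambda>a::real. a > 0) (at_right 0)" by (simp add: eventually_at_right_less)
  moreover have "eventually (\<lambda>a. m a \<ge> 1) (at_right 0)" using m_top by (simp add: filterlim_at_top)
  moreover have "eventually (\<lambda>a. real (m a) / real (N a) < c powr (- \<alpha> / (\<alpha> - 1)) + e) (at_right 0)"
    using order_tendstoD(2)[OF mN] e by (simp add: s_def)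
  ultimately show ?thesis
  proof eventually_elim
    case (elim a)
    have Na: "N a \<ge> 1" using N_props elim by auto
    have "b (m a) / b (N a) * (b (N a) / (real (N a) * a)) / (real (m a) / real (N a)) = b (m a) / (real (m a) * a)"
      using Na elim b_gt_0[of "N a"] by (simp add: field_simps)
    then have "b (m a) / (real (m a) * a) < c" using elim by simp
    then have "b (m a) \<le> real (m a) * (c * a)" using elim by (simp add: divide_less_eq mult_ac)
    then have "N (c * a) \<le> m a" using elim by (intro N_le) auto
    then have "real (N (c * a)) / real (N a) \<le> real (m a) / real (N a)" by (intro divide_right_mono) auto
    then show ?case using elim by linarith
  qed
qed

text \<open>The lower bound is the upper bound for the factor \<open>1 / c\<close>, applied at
  \<open>c * a\<close>.\<close>

lemma N_quot:
  assumes c: "c > 0"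
  shows "((\<lambda>a. real (N (c * a)) / real (N a)) \<longlongrightarrow> c powr (- \<alpha> / (\<alpha> - 1))) (at_right 0)"
proof (rule order_tendstoI)
  let ?s = "c powr (- \<alpha> / (\<alpha> - 1))"
  fix y assume y: "?s < y"
  then show "eventually (\<lambda>a. real (N (c * a)) / real (N a) < y) (at_right 0)"
    using N_quot_upper[OF c, of "(y - ?s) / 2"] by (auto elim!: eventually_mono simp: field_simps)
next
  let ?s = "c powr (- \<alpha> / (\<alpha> - 1))"
  fix y assume y: "y < ?s"
  have pos: "eventually (\<lambda>a::real. a > 0) (at_right 0)" by (simp add: eventually_at_right_less)
  show "eventually (\<lambda>a. y < real (N (c * a)) / real (N a)) (at_right 0)"
  proof (cases "y > 0")
    case False
    show ?thesis using pos
    proof eventually_elim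
      case (elim a)
      have "real (N (c * a)) / real (N a) > 0"
        using N_props(1)[of a] N_props(1)[of "c * a"] elim c by simp
      then show ?case using False by linarith
    qed
  next
    case True
    define e where "e = (1 / y - 1 / ?s) / 2"
    have sp: "?s > 0" using c by simp
    have e: "e > 0" using y True sp by (simp add: e_def field_simps)
    have inv: "(1 / c) powr (- \<alpha> / (\<alpha> - 1)) = 1 / ?s"
      using c by (simp add: powr_divide)
    have "eventually (\<lambda>a. real (N (1 / c * (c * a))) / real (N (c * a)) \<le> (1 / c) powr (- \<alpha> / (\<alpha> - 1)) + e) (at_right 0)"
      using eventually_compose_filterlim[OF N_quot_upper[of "1 / c" e] filterlim_scale_at_right[OF c]] c e by simp
    with pos show ?thesis
    proof eventually_elim
      case (elim a)
      have n: "N a \<ge> 1" "N (c * a) \<ge> 1"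
        using N_props(1)[of a] N_props(1)[of "c * a"] elim c by simp_all
      have "real (N a) / real (N (c * a)) \<le> 1 / ?s + e" using elim c unfolding inv by simp
      also have "\<dots> < 1 / y" using y True sp by (simp add: e_def field_simps)
      finally show ?case using n True by (simp add: field_simps)
    qed
  qed
qed

lemma N_scale_eventually: "eventually (\<lambda>a. b (N a) \<le> real (N a) * a \<and> real (N a) * a \<le> 2 * b (N a)) (at_right 0)"
proof -
  have "eventually (\<lambda>a. b (N a) / (real (N a) * a) > 1 / 2) (at_right 0)"
    by (rule order_tendstoD(1)[OF N_scale]) simp
  moreover have "eventually (\<lambda>a::real. a > 0) (at_right 0)" by (simp add: eventually_at_right_less)
  ultimately show ?thesis
  proof eventually_elim
    case (elim a)
    have "N a \<ge> 1" "b (N a) \<le> real (N a) * a" using N_props[OF elim(2)] by auto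
    then show ?case using elim by (simp add: field_simps)
  qed
qed

text \<open>With \<open>r = n / N a \<ge> 1\<close>, the Potter bound gives \<open>b n\<close> at
  most of order \<open>r powr p' * N a * a\<close>, so the level \<open>n * a\<close> exceeds
  \<open>b n\<close> by a factor of order \<open>r powr (1 - p')\<close>. The tail exponent
  \<open>1 / p'\<close> yields decay \<open>(1 - p') / p'\<close>, which is \<open>g\<close> for
  \<open>p' = 1 / (1 + g)\<close>; \<open>p' > 1 / \<alpha>\<close> amounts to
  \<open>g < \<alpha> - 1\<close>.\<close>

lemma q_decay:
  assumes g: "0 < g" "g < \<alpha> - 1"
  shows "\<exists>C. C \<ge> 1 \<and> eventually (\<lambda>a. \<forall>n\<ge>1. q a n \<le> C * (real n / real (N a)) powr (- g)) (at_right 0)"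
proof -
  define p' where "p' = 1 / (1 + g)"
  have p': "1 / \<alpha> < p'" "p' < 1" "p' > 0" using g \<alpha> by (auto simp: p'_def field_simps)
  have gp: "(1 - p') * (- 1 / p') = - g" using g by (simp add: p'_def field_simps)
  obtain C1 n1 where C1: "C1 \<ge> 1" "n1 \<ge> 1"
    "\<And>m n. n1 \<le> m \<Longrightarrow> m \<le> n \<Longrightarrow> b n \<le> C1 * (real n / real m) powr p' * b m"
    using potter[of 0 p'] \<alpha> p' by auto
  obtain C2 T n2 where C2: "C2 > 0" "T > 0"
    and tail: "\<And>n x. n \<ge> n2 \<Longrightarrow> x \<ge> 1 \<Longrightarrow> prob {\<omega>\<in>space M. \<bar>S n \<omega>\<bar> \<ge> 2 * x * b n / T} \<le> C2 * x powr (- 1 / p')"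
    using tail_S[OF p'(1)] by blast
  define k where "k = T / (2 * C1)"
  have k: "k > 0" using C1 C2 by (simp add: k_def)
  define C where "C = max 1 ((C2 + 1) * k powr (- 1 / p'))"
  have "eventually (\<lambda>a. N a \<ge> max n1 n2) (at_right 0)" using N_at_top unfolding filterlim_at_top by blast
  moreover have "eventually (\<lambda>a::real. a > 0) (at_right 0)" by (simp add: eventually_at_right_less)
  ultimately have "eventually (\<lambda>a. \<forall>n\<ge>1. q a n \<le> C * (real n / real (N a)) powr (- g)) (at_right 0)"
  proof eventually_elim
    case (elim a)
    note N = N_props[OF elim(2)]
    show ?case
    proof (intro allI impI)
      fix n :: nat assume n: "n \<ge> 1"
      show "q a n \<le> C * (real n / real (N a)) powr (- g)"
      proof (cases "n < N a")
        case True
        have "1 = 1 powr (- g)" by simp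
        also have "\<dots> \<le> (real n / real (N a)) powr (- g)"
          using True n g by (intro powr_mono2') auto
        finally have "1 * 1 \<le> C * (real n / real (N a)) powr (- g)"
          unfolding C_def by (intro mult_mono) auto
        then show ?thesis using q_bounds(2)[of a n] by linarith
      next
        case False
        define r where "r = real n / real (N a)"
        have r: "r > 0" using n N(1) by (simp add: r_def)
        define y where "y = k * r powr (1 - p')"
        have y0: "y > 0" using k r by (simp add: y_def)
        have bn: "b n \<le> C1 * r powr p' * b (N a)" unfolding r_def using elim False by (intro C1(3)) auto
        also have "\<dots> \<le> C1 * r powr p' * (real (N a) * a)"
          using N(2) C1(1) by (intro mult_left_mono) auto
        finally have "2 * y * b n / T \<le> 2 * y * (C1 * r powr p' * (real (N a) * a)) / T"
          using y0 C2 by (intro divide_right_mono mult_left_mono) auto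
        also have "\<dots> = real (N a) * a * (r powr (1 - p') * r powr p')"
          using C1(1) C2 by (simp add: y_def k_def field_simps)
        also have "r powr (1 - p') * r powr p' = r" using r by (simp flip: powr_add)
        also have "real (N a) * a * r = real n * a" using N(1) by (simp add: r_def)
        finally have th: "2 * y * b n / T \<le> real n * a" .
        have "q a n \<le> (C2 + 1) * y powr (- 1 / p')"
        proof (cases "y \<ge> 1")
          case True
          have "q a n \<le> prob {\<omega>\<in>space M. \<bar>S n \<omega>\<bar> \<ge> 2 * y * b n / T}"
            unfolding q_def using th by (intro finite_measure_mono) auto
          also have "\<dots> \<le> C2 * y powr (- 1 / p')" using elim False True by (intro tail) auto
          also have "\<dots> \<le> (C2 + 1) * y powr (- 1 / p')" by (intro mult_right_mono) auto
          finally show ?thesis .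
        next
          case False
          have "1 = 1 powr (- 1 / p')" by simp
          also have "\<dots> \<le> y powr (- 1 / p')" using False y0 p' by (intro powr_mono2') auto
          finally have "1 * 1 \<le> (C2 + 1) * y powr (- 1 / p')" using C2 by (intro mult_mono) auto
          then show ?thesis using q_bounds(2)[of a n] by linarith
        qed
        also have "y powr (- 1 / p') = k powr (- 1 / p') * r powr (- g)"
          using k r unfolding y_def by (simp only: powr_mult powr_powr gp)
        also have "(C2 + 1) * (k powr (- 1 / p') * r powr (- g)) = ((C2 + 1) * k powr (- 1 / p')) * r powr (- g)" by simp
        also have "\<dots> \<le> C * r powr (- g)" unfolding C_def by (intro mult_right_mono) auto
        finally show ?thesis by (simp add: r_def)
      qed
    qed
  qed
  moreover have "C \<ge> 1" by (simp add: C_def)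
  ultimately show ?thesis by blast
qed

definition gap :: "real \<Rightarrow> nat \<Rightarrow> real" where
  "gap a n = prob {\<omega>\<in>space M. 0 < S n \<omega> \<and> S n \<omega> < real n * a}"

lemma gap_bounds: "0 \<le> gap a n" "gap a n \<le> 1"
  by (simp_all add: gap_def)

lemma p_eq_q_gap: "a > 0 \<Longrightarrow> n \<ge> 1 \<Longrightarrow> p n = q a n + gap a n"
proof -
  assume a: "a > 0" "n \<ge> 1"
  then have na: "real n * a > 0" by simp
  have "{\<omega>\<in>space M. S n \<omega> > 0} = {\<omega>\<in>space M. S n \<omega> \<ge> real n * a} \<union> {\<omega>\<in>space M. 0 < S n \<omega> \<and> S n \<omega> < real n * a}"
    using na by auto
  then show ?thesis unfolding p_def q_def gap_def
    by (simp only:) (rule finite_measure_Union, auto)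
qed

text \<open>Concentration at scale \<open>n * a\<close> is available only when
  \<open>n * a \<ge> h0\<close>. There it gives order \<open>n * a / b n\<close>, which for
  \<open>n \<le> N a\<close> is \<open>r * b (N a) / b n\<close> up to constants,
  \<open>r = n / N a\<close>, hence at most of order \<open>r powr (1 - p')\<close>. For smaller
  \<open>n\<close> the fixed interval \<open>(0, h0)\<close> has probability decaying like a power
  of \<open>n\<close>, uniformly in \<open>a\<close>.\<close>

lemma gap_le:
  "\<exists>C h0 p p' n0. C > 0 \<and> h0 > 0 \<and> 0 < p \<and> 0 < p' \<and> p' < 1 \<and>
     (\<forall>n\<ge>1. prob {\<omega>\<in>space M. 0 < S n \<omega> \<and> S n \<omega> < h0} \<le> C * real n powr (- p)) \<and>
     eventually (\<lambda>a. \<forall>n\<ge>n0. n \<ge> 1 \<longrightarrow> real n * a \<ge> h0 \<longrightarrow> gap a n \<le> C * (real n / real (N a)) powr (1 - p')) (at_right 0)"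
proof -
  define p' where "p' = (1 / \<alpha> + 1) / 2"
  define p where "p = 1 / (2 * \<alpha>)"
  have p': "1 / \<alpha> < p'" "p' < 1" "p' > 0" and p: "0 < p" "p < 1 / \<alpha>"
    using \<alpha> by (auto simp: p'_def p_def field_simps)
  obtain C1 n1 where C1: "C1 \<ge> 1" "n1 \<ge> 1"
    "\<And>m n. n1 \<le> m \<Longrightarrow> m \<le> n \<Longrightarrow> b n \<le> C1 * (real n / real m) powr p' * b m \<and> (real n / real m) powr p * b m \<le> C1 * b n"
    using potter[of p p'] p p' by auto
  obtain C2 h0 where C2: "C2 > 0" "h0 > 0" "\<And>n h. h \<ge> h0 \<Longrightarrow> prob {\<omega>\<in>space M. 0 < S n \<omega> \<and> S n \<omega> < h} \<le> C2 * h / b n"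
    using prob_interval_le by blast
  define K where "K = C2 * h0 * C1 * real n1 powr p / b n1"
  have K: "K > 0" using C1 C2 b_gt_0[of n1] by (simp add: K_def)
  define L where "L = real n1 powr p"
  have L: "L > 0" using C1 by (simp add: L_def)
  define C where "C = K + L + 2 * C1 * C2 + 1"
  have C: "C > 0" "C \<ge> K" "C \<ge> L" "C \<ge> 2 * C1 * C2" "C \<ge> 1"
    using K L C1 C2 by (auto simp: C_def add_pos_pos)
  have small: "prob {\<omega>\<in>space M. 0 < S n \<omega> \<and> S n \<omega> < h0} \<le> C * real n powr (- p)" if n: "n \<ge> 1" for n
  proof (cases "n \<ge> n1")
    case True
    have "(real n / real n1) powr p * b n1 \<le> C1 * b n" using C1(3)[OF order_refl True] by blast
    then have "1 / b n \<le> C1 * real n1 powr p / b n1 * real n powr (- p)"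
      using n C1 b_gt_0[of n] b_gt_0[of n1] by (simp add: powr_divide powr_minus field_simps)
    then have "C2 * h0 * (1 / b n) \<le> C2 * h0 * (C1 * real n1 powr p / b n1 * real n powr (- p))"
      using C2 by (intro mult_left_mono) auto
    then have "C2 * h0 / b n \<le> K * real n powr (- p)" by (simp add: K_def mult_ac)
    also have "\<dots> \<le> C * real n powr (- p)" using C by (intro mult_right_mono) auto
    finally show ?thesis using C2(3)[of h0 n] by simp
  next
    case False
    have "1 = L * real n1 powr (- p)" using C1 by (simp add: L_def flip: powr_add)
    also have "\<dots> \<le> C * real n powr (- p)"
      using False n p C L by (intro mult_mono powr_mono2') auto
    finally show ?thesis by (rule order_trans[OF prob_le_1])
  qed
  have "eventually (\<lambda>a. N a \<ge> n1) (at_right 0)" using N_at_top by (simp add: filterlim_at_top)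
  moreover have "eventually (\<lambda>a::real. a > 0) (at_right 0)" by (simp add: eventually_at_right_less)
  ultimately have "eventually (\<lambda>a. \<forall>n\<ge>n1. n \<ge> 1 \<longrightarrow> real n * a \<ge> h0 \<longrightarrow> gap a n \<le> C * (real n / real (N a)) powr (1 - p')) (at_right 0)"
    using N_scale_eventually
  proof eventually_elim
    case (elim a)
    note N = N_props[OF elim(2)]
    show ?case
    proof (intro allI impI)
      fix n :: nat assume n: "n \<ge> n1" "n \<ge> 1" and h: "real n * a \<ge> h0"
      define r where "r = real n / real (N a)"
      have r: "r > 0" using n N(1) by (simp add: r_def)
      show "gap a n \<le> C * (real n / real (N a)) powr (1 - p')"
      proof (cases "n \<le> N a")
        case True
        have "b (N a) \<le> C1 * (real (N a) / real n) powr p' * b n" using C1(3)[OF n(1) True] by blast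
        also have "(real (N a) / real n) powr p' = r powr (- p')"
          using n N(1) by (simp add: r_def powr_divide powr_minus field_simps)
        finally have bN: "b (N a) / b n \<le> C1 * r powr (- p')" using b_gt_0[of n] by (simp add: divide_le_eq)
        have "gap a n \<le> C2 * (real n * a) / b n" unfolding gap_def by (rule C2(3)[OF h])
        also have "real n * a = r * (real (N a) * a)" using N(1) by (simp add: r_def)
        also have "C2 * (r * (real (N a) * a)) / b n \<le> C2 * (r * (2 * b (N a))) / b n"
          using elim r C2 b_gt_0[of n] by (intro divide_right_mono mult_left_mono) auto
        also have "\<dots> = 2 * C2 * r * (b (N a) / b n)" by simp
        also have "\<dots> \<le> 2 * C2 * r * (C1 * r powr (- p'))" using bN C2 r by (intro mult_left_mono) auto
        also have "\<dots> = 2 * C1 * C2 * r powr (1 - p')" using r by (simp add: powr_diff powr_minus divide_inverse)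
        also have "\<dots> \<le> C * r powr (1 - p')" using C by (intro mult_right_mono) auto
        finally show ?thesis by (simp add: r_def)
      next
        case False
        have "1 \<le> r powr (1 - p')" using False N(1) p' by (intro ge_one_powr_ge_zero) (auto simp: r_def)
        then have "1 * 1 \<le> C * r powr (1 - p')" using C by (intro mult_mono) auto
        then show ?thesis using gap_bounds(2)[of a n] by (simp add: r_def)
      qed
    qed
  qed
  then show ?thesis using small C C2 p p' by blast
qed

end

section \<open>Riemann sums on the half line\<close>

text \<open>Kept as a measure of its own, so that positivity of the variable is an almost-everywhere
  fact and the integral theorems apply without indicators.\<close>

definition half_line :: "real measure" where
  "half_line = density lborel (\<lambda>s. ennreal (indicator {0<..} s))"

lemma sets_half_line [simp, measurable_cong]: "sets half_line = sets borel"
  by (simp add: half_line_def)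

lemma space_half_line [simp]: "space half_line = UNIV"
  by (simp add: half_line_def)

lemma AE_half_line: "AE s in half_line. s > 0"
  unfolding half_line_def by (subst AE_density) (auto simp: indicator_def)

lemma integral_half_line_pos:
  fixes f :: "real \<Rightarrow> real"
  assumes int: "integrable half_line f" and nonneg: "\<And>s. s > 0 \<Longrightarrow> f s \<ge> 0"
    and d: "d > 0" and pos: "\<And>s. 0 < s \<Longrightarrow> s < d \<Longrightarrow> f s > 0"
  shows "integral\<^sup>L half_line f > 0"
proof -
  have f0: "AE s in half_line. f s \<ge> 0"
    using AE_half_line by eventually_elim (rule nonneg)
  have "integral\<^sup>L half_line f \<noteq> 0"
  proof
    assume "integral\<^sup>L half_line f = 0"
    then have "AE s in half_line. f s = 0"
      using integral_nonneg_eq_0_iff_AE[OF int f0] by simp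
    then have "AE s in half_line. \<not> (0 < s \<and> s < d)"
      by (rule eventually_mono) (use pos in force)
    then have "AE s in lborel. \<not> (0 < s \<and> s < d)"
      unfolding half_line_def by (subst (asm) AE_density) (auto simp: indicator_def elim!: eventually_mono)
    then have "emeasure lborel {0<..<d} = 0"
      by (subst (asm) AE_iff_measurable[OF _ refl])
         (auto simp: greaterThanLessThan_def greaterThan_def lessThan_def Int_def)
    then show False using d by simp
  qed
  moreover have "integral\<^sup>L half_line f \<ge> 0" using f0 by (rule integral_nonneg_AE)
  ultimately show ?thesis by simp
qed

lemma nn_integral_half_line:
  assumes [measurable]: "f \<in> borel_measurable borel"
  shows "(\<integral>\<^sup>+s. f s \<partial>half_line) = (\<integral>\<^sup>+s. indicator {0<..} s * f s \<partial>lborel)"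
  unfolding half_line_def by (subst nn_integral_density) (auto simp: ennreal_indicator)

lemma nn_integral_half_line_scale:
  assumes [measurable]: "f \<in> borel_measurable borel" and c: "c > 0"
  shows "(\<integral>\<^sup>+s. f s \<partial>half_line) = ennreal c * (\<integral>\<^sup>+s. f (c * s) \<partial>half_line)"
proof -
  have "(\<integral>\<^sup>+s. f s \<partial>half_line) = ennreal c * (\<integral>\<^sup>+s. indicator {0<..} (0 + c * s) * f (0 + c * s) \<partial>lborel)"
    using c by (subst nn_integral_half_line, simp, subst nn_integral_real_affine[where c=c and t=0]) auto
  also have "(\<lambda>s. indicator {0<..} (0 + c * s) * f (0 + c * s)) = (\<lambda>s. indicator {0<..} s * f (c * s) :: ennreal)"
    using c by (auto simp: fun_eq_iff indicator_def zero_less_mult_iff)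
  finally show ?thesis by (simp add: nn_integral_half_line)
qed

text \<open>The common majorant: one exponent governs 0, the other infinity.\<close>

definition broken_powr :: "real \<Rightarrow> real \<Rightarrow> real \<Rightarrow> real" where
  "broken_powr e d s = (if s \<le> 1 then s powr e else s powr d)"

lemma measurable_broken_powr [measurable]: "broken_powr e d \<in> borel_measurable borel"
  unfolding broken_powr_def by measurable

lemma broken_powr_nonneg: "broken_powr e d s \<ge> 0"
  by (simp add: broken_powr_def)

lemma integrable_broken_powr:
  assumes "e > -1" "d < -1"
  shows "integrable half_line (broken_powr e d)"
proof (rule integrableI_nonneg)
  have "((\<lambda>x. if x \<in> {0..1} then x powr e else 0) has_integral (1 powr (e+1) / (e+1))) UNIV"
    using has_integral_powr_from_0[OF assms(1), of 1] by (subst has_integral_restrict_UNIV) simp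
  then have 1: "(\<integral>\<^sup>+x. ennreal (if x \<in> {0..1} then x powr e else 0) \<partial>lborel) = ennreal (1 powr (e+1) / (e+1))"
    by (intro nn_integral_has_integral_lborel) auto
  have "((\<lambda>x. if x \<in> {1..} then x powr d else 0) has_integral (-(1 powr (d+1)) / (d+1))) UNIV"
    using has_integral_powr_to_inf[OF assms(2), of 1] by (subst has_integral_restrict_UNIV) simp
  then have 2: "(\<integral>\<^sup>+x. ennreal (if x \<in> {1..} then x powr d else 0) \<partial>lborel) = ennreal (-(1 powr (d+1)) / (d+1))"
    by (intro nn_integral_has_integral_lborel) auto
  have "(\<integral>\<^sup>+s. ennreal (broken_powr e d s) \<partial>half_line) = (\<integral>\<^sup>+s. indicator {0<..} s * ennreal (broken_powr e d s) \<partial>lborel)"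
    by (rule nn_integral_half_line) simp
  also have "\<dots> \<le> (\<integral>\<^sup>+x. ennreal (if x \<in> {0..1} then x powr e else 0) + ennreal (if x \<in> {1..} then x powr d else 0) \<partial>lborel)"
    by (intro nn_integral_mono) (auto simp: broken_powr_def indicator_def)
  also have "\<dots> = ennreal (1 powr (e+1) / (e+1)) + ennreal (-(1 powr (d+1)) / (d+1))"
    by (subst nn_integral_add) (auto simp: 1[simplified] 2[simplified])
  also have "\<dots> < \<infinity>" by simp
  finally show "(\<integral>\<^sup>+s. ennreal (broken_powr e d s) \<partial>half_line) < \<infinity>" .
qed (auto simp: broken_powr_nonneg)

lemma exp_minus_le_inverse_square: "x > 0 \<Longrightarrow> exp (- x) \<le> 2 / (x::real)\<^sup>2"
  using exp_lower_Taylor_quadratic[of x] by (simp add: exp_minus field_simps power2_eq_square)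

text \<open>Only integrability at infinity matters, so the exponential is weakened to an inverse
  square.\<close>

lemma exp_powr_le_broken_powr:
  assumes "c > 0" "s > 0" "e \<le> 0"
  shows "exp (- (c * s)) * s powr e \<le> max 1 (2 / c\<^sup>2) * broken_powr e (-2) s"
proof (cases "s \<le> 1")
  case True
  have "exp (- (c * s)) * s powr e \<le> 1 * s powr e" using assms by (intro mult_right_mono) auto
  also have "\<dots> \<le> max 1 (2 / c\<^sup>2) * s powr e" by (intro mult_right_mono) auto
  finally show ?thesis using True by (simp add: broken_powr_def)
next
  case False
  have "exp (- (c * s)) * s powr e \<le> 2 / (c * s)\<^sup>2 * 1"
  proof (intro mult_mono exp_minus_le_inverse_square)
    show "s powr e \<le> 1" using False assms powr_mono[of e 0 s] by simp
  qed (use assms in auto)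
  also have "\<dots> = 2 / c\<^sup>2 * s powr (-2)" using assms by (simp add: power_mult_distrib powr_minus divide_inverse powr_numeral)
  also have "\<dots> \<le> max 1 (2 / c\<^sup>2) * s powr (-2)" by (intro mult_right_mono) auto
  finally show ?thesis using False by (simp add: broken_powr_def)
qed

text \<open>
  Index such that \<open>Suc (step N s) = \<lceil>s N\<rceil>\<close> for \<open>s > 0\<close>; it makes a series over \<open>n\<close> an integral over
  \<open>s = Suc n / N\<close>.
\<close>

definition step :: "real \<Rightarrow> real \<Rightarrow> nat" where
  "step N s = nat \<lceil>s * N\<rceil> - 1"

lemma measurable_step [measurable]: "step N \<in> borel \<rightarrow>\<^sub>M count_space UNIV"
  unfolding step_def by measurable

lemma step_eq_iff: "N > 0 \<Longrightarrow> s > 0 \<Longrightarrow> step N s = n \<longleftrightarrow> real n / N < s \<and> s \<le> real (Suc n) / N"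
proof -
  assume N: "N > 0" and s: "s > 0"
  then have "s * N > 0" by simp
  then have "step N s = n \<longleftrightarrow> \<lceil>s * N\<rceil> = int (Suc n)"
  proof -
    have "\<lceil>s * N\<rceil> > 0" using \<open>s * N > 0\<close> by (simp only: zero_less_ceiling)
    then show ?thesis unfolding step_def by linarith
  qed
  also have "\<dots> \<longleftrightarrow> real n < s * N \<and> s * N \<le> real (Suc n)" by (subst ceiling_eq_iff) auto
  finally show ?thesis using N by (simp add: field_simps)
qed

lemma Suc_step: "N > 0 \<Longrightarrow> s > 0 \<Longrightarrow> real (Suc (step N s)) / N \<ge> s"
  using step_eq_iff[of N s "step N s"] by simp

lemma Suc_step_eq: "N > 0 \<Longrightarrow> s > 0 \<Longrightarrow> Suc (step N s) = nat \<lceil>s * N\<rceil>"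
  by (simp add: step_def)

lemma distr_step:
  assumes N: "N > 0"
  shows "distr half_line (count_space UNIV) (step N) = density (count_space UNIV) (\<lambda>_. ennreal (1 / N))"
proof (rule measure_eqI_countable[of _ UNIV])
  fix n :: nat
  have "emeasure (distr half_line (count_space UNIV) (step N)) {n} = emeasure half_line (step N -` {n} \<inter> space half_line)"
    by (rule emeasure_distr) auto
  also have "\<dots> = (\<integral>\<^sup>+s. indicator (step N -` {n}) s \<partial>half_line)"
    by (subst nn_integral_indicator) (auto simp: measurable_sets[OF measurable_step, simplified])
  also have "\<dots> = (\<integral>\<^sup>+s. indicator {0<..} s * indicator (step N -` {n}) s \<partial>lborel)"
    using measurable_sets[OF measurable_step, of "{n}"] by (intro nn_integral_half_line) auto
  also have "\<dots> = (\<integral>\<^sup>+s. indicator {real n / N<..real (Suc n) / N} s \<partial>lborel)"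
  proof (rule nn_integral_cong)
    fix s :: real
    have "real n / N \<ge> 0" using N by simp
    then have "s > 0" if "real n / N < s" using that by linarith
    then show "indicator {0<..} s * indicator (step N -` {n}) s = (indicator {real n / N<..real (Suc n) / N} s :: ennreal)"
      using step_eq_iff[OF N, of s n] by (auto simp: indicator_def)
  qed
  also have "\<dots> = ennreal (real (Suc n) / N - real n / N)"
    using N by (subst nn_integral_indicator) (auto simp: divide_right_mono)
  also have "real (Suc n) / N - real n / N = 1 / N" by (simp add: diff_divide_distrib[symmetric])
  finally show "emeasure (distr half_line (count_space UNIV) (step N)) {n} = emeasure (density (count_space UNIV) (\<lambda>_. ennreal (1 / N))) {n}"
    by (simp add: emeasure_density)
qed (use N in \<open>auto simp: emeasure_density\<close>)

lemma integral_step: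
  fixes f :: "nat \<Rightarrow> real"
  assumes N: "N > 0" and f: "summable (\<lambda>n. \<bar>f n\<bar>)"
  shows "(\<integral>s. N * f (step N s) \<partial>half_line) = (\<Sum>n. f n)"
proof -
  have int: "integrable (count_space UNIV) f" using f by (simp add: integrable_count_space_nat_iff)
  have "(\<integral>s. N * f (step N s) \<partial>half_line) = (\<integral>n. N * f n \<partial>distr half_line (count_space UNIV) (step N))"
    by (subst integral_distr) auto
  also have "\<dots> = (\<integral>n. f n \<partial>count_space UNIV)"
    unfolding distr_step[OF N] using N by (subst integral_real_density) auto
  finally show ?thesis using integral_count_space_nat[OF int] by simp
qed

lemma nn_integral_step:
  assumes N: "N > 0"
  shows "(\<integral>\<^sup>+s. ennreal N * f (step N s) \<partial>half_line) = (\<Sum>n. f n)"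
proof -
  have "(\<integral>\<^sup>+s. ennreal N * f (step N s) \<partial>half_line) = (\<integral>\<^sup>+n. ennreal N * f n \<partial>distr half_line (count_space UNIV) (step N))"
    by (subst nn_integral_distr) auto
  also have "\<dots> = (\<integral>\<^sup>+n. ennreal (1 / N) * (ennreal N * f n) \<partial>count_space UNIV)"
    unfolding distr_step[OF N] by (subst nn_integral_density) auto
  also have "\<dots> = (\<integral>\<^sup>+n. f n \<partial>count_space UNIV)"
    using N by (simp add: mult.assoc[symmetric] ennreal_mult[symmetric])
  finally show ?thesis by (simp add: nn_integral_count_space_nat)
qed

text \<open>The substitution of \<open>inverse a\<close> for \<open>a\<close> carries dominated
  convergence at infinity over to drifts tending to 0.\<close>

lemma dominated_convergence_at_right_0:
  fixes s :: "real \<Rightarrow> 'a \<Rightarrow> real"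
  assumes "f \<in> borel_measurable M" "\<And>a. s a \<in> borel_measurable M" "integrable M w"
    and lim: "AE x in M. ((\<lambda>a. s a x) \<longlongrightarrow> f x) (at_right 0)"
    and bound: "eventually (\<lambda>a. AE x in M. norm (s a x) \<le> w x) (at_right 0)"
  shows "((\<lambda>a. integral\<^sup>L M (s a)) \<longlongrightarrow> integral\<^sup>L M f) (at_right 0)" "integrable M f"
proof -
  have b: "eventually (\<lambda>a. AE x in M. norm (s (inverse a) x) \<le> w x) at_top"
    using bound by (simp add: eventually_at_right_to_top)
  have l: "AE x in M. ((\<lambda>a. s (inverse a) x) \<longlongrightarrow> f x) at_top"
    using lim by (simp add: filterlim_at_right_to_top)
  show "((\<lambda>a. integral\<^sup>L M (s a)) \<longlongrightarrow> integral\<^sup>L M f) (at_right 0)"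
    unfolding filterlim_at_right_to_top
    by (rule integral_dominated_convergence_at_top[OF assms(1) _ assms(3) l b]) (rule assms(2))
  show "integrable M f"
    by (rule integrable_dominated_convergence_at_top[OF assms(1) _ assms(3) l b]) (rule assms(2))
qed

text \<open>The terms are \<open>e\<close> times values of the decreasing function
  \<open>broken_powr (- g) (- 1 - g)\<close> at right endpoints of a grid of mesh \<open>e\<close>.
  Such a Riemann sum lies below the integral, whatever the mesh; \<open>0 < g < 1\<close> makes the
  integral finite at both ends.\<close>

lemma sum_min_powr_bound:
  assumes g: "0 < g" "g < 1"
  shows "\<exists>I. I \<ge> 0 \<and> (\<forall>e>0. summable (\<lambda>n. min (e * real (Suc n)) 1 / real (Suc n) * (e * real (Suc n)) powr (- g)) \<and>
     (\<Sum>n. min (e * real (Suc n)) 1 / real (Suc n) * (e * real (Suc n)) powr (- g)) \<le> I)"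
proof -
  define w where "w = broken_powr (- g) (- 1 - g)"
  have w: "integrable half_line w" unfolding w_def using g by (intro integrable_broken_powr) auto
  define I where "I = integral\<^sup>L half_line w"
  have wn: "w s \<ge> 0" for s by (simp add: w_def broken_powr_nonneg)
  have I0: "I \<ge> 0" unfolding I_def using wn by (intro integral_nonneg_AE) auto
  have mono: "w t \<le> w s" if "0 < s" "s \<le> t" for s t
  proof -
    have "t powr (- g) \<le> s powr (- g)" "t powr (- 1 - g) \<le> s powr (- 1 - g)"
      using that g by (auto intro!: powr_mono2')
    moreover have "t powr (- 1 - g) \<le> s powr (- g)" if "s \<le> 1" "t > 1"
    proof -
      have "t powr (- 1 - g) \<le> 1 powr (-1 - g)" using that g by (intro powr_mono2') auto
      also have "\<dots> = 1 powr (- g)" by simp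
      also have "\<dots> \<le> s powr (- g)" using that g \<open>0 < s\<close> by (intro powr_mono2') auto
      finally show ?thesis .
    qed
    ultimately show ?thesis using that by (auto simp: w_def broken_powr_def)
  qed
  have "summable (\<lambda>n. c n) \<and> (\<Sum>n. c n) \<le> I"
    if e: "e > 0" and c: "c = (\<lambda>n. min (e * real (Suc n)) 1 / real (Suc n) * (e * real (Suc n)) powr (- g))" for e c
  proof -
    have cw: "c n = e * w (e * real (Suc n))" for n
    proof (cases "e * real (Suc n) \<le> 1")
      case True
      then show ?thesis using e unfolding c w_def broken_powr_def by (simp del: of_nat_Suc)
    next
      case False
      then have "c n = 1 / real (Suc n) * (e * real (Suc n)) powr (- g)" unfolding c by (simp del: of_nat_Suc)
      also have "1 / real (Suc n) = e * (e * real (Suc n)) powr (-1)"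
        using e by (simp add: powr_minus_divide del: of_nat_Suc)
      also have "\<dots> * (e * real (Suc n)) powr (- g) = e * ((e * real (Suc n)) powr (-1) * (e * real (Suc n)) powr (- g))" by simp
      also have "(e * real (Suc n)) powr (-1) * (e * real (Suc n)) powr (- g) = (e * real (Suc n)) powr (-1 - g)"
        by (subst powr_add[symmetric]) simp
      finally show ?thesis using False by (simp add: w_def broken_powr_def del: of_nat_Suc)
    qed
    have c0: "c n \<ge> 0" for n unfolding cw using e wn by simp
    have N: "1 / e > 0" using e by simp
    have "(\<Sum>n. ennreal (c n)) = (\<integral>\<^sup>+s. ennreal (1 / e) * ennreal (c (step (1 / e) s)) \<partial>half_line)"
      by (rule nn_integral_step[OF N, symmetric])
    also have "\<dots> \<le> (\<integral>\<^sup>+s. ennreal (w s) \<partial>half_line)"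
    proof (rule nn_integral_mono_AE)
      show "AE s in half_line. ennreal (1 / e) * ennreal (c (step (1 / e) s)) \<le> ennreal (w s)"
        using AE_half_line
      proof eventually_elim
        case (elim s)
        have "1 / e * c (step (1 / e) s) = w (e * real (Suc (step (1 / e) s)))" using e by (simp add: cw)
        also have "\<dots> \<le> w s" using Suc_step[OF N elim] elim by (intro mono) (simp_all add: mult.commute)
        finally have "ennreal (1 / e * c (step (1 / e) s)) \<le> ennreal (w s)" by (rule ennreal_leI)
        then show ?case using e c0 by (subst ennreal_mult[symmetric]) auto
      qed
    qed
    also have "\<dots> = ennreal I" unfolding I_def using w wn by (intro nn_integral_eq_integral) auto
    finally have le: "(\<Sum>n. ennreal (c n)) \<le> ennreal I" .
    then have s: "summable c" using c0 by (intro summable_suminf_not_top) (auto simp: top_unique)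
    then have "(\<Sum>n. ennreal (c n)) = ennreal (\<Sum>n. c n)" using c0 by (simp add: suminf_ennreal2)
    then show ?thesis using s le I0 by simp
  qed
  then show ?thesis using I0 by blast
qed

lemma ln_geometric:
  assumes "0 \<le> z" "z < (1::real)"
  shows "(\<lambda>n. z ^ Suc n / real (Suc n)) sums (- ln (1 - z))"
proof -
  have eq: "- 1 * (z ^ Suc n / real (Suc n)) = (- 1) ^ n * (1 / real (n + 1)) * (1 - z - 1) ^ Suc n" for n
  proof -
    have "(- 1) ^ n * (1 - z - 1) ^ Suc n = (- 1) ^ n * ((- 1) ^ Suc n * z ^ Suc n)"
      by (subst power_mult_distrib[symmetric]) simp
    also have "\<dots> = - (z ^ Suc n)" by (simp flip: power_add mult_2 mult.assoc power_mult_distrib)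
    finally have "(- 1) ^ n * (1 - z - 1) ^ Suc n * (1 / real (Suc n)) = - (z ^ Suc n) * (1 / real (Suc n))"
      by (rule arg_cong)
    then show ?thesis by (simp only: Suc_eq_plus1 mult_ac mult_minus_left mult_minus_right mult_1_left divide_inverse)
  qed
  have ln: "ln (1 - z) = (\<Sum>n. - 1 * (z ^ Suc n / real (Suc n)))"
    unfolding eq using assms by (intro ln_series) auto
  have s: "summable (\<lambda>n. z ^ Suc n / real (Suc n))"
  proof (rule summable_comparison_test'[of "\<lambda>n. z ^ n" 0])
    show "summable (\<lambda>n. z ^ n)" using assms by (intro summable_geometric) auto
    show "norm (z ^ Suc n / real (Suc n)) \<le> z ^ n" for n
    proof -
      have "z ^ Suc n / real (Suc n) \<le> z ^ Suc n / 1" using assms by (intro divide_left_mono) auto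
      also have "\<dots> \<le> z ^ n" using assms by (simp add: mult_left_le_one_le)
      finally show ?thesis using assms by simp
    qed
  qed
  have "- ln (1 - z) = (\<Sum>n. z ^ Suc n / real (Suc n))"
    unfolding ln using suminf_mult[OF s, of "- 1"] by simp
  then show ?thesis using s by (simp add: sums_iff)
qed

lemma summable_exp_times:
  assumes "c > 0" "\<And>n. \<bar>h n\<bar> \<le> K"
  shows "summable (\<lambda>n. \<bar>exp (- (c * real (Suc n))) * h n\<bar>)" "summable (\<lambda>n. exp (- (c * real (Suc n))) * h n)"
proof -
  show 1: "summable (\<lambda>n. \<bar>exp (- (c * real (Suc n))) * h n\<bar>)"
  proof (rule summable_comparison_test'[of "\<lambda>n. K * exp (- c) ^ n" 0])
    show "summable (\<lambda>n. K * exp (- c) ^ n)"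
      using assms(1) by (intro summable_mult summable_geometric) auto
    fix n
    have "exp (- (c * real (Suc n))) \<le> exp (- (c * real n))" using assms(1) by simp
    also have "\<dots> = exp (- c) ^ n" by (simp flip: exp_of_nat_mult add: mult.commute)
    finally have "exp (- (c * real (Suc n))) * \<bar>h n\<bar> \<le> exp (- c) ^ n * K" using assms(2)[of n] by (intro mult_mono) auto
    then show "norm \<bar>exp (- (c * real (Suc n))) * h n\<bar> \<le> K * exp (- c) ^ n" by (simp add: abs_mult mult.commute)
  qed
  then show "summable (\<lambda>n. exp (- (c * real (Suc n))) * h n)" by (rule summable_rabs_cancel)
qed

lemma abs_diff_exp_le: "x \<ge> 0 \<Longrightarrow> \<bar>exp (- (u * x)) - exp (- (v * x))\<bar> \<le> \<bar>u - v\<bar> * x * exp (- (min u v * (x::real)))"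
proof -
  assume x: "x \<ge> 0"
  have *: "\<bar>exp (- (u * x)) - exp (- (v * x))\<bar> \<le> \<bar>u - v\<bar> * x * exp (- (min u v * x))" if "u \<le> v" for u v
  proof -
    have "exp (- (v * x)) \<le> exp (- (u * x))" using that x by (simp add: mult_right_mono)
    then have "\<bar>exp (- (u * x)) - exp (- (v * x))\<bar> = exp (- (u * x)) * (1 - exp (- ((v - u) * x)))"
      by (simp add: right_diff_distrib left_diff_distrib flip: exp_add)
    also have "\<dots> \<le> exp (- (u * x)) * ((v - u) * x)"
      using exp_ge_add_one_self[of "- ((v - u) * x)"] by (intro mult_left_mono) auto
    finally show ?thesis using that by (simp add: mult_ac)
  qed
  show ?thesis using *[of u v] *[of v u] by (cases "u \<le> v") (auto simp: abs_minus_commute min.commute)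
qed

lemma one_minus_exp_ge: "l > 0 \<Longrightarrow> 1 - exp (- l) \<ge> min 1 (l::real) / 2"
proof -
  assume l: "l > 0"
  have "exp (- l) \<le> 1 / (1 + l)" using l exp_ge_add_one_self[of l] by (simp add: exp_minus field_simps)
  moreover have "1 - 1 / (1 + l) \<ge> min 1 l / 2" using l by (auto simp: min_def field_simps)
  ultimately show ?thesis by linarith
qed

section \<open>Limits of the Sparre Andersen exponents on the time scale of the drift\<close>

context attracted_walk
begin

definition m :: "real \<Rightarrow> real" where
  "m s = measure \<mu> {s powr (1 - 1 / \<alpha>)..}"

lemma m_bounds: "0 \<le> m s" "m s \<le> 1" by (simp_all add: m_def)

lemma measurable_m [measurable]: "m \<in> borel_measurable borel"
proof -
  have "(\<lambda>x. - measure \<mu> {x..}) \<in> borel_measurable borel"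
    by (intro borel_measurable_mono monoI) (auto intro!: \<mu>.finite_measure_mono)
  then have "(\<lambda>x. - (- measure \<mu> {x..})) \<in> borel_measurable borel" by (rule borel_measurable_uminus)
  then have [measurable]: "(\<lambda>x. measure \<mu> {x..}) \<in> borel_measurable borel" by simp
  show ?thesis unfolding m_def by measurable
qed

lemma N_real_at_top: "filterlim (\<lambda>a. real (N a)) at_top (at_right 0)"
  by (rule filterlim_compose[OF filterlim_real_sequentially N_at_top])

lemma eventually_pos: "eventually (\<lambda>a::real. a > 0) (at_right 0)"
  by (simp add: eventually_at_right_less)

lemma eventually_N_ge: "eventually (\<lambda>a. N a \<ge> k) (at_right 0)"
  using N_at_top by (simp add: filterlim_at_top)

context
  fixes s :: real assumes s: "s > 0"
begin

lemma Suc_step_quot: "((\<lambda>a. real (Suc (step (N a) s)) / real (N a)) \<longlongrightarrow> s) (at_right 0)"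
proof -
  have "((\<lambda>x. real (nat \<lceil>s * x\<rceil>) / x) \<longlongrightarrow> s) at_top" using s by real_asymp
  then have "((\<lambda>a. real (nat \<lceil>s * real (N a)\<rceil>) / real (N a)) \<longlongrightarrow> s) (at_right 0)"
    by (rule filterlim_compose[OF _ N_real_at_top])
  then show ?thesis
  proof (rule Lim_transform_eventually)
    show "\<forall>\<^sub>F a in at_right 0. real (nat \<lceil>s * real (N a)\<rceil>) / real (N a) = real (Suc (step (N a) s)) / real (N a)"
      using eventually_N_ge[of 1] by eventually_elim (use s in \<open>simp add: Suc_step_eq del: of_nat_Suc\<close>)
  qed
qed

lemma Suc_step_at_top: "filterlim (\<lambda>a. Suc (step (N a) s)) sequentially (at_right 0)"
proof -
  have "filterlim (\<lambda>x::real. nat \<lceil>s * x\<rceil>) at_top at_top" using s by real_asymp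
  then have "filterlim (\<lambda>a. nat \<lceil>s * real (N a)\<rceil>) at_top (at_right 0)"
    by (rule filterlim_compose[OF _ N_real_at_top])
  moreover have "\<forall>\<^sub>F a in at_right 0. nat \<lceil>s * real (N a)\<rceil> = Suc (step (N a) s)"
    using eventually_N_ge[of 1] by eventually_elim (use s in \<open>simp add: Suc_step_eq\<close>)
  ultimately show ?thesis using filterlim_cong[OF refl refl] by fast
qed

lemma q_step_tendsto: "((\<lambda>a. q a (Suc (step (N a) s))) \<longlongrightarrow> m s) (at_right 0)"
  unfolding m_def
proof (rule q_tendsto[OF Suc_step_at_top])
  let ?n = "\<lambda>a. Suc (step (N a) s)"
  have "((\<lambda>a. real (?n a) / real (N a) / (b (?n a) / b (N a) * (b (N a) / (real (N a) * a)))) \<longlongrightarrow> s / (s powr (1 / \<alpha>) * 1)) (at_right 0)"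
    using s by (intro tendsto_intros Suc_step_quot b_quot Suc_step_at_top N_at_top N_scale) auto
  moreover have "s / (s powr (1 / \<alpha>) * 1) = s powr (1 - 1 / \<alpha>)" using s by (simp add: powr_diff)
  moreover have "\<forall>\<^sub>F a in at_right 0. real (?n a) / real (N a) / (b (?n a) / b (N a) * (b (N a) / (real (N a) * a))) = real (?n a) * a / b (?n a)"
    using eventually_N_ge[of 1] eventually_pos
  proof eventually_elim
    case (elim a)
    then show ?case using b_gt_0[of "N a"] b_gt_0[of "?n a"] by (simp add: field_simps del: of_nat_Suc)
  qed
  ultimately show "((\<lambda>a. real (?n a) * a / b (?n a)) \<longlongrightarrow> s powr (1 - 1 / \<alpha>)) (at_right 0)"
    using Lim_transform_eventually by fastforce
qed

lemma gap_step_tendsto: "((\<lambda>a. gap a (Suc (step (N a) s))) \<longlongrightarrow> \<rho> - m s) (at_right 0)"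
proof -
  have "((\<lambda>a. p (Suc (step (N a) s)) - q a (Suc (step (N a) s))) \<longlongrightarrow> \<rho> - m s) (at_right 0)"
    by (intro tendsto_diff q_step_tendsto filterlim_compose[OF p_tendsto Suc_step_at_top])
  then show ?thesis
  proof (rule Lim_transform_eventually)
    show "\<forall>\<^sub>F a in at_right 0. p (Suc (step (N a) s)) - q a (Suc (step (N a) s)) = gap a (Suc (step (N a) s))"
      using eventually_pos by eventually_elim (simp add: p_eq_q_gap)
  qed
qed

end

text \<open>For fixed \<open>n\<close> the events shrink to the empty set because 0 is excluded.
  There is no rate here; uniformity in \<open>n\<close> comes from a summable majorant in
  \<open>I2_limit\<close>.\<close>

lemma gap_fixed_tendsto: "((\<lambda>a. gap a n) \<longlongrightarrow> 0) (at_right 0)"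
proof (rule tendstoI)
  fix e :: real assume e: "e > 0"
  define B where "B k = {\<omega>\<in>space M. 0 < S n \<omega> \<and> S n \<omega> < 1 / real (Suc k)}" for k :: nat
  have "(\<lambda>k. prob (B k)) \<longlonglongrightarrow> prob (\<Inter>k. B k)"
  proof (rule finite_Lim_measure_decseq)
    show "range B \<subseteq> events" by (auto simp: B_def)
    have "1 / real (Suc l) \<le> 1 / real (Suc k)" if "k \<le> l" for k l using that by (simp add: frac_le)
    then show "decseq B" by (force simp: decseq_def B_def)
  qed
  moreover have "(\<Inter>k. B k) = {}"
  proof -
    have False if "\<omega> \<in> (\<Inter>k. B k)" for \<omega>
    proof -
      have "S n \<omega> > 0" "\<And>k. S n \<omega> < 1 / real (Suc k)" using that by (auto simp: B_def)
      then show False using reals_Archimedean[of "S n \<omega>"] by (simp add: inverse_eq_divide) (metis less_asym of_nat_Suc add.commute)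
    qed
    then show ?thesis by blast
  qed
  ultimately have "eventually (\<lambda>k. prob (B k) < e) sequentially" using e by (auto intro: order_tendstoD)
  then obtain k where k: "prob (B k) < e" by (auto simp: eventually_sequentially)
  have "((\<lambda>a. real n * a) \<longlongrightarrow> real n * 0) (at_right 0)" by (intro tendsto_intros)
  then have "eventually (\<lambda>a. real n * a < 1 / real (Suc k)) (at_right 0)" by (rule order_tendstoD) simp
  then show "eventually (\<lambda>a. dist (gap a n) 0 < e) (at_right 0)"
  proof eventually_elim
    case (elim a)
    have "gap a n \<le> prob (B k)" unfolding gap_def B_def using elim by (intro finite_measure_mono) auto
    then show ?case using k gap_bounds(1)[of a n] by simp
  qed
qed

definition Q :: "real \<Rightarrow> real \<Rightarrow> real" where
  "Q a l = (\<Sum>n. exp (- (l * real (Suc n))) * (q a (Suc n) / real (Suc n)))"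

definition P :: "real \<Rightarrow> real" where
  "P l = (\<Sum>n. exp (- (l * real (Suc n))) * (p (Suc n) / real (Suc n)))"

text \<open>The singularity \<open>1 / s\<close> at 0 is tamed by the difference of exponentials
  here, and in \<open>I2\<close> by \<open>\<rho> - m s\<close>, which tends to 0 with
  \<open>s\<close>. So the change of scale and the effect of the drift are treated
  separately.\<close>

definition I1 :: "real \<Rightarrow> real" where
  "I1 l = (\<integral>s. (exp (- (l * s)) - exp (- s)) / s * m s \<partial>half_line)"

definition I2 :: real where
  "I2 = (\<integral>s. exp (- s) / s * (\<rho> - m s) \<partial>half_line)"

lemma divide_Suc_le_1: "0 \<le> x \<Longrightarrow> x \<le> 1 \<Longrightarrow> \<bar>x / real (Suc n)\<bar> \<le> 1"
  by (simp add: divide_le_eq)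

lemma summable_Q: "l > 0 \<Longrightarrow> summable (\<lambda>n. exp (- (l * real (Suc n))) * (q a (Suc n) / real (Suc n)))"
  by (intro summable_exp_times(2)[where K=1] divide_Suc_le_1 q_bounds)

lemma summable_P: "l > 0 \<Longrightarrow> summable (\<lambda>n. exp (- (l * real (Suc n))) * (p (Suc n) / real (Suc n)))"
  by (intro summable_exp_times(2)[where K=1] divide_Suc_le_1 p_bounds)

text \<open>Written as an integral over grid points \<open>t \<ge> s\<close>, the difference of
  series has integrand at most \<open>\<bar>l - 1\<bar> * exp (- (min l 1 * t))\<close>. This bound
  decreases in \<open>t\<close>, so its value at \<open>s\<close> dominates uniformly in
  \<open>a\<close>.\<close>

lemma I1_integrand:
  assumes l: "l > 0"
  shows "integrable half_line (\<lambda>s. (exp (- (l * s)) - exp (- s)) / s * m s)" (is ?A)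
    and "((\<lambda>a. Q a (l / real (N a)) - Q a (1 / real (N a))) \<longlongrightarrow> I1 l) (at_right 0)" (is ?B)
proof -
  define c where "c = min l 1"
  have c: "c > 0" using l by (simp add: c_def)
  define w where "w s = \<bar>l - 1\<bar> * (max 1 (2 / c\<^sup>2) * broken_powr 0 (-2) s)" for s
  have w: "integrable half_line w" unfolding w_def by (intro integrable_mult_right integrable_broken_powr) auto
  define f where "f a n = (exp (- (l / real (N a) * real (Suc n))) - exp (- (1 / real (N a) * real (Suc n)))) * (q a (Suc n) / real (Suc n))" for a n
  define g where "g a s = real (N a) * f a (step (N a) s)" for a s
  have g_eq: "g a s = (exp (- (l * t)) - exp (- t)) / t * q a (Suc (step (N a) s))"
    if "N a \<ge> 1" "t = real (Suc (step (N a) s)) / real (N a)" for a s t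
  proof -
    have N: "real (N a) > 0" and t: "t > 0" using that by auto
    have k: "real (Suc (step (N a) s)) = t * real (N a)" using N that(2) by simp
    have e: "l / real (N a) * (t * real (N a)) = l * t" "1 / real (N a) * (t * real (N a)) = t" using N by auto
    show ?thesis unfolding g_def f_def k e using N t by (simp add: field_simps)
  qed
  have lim: "AE s in half_line. ((\<lambda>a. g a s) \<longlongrightarrow> (exp (- (l * s)) - exp (- s)) / s * m s) (at_right 0)"
    using AE_half_line
  proof eventually_elim
    case (elim s)
    define t where "t a = real (Suc (step (N a) s)) / real (N a)" for a
    have t: "(t \<longlongrightarrow> s) (at_right 0)" unfolding t_def by (rule Suc_step_quot[OF elim])
    have "((\<lambda>a. (exp (- (l * t a)) - exp (- t a)) / t a * q a (Suc (step (N a) s))) \<longlongrightarrow> (exp (- (l * s)) - exp (- s)) / s * m s) (at_right 0)"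
      using elim by (intro tendsto_intros t q_step_tendsto) auto
    then show ?case
      by (rule Lim_transform_eventually) (use eventually_N_ge[of 1] in eventually_elim, simp add: g_eq t_def)
  qed
  have bound: "eventually (\<lambda>a. AE s in half_line. norm (g a s) \<le> w s) (at_right 0)"
    using eventually_N_ge[of 1]
  proof eventually_elim
    case (elim a)
    show ?case using AE_half_line
    proof eventually_elim
      case (elim s)
      define t where "t = real (Suc (step (N a) s)) / real (N a)"
      have t: "t \<ge> s" "t > 0" unfolding t_def using Suc_step[of "real (N a)" s] \<open>N a \<ge> 1\<close> elim by auto
      have "\<bar>(exp (- (l * t)) - exp (- t)) / t\<bar> \<le> \<bar>l - 1\<bar> * exp (- (c * t))"
        using abs_diff_exp_le[of t l 1] t by (simp add: c_def field_simps)
      also have "\<dots> \<le> \<bar>l - 1\<bar> * exp (- (c * s))" using t c by (intro mult_left_mono) auto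
      also have "\<dots> \<le> w s" unfolding w_def using exp_powr_le_broken_powr[OF c elim, of 0] elim by (intro mult_left_mono) auto
      finally have "\<bar>(exp (- (l * t)) - exp (- t)) / t\<bar> * q a (Suc (step (N a) s)) \<le> w s * 1"
        using q_bounds[of a] broken_powr_nonneg by (intro mult_mono) (auto simp: w_def)
      then show ?case using q_bounds(1)[of a] by (simp add: g_eq[OF \<open>N a \<ge> 1\<close> t_def] abs_mult)
    qed
  qed
  have meas: "g a \<in> borel_measurable half_line" for a unfolding g_def by measurable
  note dct = dominated_convergence_at_right_0[OF _ meas w lim bound]
  show ?A by (rule dct(2)) measurable
  have "((\<lambda>a. integral\<^sup>L half_line (g a)) \<longlongrightarrow> I1 l) (at_right 0)"
    unfolding I1_def by (rule dct(1)) measurable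
  then show ?B
  proof (rule Lim_transform_eventually)
    show "\<forall>\<^sub>F a in at_right 0. integral\<^sup>L half_line (g a) = Q a (l / real (N a)) - Q a (1 / real (N a))"
      using eventually_N_ge[of 1]
    proof eventually_elim
      case (elim a)
      have N: "real (N a) > 0" using elim by simp
      have "\<bar>q a (Suc n) / real (Suc n)\<bar> \<le> 1" for n by (intro divide_Suc_le_1 q_bounds)
      then have "summable (\<lambda>n. \<bar>exp (- (l / real (N a) * real (Suc n))) * (q a (Suc n) / real (Suc n))\<bar>)"
        "summable (\<lambda>n. \<bar>exp (- (1 / real (N a) * real (Suc n))) * (q a (Suc n) / real (Suc n))\<bar>)"
        using N l by (intro summable_exp_times(1)[where K=1]; simp)+
      from summable_add[OF this] have "summable (\<lambda>n. \<bar>f a n\<bar>)"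
      proof (rule summable_comparison_test'[of _ 0])
        show "norm \<bar>f a n\<bar> \<le> \<bar>exp (- (l / real (N a) * real (Suc n))) * (q a (Suc n) / real (Suc n))\<bar> +
            \<bar>exp (- (1 / real (N a) * real (Suc n))) * (q a (Suc n) / real (Suc n))\<bar>" for n
          unfolding f_def left_diff_distrib real_norm_def abs_abs by (rule abs_triangle_ineq4)
      qed
      then have "integral\<^sup>L half_line (g a) = (\<Sum>n. f a n)" unfolding g_def by (rule integral_step[OF N])
      also have "\<dots> = Q a (l / real (N a)) - Q a (1 / real (N a))"
        unfolding Q_def f_def left_diff_distrib
        using N l by (intro suminf_diff[symmetric] summable_Q) auto
      finally show ?case .
    qed
  qed
qed

text \<open>
  Indices with \<open>n a < h0\<close>, where the concentration bound cannot see the shrinking interval, are treated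
  as a series dominated by \<open>n powr (- 1 - r)\<close>; only the others contribute to the integral.
\<close>

lemma I2_limit: "((\<lambda>a. P (1 / real (N a)) - Q a (1 / real (N a))) \<longlongrightarrow> I2) (at_right 0)"
proof -
  obtain C h0 r p' n0 where C: "C > 0" "h0 > 0" "0 < r" "0 < p'" "p' < 1"
    and small: "\<And>n. n \<ge> 1 \<Longrightarrow> prob {\<omega>\<in>space M. 0 < S n \<omega> \<and> S n \<omega> < h0} \<le> C * real n powr (- r)"
    and big: "eventually (\<lambda>a. \<forall>n\<ge>n0. n \<ge> 1 \<longrightarrow> real n * a \<ge> h0 \<longrightarrow> gap a n \<le> C * (real n / real (N a)) powr (1 - p')) (at_right 0)"
    using gap_le by blast
  define fa where "fa n a = exp (- (1 / real (N a) * real (Suc n))) * ((if real (Suc n) * a < h0 then gap a (Suc n) else 0) / real (Suc n))" for n a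
  define fb where "fb a n = exp (- (1 / real (N a) * real (Suc n))) * ((if real (Suc n) * a < h0 then 0 else gap a (Suc n)) / real (Suc n))" for n a
  have fa_lim: "((\<lambda>a. suminf (\<lambda>n. fa n a)) \<longlongrightarrow> suminf (\<lambda>n. 0)) (at_right 0)"
  proof -
    define K where "K n = C * real (Suc n) powr (- r - 1)" for n
    have "summable (\<lambda>n. real n powr (- r - 1))" using C by (subst summable_real_powr_iff) auto
    then have "summable (\<lambda>n. real (Suc n) powr (- r - 1))" by (subst summable_Suc_iff)
    then have K: "summable K" unfolding K_def by (rule summable_mult)
    have le: "norm (fa n a) \<le> K n" for n a
    proof (cases "real (Suc n) * a < h0")
      case True
      have "gap a (Suc n) \<le> prob {\<omega>\<in>space M. 0 < S (Suc n) \<omega> \<and> S (Suc n) \<omega> < h0}"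
        unfolding gap_def using True by (intro finite_measure_mono) auto
      also have "\<dots> \<le> C * real (Suc n) powr (- r)" by (rule small) simp
      finally have "1 * (gap a (Suc n) / real (Suc n)) \<le> 1 * (C * real (Suc n) powr (- r) / real (Suc n))"
        by (intro mult_left_mono divide_right_mono) auto
      moreover have "exp (- (1 / real (N a) * real (Suc n))) * (gap a (Suc n) / real (Suc n)) \<le> 1 * (gap a (Suc n) / real (Suc n))"
        using gap_bounds(1) by (intro mult_right_mono) auto
      moreover have "C * real (Suc n) powr (- r) / real (Suc n) = K n" by (simp add: K_def powr_diff)
      ultimately show ?thesis using True gap_bounds(1)[of a "Suc n"] by (simp add: fa_def del: of_nat_Suc)
    next
      case False
      then show ?thesis using C by (simp add: fa_def K_def)
    qed
    have lim: "((\<lambda>a. fa n a) \<longlongrightarrow> 0) (at_right 0)" for n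
    proof (rule Lim_null_comparison)
      show "((\<lambda>a. gap a (Suc n)) \<longlongrightarrow> 0) (at_right 0)" by (rule gap_fixed_tendsto)
      show "\<forall>\<^sub>F a in at_right 0. norm (fa n a) \<le> gap a (Suc n)"
      proof (intro always_eventually allI)
        fix a
        have "exp (- (1 / real (N a) * real (Suc n))) * (gap a (Suc n) / real (Suc n)) \<le> 1 * (gap a (Suc n) / 1)"
          using gap_bounds(1) by (intro mult_mono divide_left_mono) auto
        then show "norm (fa n a) \<le> gap a (Suc n)" using gap_bounds(1)[of a "Suc n"] by (simp add: fa_def del: of_nat_Suc)
      qed
    qed
    have "eventually (\<lambda>(k, n). norm (fa k n) \<le> K k) (at_top \<times>\<^sub>F at_right 0)"
      using le by (intro always_eventually) auto
    from tannerys_theorem[OF lim this K] show ?thesis by simp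
  qed
  define w where "w s = C * (max 1 (2 / 1\<^sup>2) * broken_powr (- p') (-2) s)" for s
  have w: "integrable half_line w" unfolding w_def using C by (intro integrable_mult_right integrable_broken_powr) auto
  define g where "g a s = real (N a) * fb a (step (N a) s)" for a s
  have g_eq: "g a s = exp (- t) / t * (if real (Suc (step (N a) s)) * a < h0 then 0 else gap a (Suc (step (N a) s)))"
    if "N a \<ge> 1" "t = real (Suc (step (N a) s)) / real (N a)" for a s t
  proof -
    have N: "real (N a) > 0" and t: "t > 0" using that by auto
    have k: "real (Suc (step (N a) s)) = t * real (N a)" using N that(2) by simp
    have e: "1 / real (N a) * (t * real (N a)) = t" using N by auto
    show ?thesis unfolding g_def fb_def k e using N t by (simp add: field_simps)
  qed
  \<comment> \<open>For fixed \<open>s\<close> the index is at least \<open>s * N a\<close>, so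
    \<open>n * a \<ge> s * b (N a)\<close>, which tends to infinity: the cut-off at
    \<open>h0\<close> disappears in the limit.\<close>
  have big_n: "eventually (\<lambda>a. real (Suc (step (N a) s)) * a \<ge> h0) (at_right 0)" if s: "s > 0" for s
  proof -
    have "filterlim (\<lambda>a. s * b (N a)) at_top (at_right 0)"
      using s by (intro filterlim_tendsto_pos_mult_at_top[OF tendsto_const] filterlim_compose[OF b_at_top N_at_top])
    then have "eventually (\<lambda>a. s * b (N a) \<ge> h0) (at_right 0)" by (simp add: filterlim_at_top)
    then show ?thesis using eventually_N_ge[of 1] eventually_pos
    proof eventually_elim
      case (elim a)
      have "h0 \<le> s * b (N a)" by (rule elim)
      also have "\<dots> \<le> s * (real (N a) * a)" using N_props(2)[of a] elim s by (intro mult_left_mono) auto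
      also have "\<dots> \<le> real (Suc (step (N a) s)) * a"
        using Suc_step[of "real (N a)" s] elim s by (simp add: field_simps del: of_nat_Suc)
      finally show ?case .
    qed
  qed
  have lim: "AE s in half_line. ((\<lambda>a. g a s) \<longlongrightarrow> exp (- s) / s * (\<rho> - m s)) (at_right 0)"
    using AE_half_line
  proof eventually_elim
    case (elim s)
    define t where "t a = real (Suc (step (N a) s)) / real (N a)" for a
    have t: "(t \<longlongrightarrow> s) (at_right 0)" unfolding t_def by (rule Suc_step_quot[OF elim])
    have "((\<lambda>a. exp (- t a) / t a * gap a (Suc (step (N a) s))) \<longlongrightarrow> exp (- s) / s * (\<rho> - m s)) (at_right 0)"
      using elim by (intro tendsto_intros t gap_step_tendsto) auto
    then show ?case
      by (rule Lim_transform_eventually) (use eventually_N_ge[of 1] big_n[OF elim] in eventually_elim, simp add: g_eq t_def)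
  qed
  \<comment> \<open>Once \<open>n0 * a < h0\<close>, every index above the cut-off automatically
    satisfies \<open>n \<ge> n0\<close>.\<close>
  have "eventually (\<lambda>a. real n0 * a < h0) (at_right 0)"
  proof -
    have "((\<lambda>a. real n0 * a) \<longlongrightarrow> real n0 * 0) (at_right 0)" by (intro tendsto_intros)
    then show ?thesis using C(2) by (intro order_tendstoD) auto
  qed
  then have bound: "eventually (\<lambda>a. AE s in half_line. norm (g a s) \<le> w s) (at_right 0)"
    using eventually_N_ge[of 1] big eventually_pos
  proof eventually_elim
    case (elim a)
    note a = elim
    show ?case using AE_half_line
    proof eventually_elim
      case (elim s)
      define n where "n = Suc (step (N a) s)"
      define t where "t = real n / real (N a)"
      have t: "t \<ge> s" "t > 0" unfolding t_def n_def using Suc_step[of "real (N a)" s] a elim by auto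
      have ge: "g a s = exp (- t) / t * (if real n * a < h0 then 0 else gap a n)"
        unfolding n_def by (rule g_eq) (use a in \<open>auto simp: t_def n_def\<close>)
      show ?case
      proof (cases "real n * a < h0")
        case True
        then show ?thesis unfolding ge w_def using C broken_powr_nonneg by auto
      next
        case False
        have "real n0 * a < real n * a" using False a by linarith
        then have "n0 \<le> n" using a by (simp add: mult_less_cancel_right)
        moreover have "n \<ge> 1" "real n * a \<ge> h0" using False by (auto simp: n_def)
        ultimately have gp: "gap a n \<le> C * t powr (1 - p')" using a(3) unfolding t_def by blast
        have "exp (- t) / t * gap a n \<le> exp (- t) / t * (C * t powr (1 - p'))"
          using t gp by (intro mult_left_mono) auto
        also have "\<dots> = C * (exp (- t) * t powr (- p'))" using t by (simp add: powr_diff powr_minus field_simps)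
        also have "\<dots> \<le> C * (exp (- s) * s powr (- p'))"
          using t elim C by (intro mult_left_mono mult_mono powr_mono2') auto
        also have "\<dots> \<le> w s" unfolding w_def using exp_powr_le_broken_powr[of 1 s "- p'"] elim C by (intro mult_left_mono) auto
        finally show ?thesis unfolding ge using False t gap_bounds(1)[of a n] by (simp add: abs_mult)
      qed
    qed
  qed
  have meas: "g a \<in> borel_measurable half_line" for a unfolding g_def by measurable
  have gl: "((\<lambda>a. integral\<^sup>L half_line (g a)) \<longlongrightarrow> I2) (at_right 0)"
    unfolding I2_def by (rule dominated_convergence_at_right_0(1)[OF _ meas w lim bound]) measurable
  have "((\<lambda>a. suminf (\<lambda>n. fa n a) + integral\<^sup>L half_line (g a)) \<longlongrightarrow> 0 + I2) (at_right 0)"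
    using tendsto_add[OF fa_lim gl] by simp
  then have "((\<lambda>a. suminf (\<lambda>n. fa n a) + integral\<^sup>L half_line (g a)) \<longlongrightarrow> I2) (at_right 0)" by simp
  then show ?thesis
  proof (rule Lim_transform_eventually)
    show "\<forall>\<^sub>F a in at_right 0. suminf (\<lambda>n. fa n a) + integral\<^sup>L half_line (g a) = P (1 / real (N a)) - Q a (1 / real (N a))"
      using eventually_N_ge[of 1] eventually_pos
    proof eventually_elim
      case (elim a)
      have N: "real (N a) > 0" "1 / real (N a) > 0" using elim by auto
      have sfa: "summable (\<lambda>n. fa n a)" unfolding fa_def
        using N gap_bounds by (intro summable_exp_times(2)[where K=1] divide_Suc_le_1) auto
      have sfb: "summable (\<lambda>n. \<bar>fb a n\<bar>)" unfolding fb_def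
        using N gap_bounds by (intro summable_exp_times(1)[where K=1] divide_Suc_le_1) auto
      have "integral\<^sup>L half_line (g a) = (\<Sum>n. fb a n)" unfolding g_def by (rule integral_step[OF N(1) sfb])
      then have "suminf (\<lambda>n. fa n a) + integral\<^sup>L half_line (g a) = (\<Sum>n. fa n a + fb a n)"
        using suminf_add[OF sfa summable_rabs_cancel[OF sfb]] by simp
      also have "\<dots> = (\<Sum>n. exp (- (1 / real (N a) * real (Suc n))) * (p (Suc n) / real (Suc n)) -
          exp (- (1 / real (N a) * real (Suc n))) * (q a (Suc n) / real (Suc n)))"
      proof (rule suminf_cong)
        fix n
        have "fa n a + fb a n = exp (- (1 / real (N a) * real (Suc n))) * (gap a (Suc n) / real (Suc n))"
          by (simp add: fa_def fb_def del: of_nat_Suc)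
        also have "gap a (Suc n) = p (Suc n) - q a (Suc n)" using p_eq_q_gap[of a "Suc n"] elim by simp
        finally show "fa n a + fb a n = exp (- (1 / real (N a) * real (Suc n))) * (p (Suc n) / real (Suc n)) -
          exp (- (1 / real (N a) * real (Suc n))) * (q a (Suc n) / real (Suc n))"
          by (simp add: diff_divide_distrib right_diff_distrib del: of_nat_Suc)
      qed
      also have "\<dots> = P (1 / real (N a)) - Q a (1 / real (N a))"
        unfolding P_def Q_def using N by (intro suminf_diff[symmetric] summable_P summable_Q)
      finally show ?case .
    qed
  qed
qed

definition J :: "real \<Rightarrow> real" where "J l = I1 l - I2"

lemma Q_minus_P_limit:
  assumes "l > 0"
  shows "((\<lambda>a. Q a (l / real (N a)) - P (1 / real (N a))) \<longlongrightarrow> J l) (at_right 0)"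
  using tendsto_diff[OF I1_integrand(2)[OF assms] I2_limit] by (simp add: J_def)

text \<open>The difference is the integral of a nonnegative function that is positive near 0: as
  \<open>s\<close> tends to 0, \<open>m s\<close> tends to \<open>\<rho>\<close>, which is
  positive.\<close>

lemma J_strict: "l > 0 \<Longrightarrow> J (2 * l) < J l"
proof -
  assume l: "l > 0"
  define f where "f s = (exp (- (l * s)) - exp (- (2 * l * s))) / s * m s" for s
  have eq: "f s = (exp (- (l * s)) - exp (- s)) / s * m s - (exp (- (2 * l * s)) - exp (- s)) / s * m s" for s
    by (simp add: f_def left_diff_distrib diff_divide_distrib)
  have l2: "2 * l > 0" using l by simp
  have int: "integrable half_line f"
    unfolding eq by (rule Bochner_Integration.integrable_diff[OF I1_integrand(1)[OF l] I1_integrand(1)[OF l2]])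
  have J: "J l - J (2 * l) = integral\<^sup>L half_line f"
    unfolding J_def I1_def eq by (subst Bochner_Integration.integral_diff[OF I1_integrand(1)[OF l] I1_integrand(1)[OF l2]]) simp
  have lt: "exp (- (2 * l * s)) < exp (- (l * s))" if "s > 0" for s
  proof -
    have "l * s > 0" using l that by simp
    then show ?thesis by simp
  qed
  have "((\<lambda>s. measure \<mu> {s powr (1 - 1 / \<alpha>)..}) \<longlongrightarrow> measure \<mu> {0..}) (at_right 0)"
  proof -
    \<comment> \<open>Continuity of the tail of \<open>\<mu>\<close> is obtained as the moving
      threshold result for a constant sequence of laws; the ceiling is a dummy index tending to
      infinity.\<close>
    have "filterlim (\<lambda>s::real. s powr (1 - 1 / \<alpha>)) (nhds 0) (at_right 0)" using \<alpha> by real_asymp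
    moreover have "filterlim (\<lambda>s::real. nat \<lceil>1 / s\<rceil>) sequentially (at_right 0)" by real_asymp
    moreover have "weak_conv_m (\<lambda>_. \<mu>) \<mu>" by (simp add: weak_conv_m_def weak_conv_def)
    ultimately show ?thesis
      using weak_conv_moving_threshold(1)[of "\<lambda>_. \<mu>" \<mu>] real_distribution_\<mu> \<mu>_atomless by blast
  qed
  then have "eventually (\<lambda>s. m s > 0) (at_right 0)" unfolding m_def using \<rho>_pos by (intro order_tendstoD) (auto simp: \<rho>_def)
  then obtain d where d: "d > 0" "\<And>s. 0 < s \<Longrightarrow> s < d \<Longrightarrow> m s > 0" by (auto simp: eventually_at_right_field)
  have "integral\<^sup>L half_line f > 0"
  proof (rule integral_half_line_pos[OF int _ d(1)])
    show "f s \<ge> 0" if "s > 0" for s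
      unfolding f_def using lt[OF that] m_bounds(1)[of s] that
      by (intro mult_nonneg_nonneg divide_nonneg_nonneg) auto
    show "f s > 0" if "0 < s" "s < d" for s
      unfolding f_def using lt[OF that(1)] d(2)[OF that] that
      by (intro mult_pos_pos divide_pos_pos) auto
  qed
  then show ?thesis using J by simp
qed

end

section \<open>Asymptotics of the generating functions\<close>

lemma suminf_le_sum_plus:
  fixes c d :: "nat \<Rightarrow> real"
  assumes "summable c" "summable d" "\<And>n. n \<ge> k \<Longrightarrow> c n \<le> d n" "\<And>n. n < k \<Longrightarrow> c n \<le> A n + d n"
  shows "suminf c \<le> (\<Sum>n<k. A n) + suminf d"
proof -
  have f: "(\<lambda>n. if n < k then A n else 0) sums (\<Sum>n<k. A n)"
    using sums_If_finite_set[of "{..<k}" A] by simp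
  have "suminf c \<le> (\<Sum>n. (if n < k then A n else 0) + d n)"
    using assms sums_summable[OF f] by (intro suminf_le summable_add) (auto simp: not_less)
  also have "\<dots> = (\<Sum>n<k. A n) + suminf d"
    using suminf_add[OF sums_summable[OF f] assms(2)] sums_unique[OF f] by simp
  finally show ?thesis .
qed

text \<open>The value that the exponent series takes when all the probabilities are 1; see
  \<open>log_kernel_sums\<close>. It is the reference against which \<open>P\<close> and
  \<open>Q\<close> are measured.\<close>

definition log_kernel :: "real \<Rightarrow> real" where "log_kernel l = - ln (1 - exp (- l))"

lemma log_kernel_sums: "l > 0 \<Longrightarrow> (\<lambda>n. exp (- (l * real (Suc n))) * (1 / real (Suc n))) sums log_kernel l"
proof -
  assume l: "l > 0"
  have "exp (- l) ^ Suc n = exp (- (l * real (Suc n)))" for n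
    by (subst exp_of_nat_mult[symmetric]) (simp add: algebra_simps)
  then show ?thesis using ln_geometric[of "exp (- l)"] l unfolding log_kernel_def by (simp del: power_Suc of_nat_Suc)
qed

lemma exp_log_kernel: "l > 0 \<Longrightarrow> exp (- log_kernel l) = 1 - exp (- l)"
  by (simp add: log_kernel_def)

lemma log_kernel_antimono: "0 < l \<Longrightarrow> l \<le> l' \<Longrightarrow> log_kernel l' \<le> log_kernel l"
  by (simp add: log_kernel_def)

text \<open>Valid for every \<open>l\<close>, not only in the limit: \<open>1 - exp (- l)\<close>
  equals \<open>min 1 l\<close> up to a factor 2, whence the 2 inside the logarithm.\<close>

lemma log_kernel_diff_le:
  assumes "l > 0" "x \<ge> 1"
  shows "log_kernel l - log_kernel (x * l) \<le> ln (2 * x)"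
proof -
  have xl: "x * l > 0" using assms by simp
  have pos: "1 - exp (- l) > 0" "1 - exp (- (x * l)) > 0" using assms xl by auto
  have "1 - exp (- (x * l)) \<le> min 1 (x * l)" using exp_ge_add_one_self[of "- (x * l)"] by auto
  also have "\<dots> \<le> x * min 1 l" using assms by (cases "l \<le> 1") auto
  also have "\<dots> \<le> 2 * x * (1 - exp (- l))" using one_minus_exp_ge[OF assms(1)] assms(2) by simp
  finally have "ln (1 - exp (- (x * l))) \<le> ln (2 * x * (1 - exp (- l)))"
    using pos assms by (subst ln_le_cancel_iff) auto
  also have "\<dots> = ln (2 * x) + ln (1 - exp (- l))" using pos assms by (subst ln_mult) auto
  finally show ?thesis by (simp add: log_kernel_def)
qed

lemma log_kernel_diff_limit:
  assumes l: "(l1 \<longlongrightarrow> 0) F" "(l2 \<longlongrightarrow> 0) F" "eventually (\<lambda>x. l1 x > 0) F" "eventually (\<lambda>x. l2 x > 0) F"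
    and s: "((\<lambda>x. l2 x / l1 x) \<longlongrightarrow> s) F" "s > 0"
  shows "((\<lambda>x. log_kernel (l1 x) - log_kernel (l2 x)) \<longlongrightarrow> ln s) F"
proof -
  have lim: "((\<lambda>l::real. (1 - exp (- l)) / l) \<longlongrightarrow> 1) (at_right 0)" by real_asymp
  have "filterlim l1 (at_right 0) F" "filterlim l2 (at_right 0) F"
    using l by (auto simp: filterlim_at elim: eventually_mono)
  note lim1 = filterlim_compose[OF lim this(1)] and lim2 = filterlim_compose[OF lim this(2)]
  have "((\<lambda>x. ln ((1 - exp (- l2 x)) / l2 x / ((1 - exp (- l1 x)) / l1 x) * (l2 x / l1 x))) \<longlongrightarrow> ln (1 / 1 * s)) F"
    using s by (intro tendsto_intros lim1 lim2) auto
  moreover have "eventually (\<lambda>x. ln ((1 - exp (- l2 x)) / l2 x / ((1 - exp (- l1 x)) / l1 x) * (l2 x / l1 x)) = log_kernel (l1 x) - log_kernel (l2 x)) F"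
    using l(3,4)
  proof eventually_elim
    case (elim x)
    have "(1 - exp (- l2 x)) / l2 x / ((1 - exp (- l1 x)) / l1 x) * (l2 x / l1 x) = (1 - exp (- l2 x)) / (1 - exp (- l1 x))"
      using elim by simp
    moreover have "ln ((1 - exp (- l2 x)) / (1 - exp (- l1 x))) = ln (1 - exp (- l2 x)) - ln (1 - exp (- l1 x))"
      using elim by (simp add: ln_div)
    ultimately show ?case by (simp add: log_kernel_def)
  qed
  ultimately show ?thesis using Lim_transform_eventually by fastforce
qed

section \<open>Regular variation of \<open>exp P\<close> and domination of the rescaled
  integrand\<close>

context attracted_walk
begin

text \<open>\<open>p n\<close> tends to \<open>\<rho>\<close>, so the difference is compared with
  \<open>\<rho>\<close> times that of \<open>log_kernel\<close>. Finitely many initial terms vanish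
  as both arguments tend to 0; the others cost at most \<open>d\<close> times the kernel difference.
  Thus \<open>exp (P (1 / n))\<close> varies regularly with index \<open>\<rho>\<close>.\<close>

lemma P_diff_limit:
  assumes l: "(l1 \<longlongrightarrow> 0) F" "(l2 \<longlongrightarrow> 0) F" "eventually (\<lambda>x. l1 x > 0) F" "eventually (\<lambda>x. l2 x > 0) F"
    and s: "((\<lambda>x. l2 x / l1 x) \<longlongrightarrow> s) F" "s > 0"
  shows "((\<lambda>x. P (l1 x) - P (l2 x)) \<longlongrightarrow> \<rho> * ln s) F"
proof -
  note Glim = log_kernel_diff_limit[OF assms]
  define E where "E l l' = (P l - P l') - \<rho> * (log_kernel l - log_kernel l')" for l l'
  have "((\<lambda>x. E (l1 x) (l2 x)) \<longlongrightarrow> 0) F"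
  proof (rule tendstoI)
    fix e :: real assume e: "e > 0"
    define d where "d = e / (2 * (\<bar>ln s\<bar> + 1))"
    have d: "d > 0" using e by (simp add: d_def)
    have "eventually (\<lambda>n. dist (p n) \<rho> < d) sequentially" using p_tendsto d by (rule tendstoD)
    then obtain k where k: "\<And>n. n \<ge> k \<Longrightarrow> \<bar>p n - \<rho>\<bar> < d" by (auto simp: eventually_sequentially dist_real_def)
    define A where "A l l' n = \<bar>exp (- (l * real (Suc n))) - exp (- (l' * real (Suc n)))\<bar>" for l l' :: real and n
    have E_le: "\<bar>E l l'\<bar> \<le> (\<Sum>n<k. A l l' n) + d * \<bar>log_kernel l - log_kernel l'\<bar>" if l: "l > 0" "l' > 0" for l l'
    proof -
      define c where "c n = (exp (- (l * real (Suc n))) - exp (- (l' * real (Suc n)))) * ((p (Suc n) - \<rho>) / real (Suc n))" for n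
      define h where "h n = d * (A l l' n * (1 / real (Suc n)))" for n
      note sP = summable_P[OF l(1)] summable_P[OF l(2)] and sG = log_kernel_sums[OF l(1)] log_kernel_sums[OF l(2)]
      have "(\<lambda>n. (exp (- (l * real (Suc n))) * (p (Suc n) / real (Suc n)) - exp (- (l' * real (Suc n))) * (p (Suc n) / real (Suc n)))
        - \<rho> * (exp (- (l * real (Suc n))) * (1 / real (Suc n)) - exp (- (l' * real (Suc n))) * (1 / real (Suc n)))) sums E l l'"
        unfolding E_def P_def by (intro sums_diff sums_mult summable_sums sP sG)
      also have "(\<lambda>n. (exp (- (l * real (Suc n))) * (p (Suc n) / real (Suc n)) - exp (- (l' * real (Suc n))) * (p (Suc n) / real (Suc n)))
        - \<rho> * (exp (- (l * real (Suc n))) * (1 / real (Suc n)) - exp (- (l' * real (Suc n))) * (1 / real (Suc n)))) = c"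
        by (simp add: fun_eq_iff c_def field_simps del: of_nat_Suc)
      finally have cs: "c sums E l l'" .
      have hs: "h sums (d * \<bar>log_kernel l - log_kernel l'\<bar>)"
      proof -
        have "(\<lambda>n. A l l' n * (1 / real (Suc n))) sums \<bar>log_kernel l - log_kernel l'\<bar>"
        proof (cases "l \<le> l'")
          case True
          then have "A l l' n = exp (- (l * real (Suc n))) - exp (- (l' * real (Suc n)))" for n
            by (simp add: A_def mult_right_mono del: of_nat_Suc)
          moreover have "\<bar>log_kernel l - log_kernel l'\<bar> = log_kernel l - log_kernel l'" using log_kernel_antimono[OF l(1) True] by simp
          ultimately show ?thesis using sums_diff[OF sG] by (simp add: diff_divide_distrib del: of_nat_Suc)
        next
          case False
          then have "A l l' n = exp (- (l' * real (Suc n))) - exp (- (l * real (Suc n)))" for n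
            by (simp add: A_def mult_right_mono del: of_nat_Suc)
          moreover have "\<bar>log_kernel l - log_kernel l'\<bar> = log_kernel l' - log_kernel l" using log_kernel_antimono[OF l(2), of l] False by simp
          ultimately show ?thesis using sums_diff[OF sG(2) sG(1)] by (simp add: diff_divide_distrib del: of_nat_Suc)
        qed
        then show ?thesis unfolding h_def by (rule sums_mult)
      qed
      have c_abs: "\<bar>c n\<bar> = A l l' n * (1 / real (Suc n)) * \<bar>p (Suc n) - \<rho>\<bar>" for n
        by (simp add: c_def A_def abs_mult abs_divide del: of_nat_Suc)
      have A0: "A l l' n \<ge> 0" for n by (simp add: A_def)
      have big: "\<bar>c n\<bar> \<le> h n" if "n \<ge> k" for n
        unfolding c_abs h_def using k[of "Suc n"] that A0[of n]
        by (subst mult.commute) (intro mult_right_mono, auto)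
      have small: "\<bar>c n\<bar> \<le> A l l' n + h n" for n
      proof -
        have "\<bar>p (Suc n) - \<rho>\<bar> \<le> 1" using p_bounds[of "Suc n"] \<rho>_bounds by (simp add: abs_le_iff)
        then have "\<bar>c n\<bar> \<le> A l l' n * 1 * 1" unfolding c_abs using A0 by (intro mult_mono) (auto simp: mult_nonneg_nonneg)
        moreover have "h n \<ge> 0" unfolding h_def using A0[of n] d by (intro mult_nonneg_nonneg) auto
        ultimately show ?thesis by simp
      qed
      have cabs: "summable (\<lambda>n. \<bar>c n\<bar>)"
        using sums_summable[OF hs] by (rule summable_comparison_test_ev[rotated]) (use big in \<open>auto simp: eventually_sequentially\<close>)
      have "\<bar>E l l'\<bar> = \<bar>suminf c\<bar>" using sums_unique[OF cs] by simp
      also have "\<dots> \<le> (\<Sum>n. \<bar>c n\<bar>)" by (rule summable_rabs[OF cabs])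
      also have "\<dots> \<le> (\<Sum>n<k. A l l' n) + suminf h"
        by (rule suminf_le_sum_plus[OF cabs sums_summable[OF hs]]) (use big small in auto)
      finally show ?thesis using sums_unique[OF hs] by simp
    qed
    have "((\<lambda>x. \<Sum>n<k. A (l1 x) (l2 x) n) \<longlongrightarrow> (\<Sum>n<k. \<bar>exp (- (0 * real (Suc n))) - exp (- (0 * real (Suc n)))\<bar>)) F"
      unfolding A_def by (intro tendsto_intros l(1) l(2))
    then have "((\<lambda>x. \<Sum>n<k. A (l1 x) (l2 x) n) \<longlongrightarrow> 0) F" by simp
    then have 1: "eventually (\<lambda>x. (\<Sum>n<k. A (l1 x) (l2 x) n) < e / 2) F" using e by (intro order_tendstoD) auto
    have "((\<lambda>x. \<bar>log_kernel (l1 x) - log_kernel (l2 x)\<bar>) \<longlongrightarrow> \<bar>ln s\<bar>) F" using Glim by (rule tendsto_rabs)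
    then have 2: "eventually (\<lambda>x. \<bar>log_kernel (l1 x) - log_kernel (l2 x)\<bar> < \<bar>ln s\<bar> + 1) F" by (rule order_tendstoD) simp
    show "eventually (\<lambda>x. dist (E (l1 x) (l2 x)) 0 < e) F"
      using 1 2 l(3,4)
    proof eventually_elim
      case (elim x)
      have "\<bar>E (l1 x) (l2 x)\<bar> \<le> (\<Sum>n<k. A (l1 x) (l2 x) n) + d * \<bar>log_kernel (l1 x) - log_kernel (l2 x)\<bar>" using elim by (intro E_le)
      also have "d * \<bar>log_kernel (l1 x) - log_kernel (l2 x)\<bar> \<le> d * (\<bar>ln s\<bar> + 1)" using elim d by (intro mult_left_mono) auto
      also have "d * (\<bar>ln s\<bar> + 1) = e / 2"
      proof -
        have "\<bar>ln s\<bar> + 1 > 0" by simp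
        then show ?thesis unfolding d_def by (simp add: divide_simps)
      qed
      finally show ?case using elim by simp
    qed
  qed
  from tendsto_add[OF this tendsto_mult_left[OF Glim, of \<rho>]] show ?thesis by (simp add: E_def)
qed

text \<open>The logarithm of \<open>(1 - exp (- l)) * exp (P l)\<close> is minus the exponent series
  with weights \<open>1 - p n\<close>. From index \<open>k\<close> on these weights are at most
  \<open>1 - \<rho> + d\<close>, while each earlier term changes the sum by at most 1, hence the
  factor \<open>exp (real k)\<close>. The bound is global in \<open>l\<close>, as domination up to
  infinity requires.\<close>

lemma P_potter:
  assumes d: "d > 0"
  shows "\<exists>C>0. \<forall>l>0. \<forall>x\<ge>1. (1 - exp (- (x * l))) * exp (P (x * l)) \<le> C * x powr (1 - \<rho> + d) * ((1 - exp (- l)) * exp (P l))"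
proof -
  have "eventually (\<lambda>n. dist (p n) \<rho> < d) sequentially" using p_tendsto d by (rule tendstoD)
  then obtain k where k: "\<And>n. n \<ge> k \<Longrightarrow> \<bar>p n - \<rho>\<bar> < d" by (auto simp: eventually_sequentially dist_real_def)
  define v where "v = 1 - \<rho> + d"
  have v: "v > 0" using d \<rho>_bounds by (simp add: v_def)
  define C where "C = exp (real k) * 2 powr v"
  have "(1 - exp (- (x * l))) * exp (P (x * l)) \<le> C * x powr v * ((1 - exp (- l)) * exp (P l))" if l: "l > 0" and x: "x \<ge> 1" for l x
  proof -
    have xl: "x * l > 0" using l x by simp
    define c where "c n = (exp (- (l * real (Suc n))) - exp (- (x * l * real (Suc n)))) * ((1 - p (Suc n)) / real (Suc n))" for n
    define h where "h n = v * ((exp (- (l * real (Suc n))) - exp (- (x * l * real (Suc n)))) * (1 / real (Suc n)))" for n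
    have A: "0 \<le> exp (- (l * real (Suc n))) - exp (- (x * l * real (Suc n)))"
      "exp (- (l * real (Suc n))) - exp (- (x * l * real (Suc n))) \<le> 1" for n
    proof -
      have "1 * l * real (Suc n) \<le> x * l * real (Suc n)" using l x by (intro mult_right_mono) auto
      then show "0 \<le> exp (- (l * real (Suc n))) - exp (- (x * l * real (Suc n)))" by simp
      have "exp (- (l * real (Suc n))) \<le> 1" using l by simp
      then show "exp (- (l * real (Suc n))) - exp (- (x * l * real (Suc n))) \<le> 1"
        using exp_gt_zero[of "- (x * l * real (Suc n))"] by linarith
    qed
    have cs: "c sums (log_kernel l - P l - (log_kernel (x * l) - P (x * l)))"
    proof -
      have "(\<lambda>n. (exp (- (l * real (Suc n))) * (1 / real (Suc n)) - exp (- (l * real (Suc n))) * (p (Suc n) / real (Suc n)))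
        - (exp (- (x * l * real (Suc n))) * (1 / real (Suc n)) - exp (- (x * l * real (Suc n))) * (p (Suc n) / real (Suc n))))
        sums (log_kernel l - P l - (log_kernel (x * l) - P (x * l)))"
        unfolding P_def by (intro sums_diff summable_sums summable_P log_kernel_sums l xl)
      moreover have "(exp (- (l * real (Suc n))) * (1 / real (Suc n)) - exp (- (l * real (Suc n))) * (p (Suc n) / real (Suc n)))
        - (exp (- (x * l * real (Suc n))) * (1 / real (Suc n)) - exp (- (x * l * real (Suc n))) * (p (Suc n) / real (Suc n))) = c n" for n
        unfolding c_def diff_divide_distrib left_diff_distrib right_diff_distrib by simp
      ultimately show ?thesis by (simp only:)
    qed
    have "(\<lambda>n. exp (- (l * real (Suc n))) * (1 / real (Suc n)) - exp (- (x * l * real (Suc n))) * (1 / real (Suc n))) sums (log_kernel l - log_kernel (x * l))"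
      by (intro sums_diff log_kernel_sums l xl)
    then have hs: "h sums (v * (log_kernel l - log_kernel (x * l)))"
      unfolding h_def left_diff_distrib by (rule sums_mult)
    have "suminf c \<le> (\<Sum>n<k. 1) + suminf h"
    proof (rule suminf_le_sum_plus[OF sums_summable[OF cs] sums_summable[OF hs]])
      fix n assume "n \<ge> k"
      then have "1 - p (Suc n) \<le> v" using k[of "Suc n"] by (simp add: v_def abs_less_iff)
      then have "(exp (- (l * real (Suc n))) - exp (- (x * l * real (Suc n)))) * ((1 - p (Suc n)) / real (Suc n)) \<le>
        (exp (- (l * real (Suc n))) - exp (- (x * l * real (Suc n)))) * (v / real (Suc n))"
        using A(1)[of n] by (intro mult_left_mono divide_right_mono) auto
      then show "c n \<le> h n" unfolding c_def h_def by (simp del: of_nat_Suc add: mult_ac)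
    next
      fix n
      have "(1 - p (Suc n)) / real (Suc n) \<le> 1" using p_bounds[of "Suc n"] by (simp add: divide_le_eq)
      then have "c n \<le> 1 * 1" unfolding c_def using A[of n] p_bounds[of "Suc n"] by (intro mult_mono) auto
      moreover have "h n \<ge> 0" unfolding h_def using A(1)[of n] v by (intro mult_nonneg_nonneg) auto
      ultimately show "c n \<le> 1 + h n" by simp
    qed
    then have "log_kernel l - P l - (log_kernel (x * l) - P (x * l)) \<le> real k + v * (log_kernel l - log_kernel (x * l))"
      using sums_unique[OF cs] sums_unique[OF hs] by simp
    also have "\<dots> \<le> real k + v * ln (2 * x)" using log_kernel_diff_le[OF l x] v by (intro add_left_mono mult_left_mono) auto
    finally have "P (x * l) - log_kernel (x * l) \<le> real k + v * ln (2 * x) + (P l - log_kernel l)" by simp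
    then have "exp (P (x * l) - log_kernel (x * l)) \<le> exp (real k + v * ln (2 * x) + (P l - log_kernel l))" by simp
    also have "\<dots> = exp (real k) * (2 * x) powr v * exp (P l - log_kernel l)"
      using x by (simp add: exp_add powr_def)
    also have "(2 * x) powr v = 2 powr v * x powr v" using x by (simp add: powr_mult)
    finally show ?thesis using exp_log_kernel[OF l] exp_log_kernel[OF xl] by (simp add: C_def exp_diff exp_minus divide_inverse mult_ac)
  qed
  moreover have "C > 0" by (simp add: C_def)
  ultimately show ?thesis unfolding v_def by blast
qed

lemma Q_le_P: "a > 0 \<Longrightarrow> l > 0 \<Longrightarrow> Q a l \<le> P l"
  unfolding Q_def P_def
proof (intro suminf_le summable_Q summable_P)
  fix n assume "a > 0"
  then show "exp (- (l * real (Suc n))) * (q a (Suc n) / real (Suc n)) \<le> exp (- (l * real (Suc n))) * (p (Suc n) / real (Suc n))"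
    using p_eq_q_gap[of a "Suc n"] gap_bounds(1)[of a "Suc n"] by (intro mult_left_mono divide_right_mono) auto
qed

lemma Q_antimono: "0 < l \<Longrightarrow> l \<le> l' \<Longrightarrow> Q a l' \<le> Q a l"
  unfolding Q_def using q_bounds(1)[of a]
  by (intro suminf_le summable_Q mult_right_mono) (auto simp: mult_right_mono)

text \<open>The condition with \<open>min (y * u) 1\<close> covers both later uses: \<open>l\<close>
  against \<open>1 / N a\<close> with \<open>y = 1 / N a\<close>, and \<open>l\<close> against
  \<open>2 * l\<close> with \<open>y = l\<close>. Inserting the decay of \<open>q\<close> and
  pulling out \<open>(y * N a) powr g\<close> leaves the sum bounded in
  \<open>sum_min_powr_bound\<close>.\<close>

lemma Q_diff_bound:
  assumes g: "0 < g" "g < 1" "g < \<alpha> - 1"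
  shows "\<exists>K\<ge>0. eventually (\<lambda>a. \<forall>y>0. \<forall>l>0. \<forall>l'>0.
     (\<forall>u>0. exp (- (l * u)) - exp (- (l' * u)) \<le> min (y * u) 1) \<longrightarrow>
     Q a l - Q a l' \<le> K * (y * real (N a)) powr g) (at_right 0)"
proof -
  obtain C where C: "C \<ge> 1" and dec: "eventually (\<lambda>a. \<forall>n\<ge>1. q a n \<le> C * (real n / real (N a)) powr (- g)) (at_right 0)"
    using q_decay[OF g(1,3)] by blast
  obtain I where I: "I \<ge> 0" and Ib: "\<And>e. e > 0 \<Longrightarrow> summable (\<lambda>n. min (e * real (Suc n)) 1 / real (Suc n) * (e * real (Suc n)) powr (- g)) \<and>
     (\<Sum>n. min (e * real (Suc n)) 1 / real (Suc n) * (e * real (Suc n)) powr (- g)) \<le> I"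
    using sum_min_powr_bound[OF g(1,2)] by blast
  have "eventually (\<lambda>a. \<forall>y>0. \<forall>l>0. \<forall>l'>0.
     (\<forall>u>0. exp (- (l * u)) - exp (- (l' * u)) \<le> min (y * u) 1) \<longrightarrow>
     Q a l - Q a l' \<le> (C * I) * (y * real (N a)) powr g) (at_right 0)"
    using dec eventually_N_ge[of 1]
  proof eventually_elim
    case (elim a)
    show ?case
    proof (intro allI impI)
      fix y l l' :: real
      assume y: "y > 0" and l: "l > 0" "l' > 0" and le: "\<forall>u>0. exp (- (l * u)) - exp (- (l' * u)) \<le> min (y * u) 1"
      define t where "t n = min (y * real (Suc n)) 1 / real (Suc n) * (y * real (Suc n)) powr (- g)" for n
      have tI: "summable t" "suminf t \<le> I" unfolding t_def[abs_def] using Ib[OF y] by blast+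
      define B where "B = C * (y * real (N a)) powr g"
      have B: "B \<ge> 0" using C by (simp add: B_def)
      have "Q a l - Q a l' = (\<Sum>n. exp (- (l * real (Suc n))) * (q a (Suc n) / real (Suc n)) - exp (- (l' * real (Suc n))) * (q a (Suc n) / real (Suc n)))"
        unfolding Q_def using l by (intro suminf_diff summable_Q)
      also have "\<dots> \<le> (\<Sum>n. B * t n)"
      proof (intro suminf_le summable_mult)
        fix n
        have Nn: "(real (Suc n) / real (N a)) powr (- g) = (y * real (Suc n)) powr (- g) * (y * real (N a)) powr g"
          using y elim by (simp add: powr_divide powr_mult powr_minus divide_simps del: of_nat_Suc)
        have "(exp (- (l * real (Suc n))) - exp (- (l' * real (Suc n)))) * (q a (Suc n) / real (Suc n))
            \<le> min (y * real (Suc n)) 1 * (q a (Suc n) / real (Suc n))"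
          using le q_bounds(1)[of a "Suc n"] by (intro mult_right_mono) (auto simp del: of_nat_Suc)
        also have "\<dots> \<le> min (y * real (Suc n)) 1 * (C * (real (Suc n) / real (N a)) powr (- g) / real (Suc n))"
          using elim(1) y by (intro mult_left_mono divide_right_mono) (auto simp del: of_nat_Suc)
        also have "\<dots> = B * t n" unfolding Nn B_def t_def by simp
        finally show "exp (- (l * real (Suc n))) * (q a (Suc n) / real (Suc n)) - exp (- (l' * real (Suc n))) * (q a (Suc n) / real (Suc n)) \<le> B * t n"
          by (simp only: left_diff_distrib)
      next
        show "summable (\<lambda>n. exp (- (l * real (Suc n))) * (q a (Suc n) / real (Suc n)) - exp (- (l' * real (Suc n))) * (q a (Suc n) / real (Suc n)))"
          using l by (intro summable_diff summable_Q)
        show "summable t" by (rule tI)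
      qed
      also have "\<dots> = B * suminf t" by (rule suminf_mult[OF tI(1)])
      also have "\<dots> \<le> B * I" using tI B by (intro mult_left_mono) auto
      finally show "Q a l - Q a l' \<le> (C * I) * (y * real (N a)) powr g" by (simp add: B_def mult_ac)
    qed
  qed
  moreover have "C * I \<ge> 0" using C I by simp
  ultimately show ?thesis by blast
qed

text \<open>
  This is \<open>E (1 - exp (- l * \<tau>))\<^sup>2\<close>. The square makes the integral of \<open>l powr (- r - 1)\<close> against it converge
  at 0 for every \<open>r < 2\<close>, so that the cases \<open>r < 1\<close>, \<open>r = 1\<close> and \<open>r > 1\<close> need not be distinguished.
\<close>

definition square_defect :: "real \<Rightarrow> real \<Rightarrow> real" where
  "square_defect a l = (1 - exp (- l)) * (2 * exp (Q a l) - (1 + exp (- l)) * exp (Q a (2 * l)))"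

text \<open>Limit of \<open>exp (Q a (x / N a) - P (1 / N a))\<close> at
  \<open>x = l\<close>.\<close>

definition F :: "real \<Rightarrow> real" where
  "F l = exp (J l)"

text \<open>Normalised to a nontrivial limit: on this scale \<open>1 - exp (- l)\<close> is of order
  \<open>1 / N a\<close> and the exponentials of \<open>Q\<close> are of order
  \<open>exp (P (1 / N a))\<close>.\<close>

definition H :: "real \<Rightarrow> real \<Rightarrow> real" where
  "H a x = real (N a) / exp (P (1 / real (N a))) * square_defect a (x / real (N a))"

lemma square_defect_nonneg: "l > 0 \<Longrightarrow> square_defect a l \<ge> 0"
proof -
  assume l: "l > 0"
  have "(1 + exp (- l)) * exp (Q a (2 * l)) \<le> 2 * exp (Q a l)"
    using l Q_antimono[of l "2 * l" a] by (intro mult_mono) auto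
  then show ?thesis unfolding square_defect_def using l by (intro mult_nonneg_nonneg) auto
qed

lemma measurable_square_defect [measurable]: "square_defect a \<in> borel_measurable borel"
  unfolding square_defect_def Q_def by measurable

lemma H_tendsto:
  assumes x: "x > 0"
  shows "((\<lambda>a. H a x) \<longlongrightarrow> 2 * x * (F x - F (2 * x))) (at_right 0)"
proof -
  have N0: "((\<lambda>a. x / real (N a)) \<longlongrightarrow> 0) (at_right 0)"
    by (intro tendsto_divide_0[OF tendsto_const] filterlim_at_top_imp_at_infinity N_real_at_top)
  have "((\<lambda>y::real. y * (1 - exp (- (x / y)))) \<longlongrightarrow> x) at_top" using x by real_asymp
  then have 1: "((\<lambda>a. real (N a) * (1 - exp (- (x / real (N a))))) \<longlongrightarrow> x) (at_right 0)"
    by (rule filterlim_compose[OF _ N_real_at_top])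
  have "((\<lambda>a. real (N a) * (1 - exp (- (x / real (N a)))) *
      (2 * exp (Q a (x / real (N a)) - P (1 / real (N a))) - (1 + exp (- (x / real (N a)))) * exp (Q a ((2 * x) / real (N a)) - P (1 / real (N a)))))
      \<longlongrightarrow> x * (2 * exp (J x) - (1 + exp (- 0)) * exp (J (2 * x)))) (at_right 0)"
    using x by (intro tendsto_intros 1 N0 Q_minus_P_limit) auto
  moreover have "x * (2 * exp (J x) - (1 + exp (- 0)) * exp (J (2 * x))) = 2 * x * (F x - F (2 * x))"
    by (simp add: F_def algebra_simps)
  moreover have "real (N a) * (1 - exp (- (x / real (N a)))) *
      (2 * exp (Q a (x / real (N a)) - P (1 / real (N a))) - (1 + exp (- (x / real (N a)))) * exp (Q a ((2 * x) / real (N a)) - P (1 / real (N a)))) = H a x" for a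
    by (simp add: H_def square_defect_def exp_diff field_simps)
  ultimately show ?thesis by (simp only:)
qed

text \<open>For \<open>x \<le> 1\<close> the cancellation between \<open>Q a l\<close> and
  \<open>Q a (2 * l)\<close> contributes an extra \<open>x powr g\<close>. For \<open>x > 1\<close>
  cancellation is dropped, \<open>Q\<close> is replaced by \<open>P\<close>, and
  \<open>P_potter\<close> gives the growth.\<close>

lemma H_bound:
  assumes g: "0 < g" "g < 1" "g < \<alpha> - 1" and d: "d > 0"
  shows "\<exists>C>0. eventually (\<lambda>a. \<forall>x>0. H a x \<le> C * broken_powr (1 + g) (1 - \<rho> + d) x) (at_right 0)"
proof -
  obtain K where K: "K \<ge> 0" and Kb: "eventually (\<lambda>a. \<forall>y>0. \<forall>l>0. \<forall>l'>0.
     (\<forall>u>0. exp (- (l * u)) - exp (- (l' * u)) \<le> min (y * u) 1) \<longrightarrow>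
     Q a l - Q a l' \<le> K * (y * real (N a)) powr g) (at_right 0)"
    using Q_diff_bound[OF g] by blast
  obtain C where C: "C > 0" and Cb: "\<And>l x. l > 0 \<Longrightarrow> x \<ge> 1 \<Longrightarrow>
     (1 - exp (- (x * l))) * exp (P (x * l)) \<le> C * x powr (1 - \<rho> + d) * ((1 - exp (- l)) * exp (P l))"
    using P_potter[OF d] by blast
  define L where "L = exp K * (2 * K + 1) + 2 * C"
  have L: "L > 0" using K C by (simp add: L_def add_nonneg_pos)
  have diff_min: "exp (- (l * u)) - exp (- (l' * u)) \<le> min (y * u) 1"
    if "0 < l" "0 < u" "0 < y" "l' \<le> l + y" for l l' y u :: real
  proof -
    have "exp (- (l * u)) \<le> 1" using that by simp
    then have "exp (- (l * u)) - exp (- (l' * u)) \<le> 1" using exp_gt_zero[of "- (l' * u)"] by linarith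
    moreover have "exp (- (l' * u)) \<ge> exp (- (l * u)) * exp (- (y * u))"
      using that mult_right_mono[OF that(4), of u] by (simp add: algebra_simps flip: exp_add)
    then have "exp (- (l * u)) - exp (- (l' * u)) \<le> exp (- (l * u)) * (1 - exp (- (y * u)))" by (simp add: algebra_simps)
    moreover have "exp (- (l * u)) * (1 - exp (- (y * u))) \<le> 1 * (y * u)"
      using that exp_ge_add_one_self[of "- (y * u)"] by (intro mult_mono) auto
    ultimately show ?thesis by simp
  qed
  have "eventually (\<lambda>a. \<forall>x>0. H a x \<le> L * broken_powr (1 + g) (1 - \<rho> + d) x) (at_right 0)"
    using Kb eventually_N_ge[of 1] eventually_pos
  proof eventually_elim
    case (elim a)
    define M where "M = real (N a)"
    have M: "M \<ge> 1" using elim by (simp add: M_def)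
    define V where "V = exp (P (1 / M))"
    have V: "V > 0" by (simp add: V_def)
    show ?case
    proof (intro allI impI)
      fix x :: real assume x: "x > 0"
      define l where "l = x / M"
      have l: "l > 0" using x M by (simp add: l_def)
      have el: "1 - exp (- l) \<le> l" "0 \<le> 1 - exp (- l)" using exp_ge_add_one_self[of "- l"] l by auto
      show "H a x \<le> L * broken_powr (1 + g) (1 - \<rho> + d) x"
      proof (cases "x \<le> 1")
        case True
        have "Q a l - Q a (1 / M) \<le> K * (1 / M * M) powr g"
          unfolding M_def
        proof (rule elim(1)[rule_format])
          show "exp (- (l * u)) - exp (- (1 / real (N a) * u)) \<le> min (1 / real (N a) * u) 1" if "u > 0" for u
            using that l M by (intro diff_min) (auto simp: M_def)
        qed (use l M in \<open>auto simp: M_def\<close>)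
        then have "Q a l \<le> K + Q a (1 / M)" using M by simp
        also have "\<dots> \<le> K + P (1 / M)" using Q_le_P[of a "1 / M"] elim M by auto
        finally have psi: "exp (Q a l) \<le> exp K * V" by (simp add: V_def flip: exp_add)
        have "Q a l - Q a (2 * l) \<le> K * (l * M) powr g"
          unfolding M_def
        proof (rule elim(1)[rule_format])
          show "exp (- (l * u)) - exp (- (2 * l * u)) \<le> min (l * u) 1" if "u > 0" for u
            using that l by (intro diff_min) auto
        qed (use l in auto)
        also have "l * M = x" using M by (simp add: l_def)
        finally have dQ: "Q a l - Q a (2 * l) \<le> K * x powr g" .
        have "exp (Q a l) - exp (Q a (2 * l)) = exp (Q a l) * (1 - exp (- (Q a l - Q a (2 * l))))"
          by (simp add: right_diff_distrib flip: exp_add)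
        also have "\<dots> \<le> exp (Q a l) * (Q a l - Q a (2 * l))"
        proof (rule mult_left_mono)
          show "1 - exp (- (Q a l - Q a (2 * l))) \<le> Q a l - Q a (2 * l)"
            using exp_ge_add_one_self[of "- (Q a l - Q a (2 * l))"] by linarith
        qed simp
        also have "\<dots> \<le> exp K * V * (K * x powr g)"
          using psi dQ Q_antimono[of l "2 * l" a] l V by (intro mult_mono) auto
        finally have dpsi: "exp (Q a l) - exp (Q a (2 * l)) \<le> exp K * V * (K * x powr g)" .
        have psi2: "exp (Q a (2 * l)) \<le> exp K * V" 
        proof (rule order_trans[OF _ psi])
          show "exp (Q a (2 * l)) \<le> exp (Q a l)" using Q_antimono[of l "2 * l" a] l by simp
        qed
        have xg: "x \<le> x powr g" using True x g powr_mono'[of g 1 x] by simp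
        have "l \<le> x" unfolding l_def using M x by (simp add: divide_le_eq)
        \<comment> \<open>This rearrangement isolates the two small quantities, the drop of
          \<open>exp Q\<close> and \<open>1 - exp (- l)\<close>; both are bounded by multiples of
          \<open>x powr g\<close>.\<close>
        have "square_defect a l = (1 - exp (- l)) * (2 * (exp (Q a l) - exp (Q a (2 * l))) + (1 - exp (- l)) * exp (Q a (2 * l)))"
          by (simp add: square_defect_def algebra_simps)
        also have "\<dots> \<le> l * (2 * (exp K * V * (K * x powr g)) + x powr g * (exp K * V))"
          using el dpsi psi2 xg \<open>l \<le> x\<close> V l Q_antimono[of l "2 * l" a]
          by (intro mult_mono add_mono) auto
        also have "\<dots> = l * (exp K * (2 * K + 1) * V * x powr g)" by (simp add: algebra_simps)
        finally have "H a x \<le> M / V * (l * (exp K * (2 * K + 1) * V * x powr g))"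
          unfolding H_def l_def M_def[symmetric] V_def[symmetric] using M V by (intro mult_left_mono) auto
        also have "\<dots> = exp K * (2 * K + 1) * (x * x powr g)" using M V by (simp add: l_def)
        also have "x * x powr g = x powr (1 + g)" using x by (simp add: powr_add)
        also have "exp K * (2 * K + 1) * x powr (1 + g) \<le> L * x powr (1 + g)"
          unfolding L_def using C by (intro mult_right_mono) auto
        finally show ?thesis using True by (simp add: broken_powr_def)
      next
        case False
        have "square_defect a l \<le> (1 - exp (- l)) * (2 * exp (Q a l))" unfolding square_defect_def using el by (intro mult_left_mono) auto
        also have "\<dots> \<le> (1 - exp (- l)) * (2 * exp (P l))" using el Q_le_P[of a l] elim l by (intro mult_left_mono) auto
        also have "\<dots> = 2 * ((1 - exp (- (x * (1 / M)))) * exp (P (x * (1 / M))))" by (simp add: l_def)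
        also have "\<dots> \<le> 2 * (C * x powr (1 - \<rho> + d) * ((1 - exp (- (1 / M))) * exp (P (1 / M))))"
          using Cb[of "1 / M" x] False M by (intro mult_left_mono) auto
        also have "\<dots> \<le> 2 * (C * x powr (1 - \<rho> + d) * (1 / M * V))"
          unfolding V_def using exp_ge_add_one_self[of "- (1 / M)"] C by (intro mult_left_mono mult_right_mono) auto
        finally have "H a x \<le> M / V * (2 * (C * x powr (1 - \<rho> + d) * (1 / M * V)))"
          unfolding H_def l_def M_def[symmetric] V_def[symmetric] using M V by (intro mult_left_mono) auto
        also have "\<dots> = 2 * C * x powr (1 - \<rho> + d)" using M V by simp
        also have "\<dots> \<le> L * x powr (1 - \<rho> + d)" unfolding L_def using K by (intro mult_right_mono) auto
        finally show ?thesis using False by (simp add: broken_powr_def)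
      qed
    qed
  qed
  then show ?thesis using L by blast
qed

lemma F_strict: "x > 0 \<Longrightarrow> F (2 * x) < F x"
  using J_strict by (simp add: F_def)

text \<open>\<open>g\<close> is the midpoint between \<open>max (r - 1) 0\<close> and
  \<open>\<alpha> - 1\<close>, \<open>d\<close> half of \<open>r + \<rho> - 1\<close>. After
  multiplication by \<open>x powr (- r - 1)\<close> the majorant has exponent
  \<open>g - r > -1\<close> at 0 and \<open>- \<rho> + d - r < -1\<close> at infinity.\<close>

lemma H_integral_limit:
  assumes r: "1 - \<rho> < r" "r < \<alpha>"
  shows "\<exists>K>0. ((\<lambda>a. \<integral>x. x powr (- r - 1) * H a x \<partial>half_line) \<longlongrightarrow> K) (at_right 0)"
    and "eventually (\<lambda>a. integrable half_line (\<lambda>x. x powr (- r - 1) * H a x)) (at_right 0)"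
proof -
  define g where "g = (max (r - 1) 0 + (\<alpha> - 1)) / 2"
  define d where "d = (r + \<rho> - 1) / 2"
  have g: "0 < g" "g < 1" "g < \<alpha> - 1" "g > r - 1" using r \<alpha> by (auto simp: g_def max_def)
  have d: "d > 0" using r by (simp add: d_def)
  obtain C where C: "C > 0" and Cb: "eventually (\<lambda>a. \<forall>x>0. H a x \<le> C * broken_powr (1 + g) (1 - \<rho> + d) x) (at_right 0)"
    using H_bound[OF g(1-3) d] by blast
  define w where "w x = C * broken_powr (g - r) (- \<rho> + d - r) x" for x
  have w: "integrable half_line w" unfolding w_def
    using g r d by (intro integrable_mult_right integrable_broken_powr) (auto simp: d_def field_simps)
  \<comment> \<open>With the indicator the convergence holds at every point, so \<open>f\<close> is
    measurable as a limit along the sequence \<open>a = 1 / (k + 1)\<close>.\<close>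
  define f where "f x = indicator {0<..} x * (x powr (- r - 1) * (2 * x * (F x - F (2 * x))))" for x
  have lim_pt: "((\<lambda>a. indicator {0<..} x * (x powr (- r - 1) * H a x)) \<longlongrightarrow> f x) (at_right 0)" for x
  proof (cases "x > 0")
    case True
    have "((\<lambda>a. 1 * (x powr (- r - 1) * H a x)) \<longlongrightarrow> 1 * (x powr (- r - 1) * (2 * x * (F x - F (2 * x))))) (at_right 0)"
      by (intro tendsto_mult tendsto_const H_tendsto[OF True])
    then show ?thesis using True by (simp add: f_def)
  qed (simp add: f_def)
  have meas: "H a \<in> borel_measurable borel" for a unfolding H_def by measurable
  have f_meas: "f \<in> borel_measurable half_line"
  proof -
    have "filterlim (\<lambda>k. 1 / real (Suc k)) (at_right 0) sequentially" by real_asymp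
    then have "(\<lambda>k. indicator {0<..} x * (x powr (- r - 1) * H (1 / real (Suc k)) x)) \<longlonglongrightarrow> f x" for x
      by (rule filterlim_compose[OF lim_pt])
    then have "f \<in> borel_measurable borel"
      by (rule borel_measurable_LIMSEQ_real) (use meas in measurable)
    then show ?thesis by simp
  qed
  have lim: "AE x in half_line. ((\<lambda>a. x powr (- r - 1) * H a x) \<longlongrightarrow> f x) (at_right 0)"
    using AE_half_line
  proof eventually_elim
    case (elim x)
    then show ?case using lim_pt[of x] by simp
  qed
  have H0: "eventually (\<lambda>a. \<forall>x>0. H a x \<ge> 0) (at_right 0)"
    using eventually_N_ge[of 1] by eventually_elim (simp add: H_def square_defect_nonneg)
  have bound: "eventually (\<lambda>a. AE x in half_line. norm (x powr (- r - 1) * H a x) \<le> w x) (at_right 0)"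
    using Cb H0
  proof eventually_elim
    case (elim a)
    note a = elim
    show ?case using AE_half_line
    proof eventually_elim
      case (elim x)
      have "x powr (- r - 1) * H a x \<le> x powr (- r - 1) * (C * broken_powr (1 + g) (1 - \<rho> + d) x)"
        using a elim by (intro mult_left_mono) auto
      also have "\<dots> = C * (x powr (- r - 1) * broken_powr (1 + g) (1 - \<rho> + d) x)" by simp
      also have "x powr (- r - 1) * broken_powr (1 + g) (1 - \<rho> + d) x = broken_powr (g - r) (- \<rho> + d - r) x"
        by (simp add: broken_powr_def algebra_simps flip: powr_add)
      finally show ?case using a elim by (simp add: w_def abs_mult)
    qed
  qed
  have meas': "(\<lambda>x. x powr (- r - 1) * H a x) \<in> borel_measurable half_line" for a using meas by measurable
  note dct = dominated_convergence_at_right_0[OF f_meas meas' w lim bound]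
  have "integral\<^sup>L half_line f > 0"
  proof -
    have pos: "f x > 0" if "x > 0" for x
      using that F_strict[OF that] by (simp add: f_def)
    show ?thesis
      by (rule integral_half_line_pos[OF dct(2) _ zero_less_one]) (auto intro: less_imp_le pos)
  qed
  then show "\<exists>K>0. ((\<lambda>a. \<integral>x. x powr (- r - 1) * H a x \<partial>half_line) \<longlongrightarrow> K) (at_right 0)"
    using dct(1) by blast
  show "eventually (\<lambda>a. integrable half_line (\<lambda>x. x powr (- r - 1) * H a x)) (at_right 0)"
    using bound by eventually_elim (rule Bochner_Integration.integrable_bound[OF w meas'], auto elim!: eventually_mono)
qed

end

section \<open>Moments of the first passage time\<close>

lemma enat_eq_Inf_iff:
  fixes A :: "nat set"
  shows "Inf {enat k | k. k \<in> A} = enat n \<longleftrightarrow> n \<in> A \<and> (\<forall>k<n. k \<notin> A)"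
proof (cases "A = {}")
  case True
  then show ?thesis by (simp add: Inf_enat_def)
next
  case False
  define l where "l = (LEAST k. k \<in> A)"
  have l: "l \<in> A" "\<And>k. k \<in> A \<Longrightarrow> l \<le> k"
    unfolding l_def using False by (auto intro: LeastI Least_le)
  have "Inf {enat k | k. k \<in> A} = enat l"
  proof (rule antisym)
    show "Inf {enat k | k. k \<in> A} \<le> enat l" using l by (intro Inf_lower) auto
    show "enat l \<le> Inf {enat k | k. k \<in> A}" using l by (intro Inf_greatest) auto
  qed
  then have "Inf {enat k | k. k \<in> A} = enat n \<longleftrightarrow> l = n" by simp
  also have "\<dots> \<longleftrightarrow> n \<in> A \<and> (\<forall>k<n. k \<notin> A)"
    using l by (metis not_less le_antisym not_le)
  finally show ?thesis .
qed

lemma walk_eq_path_sum: "walk X a n \<omega> = path_sum (\<lambda>i. X i \<omega> - a) n"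
  by (simp add: walk_def path_sum_def)

lemma first_negative_time_eq_iff:
  "first_negative_time X a \<omega> = enat n \<longleftrightarrow> first_neg (\<lambda>i. X i \<omega> - a) n"
proof -
  have *: "first_negative_time X a \<omega> = Inf {enat k | k. k \<in> {k. 1 \<le> k \<and> walk X a k \<omega> < 0}}"
    by (simp add: first_negative_time_def)
  have "first_negative_time X a \<omega> = enat n \<longleftrightarrow> 1 \<le> n \<and> walk X a n \<omega> < 0 \<and> (\<forall>k<n. \<not> (1 \<le> k \<and> walk X a k \<omega> < 0))"
    unfolding * enat_eq_Inf_iff by simp
  also have "\<dots> \<longleftrightarrow> first_neg (\<lambda>i. X i \<omega> - a) n"
  proof -
    have "(\<forall>k<n. \<not> (1 \<le> k \<and> walk X a k \<omega> < 0)) \<longleftrightarrow> nonneg_upto (\<lambda>i. X i \<omega> - a) (n - 1)" if "1 \<le> n"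
      using that by (force simp: nonneg_upto_def walk_eq_path_sum not_less)
    then show ?thesis by (auto simp: first_neg_def walk_eq_path_sum)
  qed
  finally show ?thesis .
qed

lemma first_negative_time_ge_1: "first_negative_time X a \<omega> \<ge> 1"
  unfolding first_negative_time_def by (rule Inf_greatest) (auto simp: one_enat_def)

lemma first_negative_time_antimono:
  assumes "a \<le> a'"
  shows "first_negative_time X a' \<omega> \<le> first_negative_time X a \<omega>"
proof -
  have "walk X a' k \<omega> \<le> walk X a k \<omega>" for k
    unfolding walk_def using assms by (intro sum_mono) auto
  then show ?thesis
    unfolding first_negative_time_def by (intro Inf_superset_mono) (auto intro: le_less_trans)
qed

lemma enat_powr_mono: "r \<ge> 0 \<Longrightarrow> m \<le> n \<Longrightarrow> enat_powr m r \<le> enat_powr n r"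
  by (cases m; cases n) (auto simp: enat_powr_def intro!: ennreal_leI powr_mono2)

definition exp_enat :: "real \<Rightarrow> enat \<Rightarrow> real" where
  "exp_enat l t = (case t of enat n \<Rightarrow> exp (- (l * real n)) | \<infinity> \<Rightarrow> 0)"

lemma exp_enat_bounds: "l \<ge> 0 \<Longrightarrow> 0 \<le> exp_enat l t" "l \<ge> 0 \<Longrightarrow> exp_enat l t \<le> 1"
  by (auto simp: exp_enat_def split: enat.splits)

lemma exp_enat_square: "(exp_enat l t)\<^sup>2 = exp_enat (2 * l) t"
  by (auto simp: exp_enat_def power2_eq_square split: enat.splits simp flip: exp_add)

lemma measurable_exp_enat [measurable]: "(\<lambda>l. exp_enat l t) \<in> borel_measurable borel"
  by (cases t) (auto simp: exp_enat_def)

lemma inverse_scale_powr: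
  "n > 0 \<Longrightarrow> x > 0 \<Longrightarrow> (1 / n * x) powr (- r - 1) = n powr (r + 1) * x powr (- r - 1)" for n x r :: real
proof -
  assume "n > 0" "x > 0"
  moreover have "- r - 1 = - (r + 1)" by simp
  ultimately show ?thesis unfolding powr_minus by (simp only: powr_minus) (simp add: powr_divide, rule divide_inverse)
qed

text \<open>Replacing \<open>exp (- l)\<close> by \<open>exp (- l * t)\<close> multiplies this
  integral by \<open>t powr r\<close>, which is how powers of the passage time are represented. It
  converges at 0 because \<open>r < 2\<close> and at infinity because \<open>r > 0\<close>.\<close>

definition powr_const :: "real \<Rightarrow> real" where
  "powr_const r = (\<integral>l. l powr (- r - 1) * (1 - exp (- l))\<^sup>2 \<partial>half_line)"

context
  fixes r :: real
  assumes r: "0 < r" "r < 2"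
begin

lemma integrable_powr_const: "integrable half_line (\<lambda>l. l powr (- r - 1) * (1 - exp (- l))\<^sup>2)"
proof (rule Bochner_Integration.integrable_bound)
  show "integrable half_line (broken_powr (1 - r) (- r - 1))" using r by (intro integrable_broken_powr) auto
  show "AE l in half_line. norm (l powr (- r - 1) * (1 - exp (- l))\<^sup>2) \<le> norm (broken_powr (1 - r) (- r - 1) l)"
    using AE_half_line
  proof eventually_elim
    case (elim l)
    have b: "0 \<le> 1 - exp (- l)" "1 - exp (- l) \<le> l" "1 - exp (- l) \<le> 1"
      using elim exp_ge_add_one_self[of "- l"] by auto
    show ?case
    proof (cases "l \<le> 1")
      case True
      have "(1 - exp (- l))\<^sup>2 \<le> l\<^sup>2" using b by (intro power_mono) auto
      then have "l powr (- r - 1) * (1 - exp (- l))\<^sup>2 \<le> l powr (- r - 1) * l\<^sup>2" by (intro mult_left_mono) auto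
      also have "\<dots> = l powr (1 - r)" using elim by (simp flip: powr_numeral powr_add)
      finally show ?thesis using True by (simp add: broken_powr_def)
    next
      case False
      have "(1 - exp (- l))\<^sup>2 \<le> 1" using b by (simp add: power_le_one)
      then have "l powr (- r - 1) * (1 - exp (- l))\<^sup>2 \<le> l powr (- r - 1) * 1" by (intro mult_left_mono) auto
      then show ?thesis using False by (simp add: broken_powr_def)
    qed
  qed
qed simp

lemma powr_const_pos: "powr_const r > 0"
  unfolding powr_const_def
  by (rule integral_half_line_pos[OF integrable_powr_const _ zero_less_one]) auto

lemma nn_integral_powr_const: "(\<integral>\<^sup>+l. ennreal (l powr (- r - 1) * (1 - exp (- l))\<^sup>2) \<partial>half_line) = ennreal (powr_const r)"
  unfolding powr_const_def by (rule nn_integral_eq_integral[OF integrable_powr_const]) auto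

text \<open>The case of an infinite passage time. Doubling the variable shows that the integral
  equals \<open>2 powr (- r)\<close> times itself; being nonzero, it must be infinite.\<close>

lemma nn_integral_powr_infinite: "(\<integral>\<^sup>+l. ennreal (l powr (- r - 1)) \<partial>half_line) = \<top>"
proof -
  define A where "A = (\<integral>\<^sup>+l. ennreal (l powr (- r - 1)) \<partial>half_line)"
  have "A = ennreal 2 * (\<integral>\<^sup>+l. ennreal ((2 * l) powr (- r - 1)) \<partial>half_line)"
    unfolding A_def by (rule nn_integral_half_line_scale) auto
  also have "(\<integral>\<^sup>+l. ennreal ((2 * l) powr (- r - 1)) \<partial>half_line) = (\<integral>\<^sup>+l. ennreal (2 powr (- r - 1)) * ennreal (l powr (- r - 1)) \<partial>half_line)"
    by (rule nn_integral_cong_AE) (use AE_half_line in \<open>eventually_elim, simp add: powr_mult flip: ennreal_mult\<close>)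
  also have "\<dots> = ennreal (2 powr (- r - 1)) * A" unfolding A_def by (rule nn_integral_cmult) simp
  also have "ennreal 2 * (ennreal (2 powr (- r - 1)) * A) = ennreal (2 * 2 powr (- r - 1)) * A"
    by (subst ennreal_mult) (auto simp: mult.assoc)
  also have "2 * 2 powr (- r - 1) = (2::real) powr (- r)" by (simp add: powr_diff)
  finally have A: "A = ennreal (2 powr (- r)) * A" .
  have "ennreal (powr_const r) \<le> A"
    unfolding A_def nn_integral_powr_const[symmetric]
  proof (rule nn_integral_mono_AE)
    show "AE l in half_line. ennreal (l powr (- r - 1) * (1 - exp (- l))\<^sup>2) \<le> ennreal (l powr (- r - 1))"
      using AE_half_line
    proof eventually_elim
      case (elim l)
      then have "(1 - exp (- l))\<^sup>2 \<le> 1" by (simp add: power_le_one)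
      then have "l powr (- r - 1) * (1 - exp (- l))\<^sup>2 \<le> l powr (- r - 1) * 1" by (intro mult_left_mono) auto
      then show ?case by (intro ennreal_leI) simp
    qed
  qed
  then have "A \<noteq> 0" using powr_const_pos by (auto simp: ennreal_eq_0_iff)
  show ?thesis
  proof (rule ccontr)
    assume "\<not> ?thesis"
    then have "A \<noteq> \<top>" by (simp add: A_def)
    then obtain x where x: "A = ennreal x" "x \<ge> 0" by (cases A) auto
    then have "x \<noteq> 0" using \<open>A \<noteq> 0\<close> by auto
    have "x = 2 powr (- r) * x" using A x by (simp flip: ennreal_mult)
    then have "(2::real) powr (- r) = 1" using \<open>x \<noteq> 0\<close> by simp
    then show False using r by simp
  qed
qed

lemma nn_integral_enat_powr:
  assumes t: "t \<ge> 1"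
  shows "(\<integral>\<^sup>+l. ennreal (l powr (- r - 1) * (1 - exp_enat l t)\<^sup>2) \<partial>half_line) = ennreal (powr_const r) * enat_powr t r"
proof (cases t)
  case (enat n)
  then have n: "n \<ge> 1" using t by (simp add: one_enat_def)
  define f where "f l = ennreal (l powr (- r - 1) * (1 - exp (- (l * real n)))\<^sup>2)" for l
  have [measurable]: "f \<in> borel_measurable borel" unfolding f_def by measurable
  have "(\<integral>\<^sup>+l. f l \<partial>half_line) = ennreal (1 / real n) * (\<integral>\<^sup>+l. f (1 / real n * l) \<partial>half_line)"
    using n by (intro nn_integral_half_line_scale) auto
  also have "(\<integral>\<^sup>+l. f (1 / real n * l) \<partial>half_line) = (\<integral>\<^sup>+l. ennreal (real n powr (r + 1)) * ennreal (l powr (- r - 1) * (1 - exp (- l))\<^sup>2) \<partial>half_line)"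
  proof (rule nn_integral_cong_AE)
    show "AE l in half_line. f (1 / real n * l) = ennreal (real n powr (r + 1)) * ennreal (l powr (- r - 1) * (1 - exp (- l))\<^sup>2)"
      using AE_half_line
    proof eventually_elim
      case (elim l)
      have "(1 / real n * l) powr (- r - 1) = real n powr (r + 1) * l powr (- r - 1)"
        using n elim by (intro inverse_scale_powr) auto
      then have "(1 / real n * l) powr (- r - 1) * (1 - exp (- (1 / real n * l * real n)))\<^sup>2 =
          real n powr (r + 1) * (l powr (- r - 1) * (1 - exp (- l))\<^sup>2)" using n by simp
      then show ?case unfolding f_def by (simp only:) (rule ennreal_mult, auto)
    qed
  qed
  also have "\<dots> = ennreal (real n powr (r + 1)) * ennreal (powr_const r)"
    by (subst nn_integral_cmult) (auto simp: nn_integral_powr_const)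
  also have "ennreal (1 / real n) * (ennreal (real n powr (r + 1)) * ennreal (powr_const r)) = ennreal (powr_const r) * ennreal (real n powr r)"
    using n powr_const_pos by (simp add: powr_add mult_ac flip: ennreal_mult)
  finally show ?thesis by (simp add: enat f_def exp_enat_def enat_powr_def)
next
  case infinity
  then show ?thesis using powr_const_pos
    by (simp add: exp_enat_def enat_powr_def nn_integral_powr_infinite ennreal_mult_top)
qed

end

lemma sigma_finite_half_line: "sigma_finite_measure half_line"
  unfolding half_line_def
  by (subst sigma_finite_measure.sigma_finite_iff_density_finite[OF sigma_finite_lborel]) auto

section \<open>Laplace transform and moments of the passage time\<close>

context attracted_walk
begin

lemma iid_shifted: "iid_sequence M (\<lambda>i \<omega>. X i \<omega> - a)"
  unfolding iid_sequence_def
proof (intro conjI allI)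
  show "indep_vars (\<lambda>_. borel) (\<lambda>i \<omega>. X i \<omega> - a) UNIV"
    by (rule indep_vars_compose2[OF indep_X]) simp
  have eq: "distr M borel (\<lambda>\<omega>. X i \<omega> - a) = distr (distr M borel (X i)) borel (\<lambda>x. x - a)" for i
    by (subst distr_distr) (auto simp: o_def)
  show "distr M borel (\<lambda>\<omega>. X i \<omega> - a) = distr M borel (\<lambda>\<omega>. X 0 \<omega> - a)" for i
    unfolding eq by (subst distr_X) simp
qed

lemma shifted_path_sum: "path_sum (\<lambda>i. X i \<omega> - a) n = S n \<omega> - real n * a"
  by (simp add: path_sum_def S_def sum_subtractf)

lemma measurable_first_negative_time [measurable]: "first_negative_time X a \<in> measurable M (count_space UNIV)"
proof (rule measurable_count_space_eq2_countable[THEN iffD2], intro conjI ballI)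
  interpret Y: iid_reals M "\<lambda>i \<omega>. X i \<omega> - a" by unfold_locales (rule iid_shifted)
  have fin: "first_negative_time X a -` {enat n} \<inter> space M \<in> events" for n
  proof -
    have "Measurable.pred M (\<lambda>\<omega>. first_neg (\<lambda>i. X i \<omega> - a) n)"
      by (rule measurable_compose[OF Y.rv_path[of "\<lambda>i. i"] pred_first_neg])
    then have "{\<omega>\<in>space M. first_neg (\<lambda>i. X i \<omega> - a) n} \<in> events" by (simp add: pred_def)
    moreover have "first_negative_time X a -` {enat n} \<inter> space M = {\<omega>\<in>space M. first_neg (\<lambda>i. X i \<omega> - a) n}"
      by (auto simp: first_negative_time_eq_iff)
    ultimately show ?thesis by simp
  qed
  fix t :: enat
  show "first_negative_time X a -` {t} \<inter> space M \<in> events"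
  proof (cases t)
    case infinity
    have "first_negative_time X a -` {\<infinity>} \<inter> space M = space M - (\<Union>n. first_negative_time X a -` {enat n} \<inter> space M)"
      by (auto simp: not_infinity_eq)
    moreover have "space M - (\<Union>n. first_negative_time X a -` {enat n} \<inter> space M) \<in> events"
      by (intro sets.Diff sets.top sets.countable_UN) (use fin in auto)
    ultimately show ?thesis using infinity by simp
  qed (use fin in simp)
qed auto

definition hitting_prob :: "real \<Rightarrow> nat \<Rightarrow> real" where
  "hitting_prob a n = prob {\<omega>\<in>space M. first_negative_time X a \<omega> = enat n}"

text \<open>Sparre Andersen for the increments \<open>X i - a\<close>, whose sums are negative with
  probability \<open>1 - q a n\<close>. The 1 in this weight sums to \<open>log_kernel l\<close>,
  whose exponential is the factor \<open>1 - exp (- l)\<close>; the rest is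
  \<open>Q\<close>.\<close>

lemma hitting_prob_generating:
  assumes l: "l > 0"
  shows "summable (\<lambda>n. hitting_prob a n * exp (- (l * real n)))"
    and "1 - (\<Sum>n. hitting_prob a n * exp (- (l * real n))) = (1 - exp (- l)) * exp (Q a l)"
proof -
  interpret Y: iid_reals M "\<lambda>i \<omega>. X i \<omega> - a" by unfold_locales (rule iid_shifted)
  have fY: "hitting_prob a n = Y.pr (\<lambda>x. first_neg x n)" for n
    by (simp add: hitting_prob_def Y.pr_def first_negative_time_eq_iff)
  have wY: "Y.pr (\<lambda>x. path_sum x n < 0) = 1 - q a n" for n
  proof -
    have "{\<omega>\<in>space M. path_sum (\<lambda>i. X i \<omega> - a) n < 0} = space M - {\<omega>\<in>space M. S n \<omega> \<ge> real n * a}"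
      by (auto simp: shifted_path_sum)
    then show ?thesis unfolding Y.pr_def q_def by (simp only:) (rule prob_compl, measurable)
  qed
  have ez: "exp (- l) ^ n = exp (- (l * real n))" for n
    by (subst exp_of_nat_mult[symmetric]) (simp add: algebra_simps)
  have "\<bar>hitting_prob a n\<bar> \<le> 1" for n by (simp add: hitting_prob_def)
  then have "summable (\<lambda>n. exp (- (l * real (Suc n))) * hitting_prob a (Suc n))"
    by (intro summable_exp_times(2)[OF l, where K=1]) simp
  then show "summable (\<lambda>n. hitting_prob a n * exp (- (l * real n)))"
    by (subst summable_Suc_iff[symmetric]) (simp add: mult.commute)
  have "(\<lambda>n. exp (- (l * real (Suc n))) * (1 / real (Suc n)) - exp (- (l * real (Suc n))) * (q a (Suc n) / real (Suc n))) sums (log_kernel l - Q a l)"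
    unfolding Q_def by (intro sums_diff log_kernel_sums summable_sums summable_Q l)
  moreover have "exp (- (l * real (Suc n))) * (1 / real (Suc n)) - exp (- (l * real (Suc n))) * (q a (Suc n) / real (Suc n))
      = (1 - q a (Suc n)) / real (Suc n) * exp (- l) ^ Suc n" for n
    unfolding ez by (simp add: diff_divide_distrib left_diff_distrib right_diff_distrib mult.commute)
  ultimately have "(\<lambda>n. (1 - q a (Suc n)) / real (Suc n) * exp (- l) ^ Suc n) sums (log_kernel l - Q a l)" by (simp only:)
  then have "(\<lambda>n. (1 - q a n) / real n * exp (- l) ^ n) sums (log_kernel l - Q a l)"
    by (subst (asm) sums_Suc_iff) simp
  then have "(\<Sum>n. (1 - q a n) / real n * exp (- l) ^ n) = log_kernel l - Q a l" by (simp add: sums_iff)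
  then have "1 - (\<Sum>n. hitting_prob a n * exp (- l) ^ n) = exp (- (log_kernel l - Q a l))"
    using Y.sparre_andersen[of "exp (- l)"] l by (simp add: fY wY)
  also have "\<dots> = exp (- log_kernel l) * exp (Q a l)" by (simp flip: exp_add)
  finally show "1 - (\<Sum>n. hitting_prob a n * exp (- (l * real n))) = (1 - exp (- l)) * exp (Q a l)"
    by (simp add: ez exp_log_kernel[OF l])
qed

lemma expectation_exp_enat:
  assumes l: "l > 0"
  shows "expectation (\<lambda>\<omega>. exp_enat l (first_negative_time X a \<omega>)) = (\<Sum>n. hitting_prob a n * exp (- (l * real n)))"
    and "integrable M (\<lambda>\<omega>. exp_enat l (first_negative_time X a \<omega>))"
proof -
  let ?T = "first_negative_time X a"
  have "(\<lambda>t. exp_enat l t) \<in> borel_measurable (count_space UNIV)" by simp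
  then have [measurable]: "(\<lambda>\<omega>. exp_enat l (?T \<omega>)) \<in> borel_measurable M"
    by (rule measurable_compose[OF measurable_first_negative_time])
  have [measurable]: "{\<omega>\<in>space M. ?T \<omega> = enat n} \<in> events" for n by measurable
  show "integrable M (\<lambda>\<omega>. exp_enat l (?T \<omega>))"
    using l exp_enat_bounds[of l] by (intro integrable_const_bound[where B=1]) auto
  have pt: "ennreal (exp_enat l (?T \<omega>)) = (\<Sum>n. ennreal (exp (- (l * real n))) * indicator {\<omega>\<in>space M. ?T \<omega> = enat n} \<omega>)"
    if "\<omega> \<in> space M" for \<omega>
  proof (cases "?T \<omega>")
    case (enat k)
    have "(\<Sum>n. ennreal (exp (- (l * real n))) * indicator {\<omega>\<in>space M. ?T \<omega> = enat n} \<omega>) =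
        (\<Sum>n\<in>{k}. ennreal (exp (- (l * real n))) * indicator {\<omega>\<in>space M. ?T \<omega> = enat n} \<omega>)"
      by (rule suminf_finite) (auto simp: enat)
    then show ?thesis using that enat by (simp add: exp_enat_def)
  qed (simp add: exp_enat_def)
  have "(\<integral>\<^sup>+\<omega>. ennreal (exp_enat l (?T \<omega>)) \<partial>M) =
      (\<integral>\<^sup>+\<omega>. (\<Sum>n. ennreal (exp (- (l * real n))) * indicator {\<omega>\<in>space M. ?T \<omega> = enat n} \<omega>) \<partial>M)"
    by (rule nn_integral_cong) (rule pt)
  also have "\<dots> = (\<Sum>n. ennreal (exp (- (l * real n))) * emeasure M {\<omega>\<in>space M. ?T \<omega> = enat n})"
    by (subst nn_integral_suminf) (auto simp: nn_integral_cmult_indicator)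
  also have "\<dots> = (\<Sum>n. ennreal (hitting_prob a n * exp (- (l * real n))))"
    by (simp add: emeasure_eq_measure hitting_prob_def mult.commute flip: ennreal_mult)
  also have "\<dots> = ennreal (\<Sum>n. hitting_prob a n * exp (- (l * real n)))"
    by (intro suminf_ennreal2 hitting_prob_generating l) (simp add: hitting_prob_def)
  finally show "expectation (\<lambda>\<omega>. exp_enat l (?T \<omega>)) = (\<Sum>n. hitting_prob a n * exp (- (l * real n)))"
    using l exp_enat_bounds(1)[of l] hitting_prob_generating(1)[OF l, of a]
    by (intro integral_eq_nn_integral[THEN trans]) (auto simp: enn2real_ennreal suminf_nonneg hitting_prob_def)
qed

text \<open>Expanding the square needs the Laplace transform only at \<open>l\<close> and
  \<open>2 * l\<close>. The factor \<open>1 + exp (- l)\<close> of \<open>square_defect\<close>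
  comes from factoring \<open>1 - exp (- 2 * l)\<close>.\<close>

lemma nn_integral_exp_enat_square:
  assumes l: "l > 0"
  shows "(\<integral>\<^sup>+\<omega>. ennreal ((1 - exp_enat l (first_negative_time X a \<omega>))\<^sup>2) \<partial>M) = ennreal (square_defect a l)"
proof -
  let ?e = "\<lambda>l \<omega>. exp_enat l (first_negative_time X a \<omega>)"
  have l2: "2 * l > 0" using l by simp
  have eq: "(1 - ?e l \<omega>)\<^sup>2 = 1 - 2 * ?e l \<omega> + ?e (2 * l) \<omega>" for \<omega>
    unfolding exp_enat_square[symmetric] by (simp add: power2_eq_square algebra_simps)
  have int: "integrable M (\<lambda>\<omega>. (1 - ?e l \<omega>)\<^sup>2)"
    unfolding eq by (intro Bochner_Integration.integrable_add Bochner_Integration.integrable_diff integrable_mult_right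
        expectation_exp_enat(2) l l2) simp
  have "expectation (\<lambda>\<omega>. (1 - ?e l \<omega>)\<^sup>2) = expectation (\<lambda>\<omega>. 1) - 2 * expectation (?e l) + expectation (?e (2 * l))"
    unfolding eq using expectation_exp_enat(2)[OF l] expectation_exp_enat(2)[OF l2]
    by (subst Bochner_Integration.integral_add) (auto simp: Bochner_Integration.integral_diff)
  also have "\<dots> = 2 * (1 - (\<Sum>n. hitting_prob a n * exp (- (l * real n)))) - (1 - (\<Sum>n. hitting_prob a n * exp (- (2 * l * real n))))"
    by (simp add: expectation_exp_enat l l2 prob_space)
  also have "\<dots> = 2 * ((1 - exp (- l)) * exp (Q a l)) - (1 - exp (- (2 * l))) * exp (Q a (2 * l))"
    using hitting_prob_generating(2)[OF l] hitting_prob_generating(2)[OF l2] by simp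
  also have "1 - exp (- (2 * l)) = (1 - exp (- l)) * (1 + exp (- l))"
    by (simp add: algebra_simps flip: exp_add)
  finally have "expectation (\<lambda>\<omega>. (1 - ?e l \<omega>)\<^sup>2) = square_defect a l" by (simp add: square_defect_def algebra_simps)
  then show ?thesis using nn_integral_eq_integral[OF int] by simp
qed

definition moment :: "real \<Rightarrow> real \<Rightarrow> ennreal" where
  "moment r a = (\<integral>\<^sup>+\<omega>. enat_powr (first_negative_time X a \<omega>) r \<partial>M)"

text \<open>Tonelli, applied to the integral representation of powers at each outcome. Working with
  nonnegative integrals admits infinite passage times and infinite moments.\<close>

lemma moment_eq:
  assumes r: "0 < r" "r < 2"
  shows "ennreal (powr_const r) * moment r a = (\<integral>\<^sup>+l. ennreal (l powr (- r - 1) * square_defect a l) \<partial>half_line)"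
proof -
  let ?T = "first_negative_time X a"
  interpret L: sigma_finite_measure half_line by (rule sigma_finite_half_line)
  interpret pair_sigma_finite M half_line ..
  have meas: "(\<lambda>(\<omega>, l). ennreal (l powr (- r - 1) * (1 - exp_enat l (?T \<omega>))\<^sup>2)) \<in> borel_measurable (M \<Otimes>\<^sub>M half_line)"
  proof -
    have "(\<lambda>p. ennreal (snd p powr (- r - 1) * (1 - exp_enat (snd p) t)\<^sup>2)) \<in> borel_measurable (M \<Otimes>\<^sub>M half_line)" for t
      by measurable
    moreover have "(\<lambda>p. ?T (fst p)) \<in> measurable (M \<Otimes>\<^sub>M half_line) (count_space UNIV)" by measurable
    ultimately have "(\<lambda>p. ennreal (snd p powr (- r - 1) * (1 - exp_enat (snd p) (?T (fst p)))\<^sup>2)) \<in> borel_measurable (M \<Otimes>\<^sub>M half_line)"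
      by (rule measurable_compose_countable)
    then show ?thesis by (simp add: case_prod_beta)
  qed
  have eT: "(\<lambda>\<omega>. enat_powr (?T \<omega>) r) \<in> borel_measurable M"
    by (rule measurable_compose[OF measurable_first_negative_time]) simp
  have "ennreal (powr_const r) * moment r a = (\<integral>\<^sup>+\<omega>. ennreal (powr_const r) * enat_powr (?T \<omega>) r \<partial>M)"
    unfolding moment_def by (rule nn_integral_cmult[symmetric, OF eT])
  also have "\<dots> = (\<integral>\<^sup>+\<omega>. (\<integral>\<^sup>+l. ennreal (l powr (- r - 1) * (1 - exp_enat l (?T \<omega>))\<^sup>2) \<partial>half_line) \<partial>M)"
    by (intro nn_integral_cong nn_integral_enat_powr[symmetric] r first_negative_time_ge_1)
  also have "\<dots> = (\<integral>\<^sup>+l. (\<integral>\<^sup>+\<omega>. ennreal (l powr (- r - 1) * (1 - exp_enat l (?T \<omega>))\<^sup>2) \<partial>M) \<partial>half_line)"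
    by (rule Fubini'[OF meas, symmetric])
  also have "\<dots> = (\<integral>\<^sup>+l. ennreal (l powr (- r - 1) * square_defect a l) \<partial>half_line)"
  proof (rule nn_integral_cong_AE)
    show "AE l in half_line. (\<integral>\<^sup>+\<omega>. ennreal (l powr (- r - 1) * (1 - exp_enat l (?T \<omega>))\<^sup>2) \<partial>M) = ennreal (l powr (- r - 1) * square_defect a l)"
      using AE_half_line
    proof eventually_elim
      case (elim l)
      have m: "(\<lambda>\<omega>. ennreal ((1 - exp_enat l (?T \<omega>))\<^sup>2)) \<in> borel_measurable M"
        by (rule measurable_compose[OF measurable_first_negative_time]) simp
      have "(\<integral>\<^sup>+\<omega>. ennreal (l powr (- r - 1) * (1 - exp_enat l (?T \<omega>))\<^sup>2) \<partial>M) =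
          (\<integral>\<^sup>+\<omega>. ennreal (l powr (- r - 1)) * ennreal ((1 - exp_enat l (?T \<omega>))\<^sup>2) \<partial>M)"
        by (simp flip: ennreal_mult)
      also have "\<dots> = ennreal (l powr (- r - 1)) * ennreal (square_defect a l)"
        by (simp add: nn_integral_cmult[OF m] nn_integral_exp_enat_square[OF elim])
      finally show ?case using square_defect_nonneg[OF elim] by (simp flip: ennreal_mult)
    qed
  qed
  finally show ?thesis .
qed

lemma moment_antimono: "r \<ge> 0 \<Longrightarrow> a \<le> a' \<Longrightarrow> moment r a' \<le> moment r a"
  unfolding moment_def by (intro nn_integral_mono enat_powr_mono first_negative_time_antimono)

lemma moment_ge_1: "r \<ge> 0 \<Longrightarrow> moment r a \<ge> 1"
proof -
  assume r: "r \<ge> 0"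
  have "1 = (\<integral>\<^sup>+\<omega>. enat_powr 1 r \<partial>M)" by (simp add: enat_powr_def one_enat_def emeasure_space_1)
  also have "\<dots> \<le> moment r a"
    unfolding moment_def by (intro nn_integral_mono enat_powr_mono r first_negative_time_ge_1)
  finally show ?thesis .
qed

section \<open>Regular variation of the moment in the drift\<close>

context
  fixes r :: real
  assumes r: "1 - \<rho> < r" "r < \<alpha>"
begin

lemma r_bounds: "0 < r" "r < 2"
  using r \<rho>_bounds \<alpha> by auto

text \<open>Substituting \<open>l = x / N a\<close> yields an exact identity once the rescaled
  integral is finite; the asymptotics enter only through the limit of that integral.\<close>

lemma moment_asymptotic:
  "eventually (\<lambda>a. moment r a = ennreal (real (N a) powr (r - 1) * exp (P (1 / real (N a))) *
     (\<integral>x. x powr (- r - 1) * H a x \<partial>half_line) / powr_const r)) (at_right 0)"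
  using eventually_N_ge[of 1] H_integral_limit(2)[OF r]
proof eventually_elim
  case (elim a)
  define n where "n = real (N a)"
  have n: "n > 0" using elim by (simp add: n_def)
  define v where "v = exp (P (1 / n))"
  have v: "v > 0" by (simp add: v_def)
  have H0: "H a x \<ge> 0" if "x > 0" for x using that elim by (simp add: H_def square_defect_nonneg)
  have c: "powr_const r > 0" by (rule powr_const_pos[OF r_bounds])
  have "ennreal (powr_const r) * moment r a = (\<integral>\<^sup>+l. ennreal (l powr (- r - 1) * square_defect a l) \<partial>half_line)"
    by (rule moment_eq[OF r_bounds])
  also have "\<dots> = ennreal (1 / n) * (\<integral>\<^sup>+x. ennreal ((1 / n * x) powr (- r - 1) * square_defect a (1 / n * x)) \<partial>half_line)"
    using n by (intro nn_integral_half_line_scale) auto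
  also have "(\<integral>\<^sup>+x. ennreal ((1 / n * x) powr (- r - 1) * square_defect a (1 / n * x)) \<partial>half_line) =
      (\<integral>\<^sup>+x. ennreal (n powr r * v) * ennreal (x powr (- r - 1) * H a x) \<partial>half_line)"
  proof (rule nn_integral_cong_AE)
    show "AE x in half_line. ennreal ((1 / n * x) powr (- r - 1) * square_defect a (1 / n * x)) = ennreal (n powr r * v) * ennreal (x powr (- r - 1) * H a x)"
      using AE_half_line
    proof eventually_elim
      case (elim x)
      have D: "square_defect a (1 / n * x) = v / n * H a x" using n v by (simp add: H_def n_def[symmetric] v_def[symmetric])
      have "(1 / n * x) powr (- r - 1) = n powr (r + 1) * x powr (- r - 1)" by (rule inverse_scale_powr[OF n elim])
      then have "(1 / n * x) powr (- r - 1) * square_defect a (1 / n * x) = (n powr r * v) * (x powr (- r - 1) * H a x)"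
        unfolding D using n by (simp add: powr_add)
      then show ?case using n v H0[OF elim] by (simp flip: ennreal_mult)
    qed
  qed
  also have "\<dots> = ennreal (n powr r * v) * (\<integral>\<^sup>+x. ennreal (x powr (- r - 1) * H a x) \<partial>half_line)"
    using borel_measurable_integrable[OF elim(2)] by (intro nn_integral_cmult) auto
  also have "(\<integral>\<^sup>+x. ennreal (x powr (- r - 1) * H a x) \<partial>half_line) = ennreal (\<integral>x. x powr (- r - 1) * H a x \<partial>half_line)"
  proof (rule nn_integral_eq_integral[OF elim(2)])
    show "AE x in half_line. 0 \<le> x powr (- r - 1) * H a x"
      using AE_half_line by eventually_elim (simp add: H0)
  qed
  also have "ennreal (1 / n) * (ennreal (n powr r * v) * ennreal (\<integral>x. x powr (- r - 1) * H a x \<partial>half_line)) =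
      ennreal (1 / n * ((n powr r * v) * (\<integral>x. x powr (- r - 1) * H a x \<partial>half_line)))"
    using n v by (simp only: ennreal_mult' mult_nonneg_nonneg powr_ge_zero less_imp_le divide_nonneg_pos zero_le_one)
  finally have eq: "ennreal (powr_const r) * moment r a = ennreal (1 / n * (n powr r * v) * (\<integral>x. x powr (- r - 1) * H a x \<partial>half_line))"
    by (simp only: mult.assoc)
  have "1 / n * (n powr r * v) = n powr (r - 1) * v" using n by (simp add: powr_diff)
  then have eq': "ennreal (powr_const r) * moment r a = ennreal (n powr (r - 1) * v * (\<integral>x. x powr (- r - 1) * H a x \<partial>half_line))"
    using eq by simp
  have "moment r a = ennreal (1 / powr_const r) * (ennreal (powr_const r) * moment r a)"
    using c by (simp flip: mult.assoc ennreal_mult)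
  also have "\<dots> = ennreal (n powr (r - 1) * v * (\<integral>x. x powr (- r - 1) * H a x \<partial>half_line) / powr_const r)"
    unfolding eq' using c by (simp flip: ennreal_mult' add: mult.commute)
  finally show ?case by (simp add: n_def v_def)
qed

text \<open>The explicit formula gives finiteness only for small drifts; a larger drift shortens the
  passage time.\<close>

lemma moment_finite:
  assumes a: "a > 0"
  shows "moment r a < \<top>"
proof -
  have "eventually (\<lambda>a'::real. a' < a) (at_right 0)"
    using a by (auto simp: eventually_at_right_field)
  from eventually_conj[OF this moment_asymptotic]
  obtain a' where a': "a' < a" "moment r a' = ennreal (real (N a') powr (r - 1) * exp (P (1 / real (N a'))) *
     (\<integral>x. x powr (- r - 1) * H a' x \<partial>half_line) / powr_const r)"
    using eventually_happens'[OF trivial_limit_at_right_real] by blast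
  have "moment r a \<le> moment r a'" using r_bounds a' by (intro moment_antimono) auto
  also have "\<dots> < \<top>" unfolding a'(2) by simp
  finally show ?thesis .
qed

definition mom :: "real \<Rightarrow> real" where "mom a = enn2real (moment r a)"

lemma moment_eq_mom: "a > 0 \<Longrightarrow> moment r a = ennreal (mom a)"
  unfolding mom_def using moment_finite[of a] by simp

lemma mom_pos: "a > 0 \<Longrightarrow> mom a > 0"
  using less_le_trans[OF zero_less_one moment_ge_1[of r a]] r_bounds moment_finite[of a]
  by (simp add: mom_def enn2real_positive_iff)

lemma mom_antimono: "0 < a \<Longrightarrow> a \<le> a' \<Longrightarrow> mom a' \<le> mom a"
  unfolding mom_def using moment_antimono[of r a a'] moment_finite[of a] r_bounds by (intro enn2real_mono) auto

text \<open>The integrals cancel in the limit, their common limit being positive. What remains is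
  \<open>s powr (r - 1 + \<rho>)\<close>, with \<open>s\<close> the limit ratio of the time
  scales.\<close>

lemma mom_quot:
  assumes c: "c > 0"
  shows "((\<lambda>a. mom (c * a) / mom a) \<longlongrightarrow> c powr (- (\<alpha> * (r + \<rho> - 1) / (\<alpha> - 1)))) (at_right 0)"
proof -
  obtain K where K: "K > 0" and lim: "((\<lambda>a. \<integral>x. x powr (- r - 1) * H a x \<partial>half_line) \<longlongrightarrow> K) (at_right 0)"
    using H_integral_limit(1)[OF r] by blast
  define I where "I a = (\<integral>x. x powr (- r - 1) * H a x \<partial>half_line)" for a
  have I: "(I \<longlongrightarrow> K) (at_right 0)" using lim by (simp add: I_def[abs_def])
  define s where "s = c powr (- \<alpha> / (\<alpha> - 1))"
  have s: "s > 0" using c by (simp add: s_def)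
  note fc = filterlim_scale_at_right[OF c]
  have Nq: "((\<lambda>a. real (N (c * a)) / real (N a)) \<longlongrightarrow> s) (at_right 0)" unfolding s_def by (rule N_quot[OF c])
  have ge1: "eventually (\<lambda>a. N (c * a) \<ge> 1) (at_right 0)"
    using eventually_compose_filterlim[OF eventually_N_ge[of 1] fc] .
  have PP: "((\<lambda>a. P (1 / real (N (c * a))) - P (1 / real (N a))) \<longlongrightarrow> \<rho> * ln s) (at_right 0)"
  proof (rule P_diff_limit)
    show "((\<lambda>a. 1 / real (N a)) \<longlongrightarrow> 0) (at_right 0)"
      by (intro tendsto_divide_0[OF tendsto_const] filterlim_at_top_imp_at_infinity N_real_at_top)
    then show "((\<lambda>a. 1 / real (N (c * a))) \<longlongrightarrow> 0) (at_right 0)" by (rule filterlim_compose[OF _ fc])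
    show "eventually (\<lambda>a. 1 / real (N (c * a)) > 0) (at_right 0)" using ge1 by eventually_elim simp
    show "eventually (\<lambda>a. 1 / real (N a) > 0) (at_right 0)" using eventually_N_ge[of 1] by eventually_elim simp
    show "((\<lambda>a. 1 / real (N a) / (1 / real (N (c * a)))) \<longlongrightarrow> s) (at_right 0)" using Nq by simp
  qed (rule s)
  have "((\<lambda>a. (real (N (c * a)) / real (N a)) powr (r - 1) * exp (P (1 / real (N (c * a))) - P (1 / real (N a))) * (I (c * a) / I a))
      \<longlongrightarrow> s powr (r - 1) * exp (\<rho> * ln s) * (K / K)) (at_right 0)"
    using K s by (intro tendsto_intros Nq PP I filterlim_compose[OF I fc]) auto
  moreover have "s powr (r - 1) * exp (\<rho> * ln s) * (K / K) = c powr (- (\<alpha> * (r + \<rho> - 1) / (\<alpha> - 1)))"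
  proof -
    have "s powr (r - 1) * exp (\<rho> * ln s) * (K / K) = s powr (r - 1) * s powr \<rho>" using s K by (simp add: powr_def)
    also have "\<dots> = s powr (r + \<rho> - 1)" by (simp flip: powr_add add: algebra_simps)
    also have "\<dots> = c powr (- (\<alpha> * (r + \<rho> - 1) / (\<alpha> - 1)))" by (simp add: s_def powr_powr)
    finally show ?thesis .
  qed
  moreover have "\<forall>\<^sub>F a in at_right 0. (real (N (c * a)) / real (N a)) powr (r - 1) * exp (P (1 / real (N (c * a))) - P (1 / real (N a))) * (I (c * a) / I a) = mom (c * a) / mom a"
    using eventually_N_ge[of 1] ge1 moment_asymptotic eventually_compose_filterlim[OF moment_asymptotic fc]
      order_tendstoD(1)[OF I K] eventually_compose_filterlim[OF order_tendstoD(1)[OF I K] fc]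
  proof eventually_elim
    case (elim a)
    have cp: "powr_const r > 0" by (rule powr_const_pos[OF r_bounds])
    have A: "mom a = real (N a) powr (r - 1) * exp (P (1 / real (N a))) * I a / powr_const r"
      using elim(3,5) cp by (simp add: mom_def I_def)
    have B: "mom (c * a) = real (N (c * a)) powr (r - 1) * exp (P (1 / real (N (c * a)))) * I (c * a) / powr_const r"
      using elim(4,6) cp by (simp add: mom_def I_def)
    show ?case unfolding A B using elim(1,2,5,6) cp by (simp add: powr_divide exp_diff divide_simps)
  qed
  ultimately show ?thesis using Lim_transform_eventually by fastforce
qed

text \<open>\<open>L\<close> is defined by solving the desired identity, which then holds for every
  \<open>a > 0\<close>; \<open>mom_quot\<close> is exactly its slow variation.\<close>

lemma slowly_varying_moment:
  defines "k \<equiv> \<alpha> * (r + \<rho> - 1) / (\<alpha> - 1)"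
  shows "\<exists>L. slowly_varying_at_infinity L \<and> (\<forall>a>0. moment r a = ennreal (L (1 / a) * a powr (- k)))"
proof (intro exI conjI allI impI)
  define L where "L x = mom (1 / x) * (1 / x) powr k" for x
  show "moment r a = ennreal (L (1 / a) * a powr (- k))" if "a > 0" for a
    using that moment_eq_mom[OF that] by (simp add: L_def mult.assoc flip: powr_add)
  show "slowly_varying_at_infinity L"
    unfolding slowly_varying_at_infinity_def
  proof (intro conjI exI[of _ 1] allI impI)
    show "L x > 0" if "x \<ge> 1" for x using that by (simp add: L_def mom_pos)
    \<comment> \<open>Extended by 0 below 1, the moment is a monotone function of
      \<open>x = 1 / a\<close> on the whole line, hence Borel.\<close>
    define h where "h x = (if x \<ge> 1 then mom (1 / x) else 0)" for x
    have "mono h"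
    proof (rule monoI)
      fix x y :: real assume "x \<le> y"
      then show "h x \<le> h y"
        by (auto simp: h_def intro!: mom_antimono frac_le less_imp_le[OF mom_pos])
    qed
    then have [measurable]: "h \<in> borel_measurable borel" by (rule borel_measurable_mono)
    have "(\<lambda>x. h x * (1 / x) powr k) \<in> borel_measurable borel" by measurable
    moreover have "indicat_real {1..} x *\<^sub>R L x = h x * (1 / x) powr k" for x by (simp add: h_def L_def)
    ultimately show "set_borel_measurable borel {1..} L" by (simp add: set_borel_measurable_def)
    fix c :: real assume c: "c > 0"
    have "((\<lambda>a. mom (1 / c * a) / mom a) \<longlongrightarrow> (1 / c) powr (- k)) (at_right 0)"
      unfolding k_def using c by (intro mom_quot) simp
    moreover have "filterlim (\<lambda>x::real. 1 / x) (at_right 0) at_top" by real_asymp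
    ultimately have "((\<lambda>x. mom (1 / c * (1 / x)) / mom (1 / x)) \<longlongrightarrow> (1 / c) powr (- k)) at_top"
      by (rule filterlim_compose)
    then have "((\<lambda>x. mom (1 / c * (1 / x)) / mom (1 / x) * (1 / c) powr k) \<longlongrightarrow> (1 / c) powr (- k) * (1 / c) powr k) at_top"
      by (intro tendsto_intros)
    moreover have "(1 / c) powr (- k) * (1 / c) powr k = 1" using c by (simp flip: powr_add)
    moreover have "\<forall>\<^sub>F x in at_top. mom (1 / c * (1 / x)) / mom (1 / x) * (1 / c) powr k = L (c * x) / L x"
      using eventually_gt_at_top[of 0]
    proof eventually_elim
      case (elim x)
      have "(1 / (c * x)) powr k = (1 / c) powr k * (1 / x) powr k" using c elim by (simp flip: powr_mult)
      then show ?case using c elim by (simp add: L_def)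
    qed
    ultimately show "((\<lambda>x. L (c * x) / L x) \<longlongrightarrow> 1) at_top"
      using Lim_transform_eventually by fastforce
  qed
qed

end

end

theorem theorem3:
  fixes M :: "'a measure" and X :: "nat \<Rightarrow> 'a \<Rightarrow> real"
    and \<mu> :: "real measure" and \<alpha> \<beta> \<rho> a\<^sub>0 :: real
  assumes "prob_space M"
    and "iid_sequence M X"
    and "integrable M (X 0)" and "prob_space.expectation M (X 0) = 0"
    and "a\<^sub>0 > 0"
    and "1 < \<alpha>" and "\<alpha> \<le> 2" and "\<bar>\<beta>\<bar> \<le> 1"
    and "in_domain_of_attraction \<alpha> \<beta> M X"
    and "stable_law \<alpha> \<beta> \<mu>" and "\<rho> = measure \<mu> {0..}"
  shows "\<forall>r. 1 - \<rho> < r \<and> r < \<alpha> \<longrightarrow>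
    (\<exists>L. slowly_varying_at_infinity L \<and>
      (\<forall>a. 0 < a \<and> a \<le> a\<^sub>0 \<longrightarrow>
        (\<integral>\<^sup>+\<omega>. enat_powr (first_negative_time X a \<omega>) r \<partial>M) =
          ennreal (L (1 / a) * a powr (- (\<alpha> * (r + \<rho> - 1) / (\<alpha> - 1))))))"
proof (intro allI impI)
  fix r assume r: "1 - \<rho> < r \<and> r < \<alpha>"
  obtain \<mu>' b where b: "stable_law \<alpha> \<beta> \<mu>'" "\<And>n. b n > 0"
    "weak_conv_m (\<lambda>n. distr M borel (\<lambda>\<omega>. (\<Sum>i=1..n. X i \<omega>) / b n)) \<mu>'"
    using assms(9) unfolding in_domain_of_attraction_def by blast
  \<comment> \<open>The limit law from the domain of attraction and the one defining
    \<open>\<rho>\<close> share their characteristic function.\<close>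
  have "\<mu>' = \<mu>"
    using b(1) assms(10) unfolding stable_law_def by (intro Levy_uniqueness) auto
  interpret prob_space M by fact
  interpret W: attracted_walk M X \<alpha> \<beta> \<mu> b
    by unfold_locales (use assms b \<open>\<mu>' = \<mu>\<close> in auto)
  have \<rho>: "W.\<rho> = \<rho>" using assms(11) by (simp add: W.\<rho>_def)
  obtain L where "slowly_varying_at_infinity L"
    "\<And>a. a > 0 \<Longrightarrow> W.moment r a = ennreal (L (1 / a) * a powr (- (\<alpha> * (r + \<rho> - 1) / (\<alpha> - 1))))"
    using W.slowly_varying_moment[of r] r unfolding \<rho> by blast
  then show "\<exists>L. slowly_varying_at_infinity L \<and>
      (\<forall>a. 0 < a \<and> a \<le> a\<^sub>0 \<longrightarrow>
        (\<integral>\<^sup>+\<omega>. enat_powr (first_negative_time X a \<omega>) r \<partial>M) =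
          ennreal (L (1 / a) * a powr (- (\<alpha> * (r + \<rho> - 1) / (\<alpha> - 1)))))"
    unfolding W.moment_def by blast
qed

end
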